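(* Let $1<p<\infty$, and for each $\epsilon>0$ let $\phi_\epsilon\in M_p^{(w)}(\mathbb Z)$. Let $\phi$ be a function on $\mathbb R$ and suppose that (i) $\lim_{\epsilon\to0}\phi_\epsilon\big(\big[\tfrac{x}{\epsilon}\big]\big)=\phi(x)$ for a.e. $x\in\mathbb R$; (ii) $\sup_{\epsilon>0}N_p^{(w)}(\phi_\epsilon)=K<\infty$. Then $\phi\in M_p^{(w)}(\mathbb R)$ and $N_p^{(w)}(\phi)\le\sup_{\epsilon>0}N_p^{(w)}(\phi_\epsilon)$.
   Context: $[y]$ denotes the integer part (floor) of $y\in\mathbb R$. Let $G$ be a locally compact abelian group with Haar measure $\mu$ and dual group $\hat G$ (here $G=\mathbb R$, $\hat G=\mathbb R$, or $G=\mathbb T\cong[0,1)$, $\hat G=\mathbb Z$, with Lebesgue measure; on $\mathbb R$ the Fourier transform is $\hat f(\xi)=\int f(x)e^{-2\pi i\xi x}dx$). $M_p^{(w)}(\hat G)$ is the space of multipliers of weak type $(p,p)$: those $\phi\in L^\infty(\hat G)$ for which there is a translation-invariant operator $T_\phi:L^p(G)\to L^{p,\infty}(G)$ with $(T_\phi f)^\wedge=\phi\hat f$ for all $f\in L^2\cap L^p(G)$ and a constant $C$ with $\mu\{x\in G:|T_\phi f(x)|>t\}\le\frac{C^p}{t^p}\|f\|_p^p$ for all $f\in L^p(G)$, $t>0$; $N_p^{(w)}(\phi)$ is the smallest such $C$. *)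

theory Defs
  imports "HOL-Analysis.Analysis"
begin

definition Lp :: "real \<Rightarrow> 'g measure \<Rightarrow> ('g \<Rightarrow> complex) set" where
  "Lp p M = {f \<in> borel_measurable M. integrable M (\<lambda>x. norm (f x) powr p)}"

definition Linfty :: "'g measure \<Rightarrow> ('g \<Rightarrow> complex) set" where
  "Linfty M = {f \<in> borel_measurable M. \<exists>B. AE x in M. norm (f x) \<le> B}"

definition weak_Lp :: "real \<Rightarrow> 'g measure \<Rightarrow> ('g \<Rightarrow> complex) set" where
  "weak_Lp p M = {f \<in> borel_measurable M. \<exists>A\<ge>0. \<forall>t>0.
     emeasure M {x \<in> space M. norm (f x) > t} \<le> ennreal (A powr p / t powr p)}"

(* Elements of L^p are represented by functions, so all identities between images
   hold almost everywhere.  tr y x stands for x - y in the group. *)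
definition translation_invariant_operator ::
  "real \<Rightarrow> 'g measure \<Rightarrow> ('g \<Rightarrow> 'g \<Rightarrow> 'g) \<Rightarrow> (('g \<Rightarrow> complex) \<Rightarrow> 'g \<Rightarrow> complex) \<Rightarrow> bool" where
  "translation_invariant_operator p M tr T \<longleftrightarrow>
     (\<forall>f\<in>Lp p M. T f \<in> weak_Lp p M) \<and>
     (\<forall>f\<in>Lp p M. \<forall>g\<in>Lp p M. (AE x in M. f x = g x) \<longrightarrow> (AE x in M. T f x = T g x)) \<and>
     (\<forall>f\<in>Lp p M. \<forall>g\<in>Lp p M. \<forall>a b.
        AE x in M. T (\<lambda>z. a * f z + b * g z) x = a * T f x + b * T g x) \<and>
     (\<forall>f\<in>Lp p M. \<forall>y\<in>space M. AE x in M. T (\<lambda>z. f (tr y z)) x = T f (tr y x))"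

(* ft f F: F is the L^2 Fourier transform of f (determined up to null sets).  In particular
   ft (T f) (\<lambda>\<xi>. \<phi> \<xi> * F \<xi>) includes that T f is in L^2, as it must be when \<phi> is bounded. *)
definition is_multiplier_operator ::
  "real \<Rightarrow> 'g measure \<Rightarrow> ('g \<Rightarrow> 'g \<Rightarrow> 'g) \<Rightarrow> (('g \<Rightarrow> complex) \<Rightarrow> ('d \<Rightarrow> complex) \<Rightarrow> bool)
    \<Rightarrow> ('d \<Rightarrow> complex) \<Rightarrow> (('g \<Rightarrow> complex) \<Rightarrow> 'g \<Rightarrow> complex) \<Rightarrow> bool" where
  "is_multiplier_operator p M tr ft \<phi> T \<longleftrightarrow>
     translation_invariant_operator p M tr T \<and>
     (\<forall>f \<in> Lp 2 M \<inter> Lp p M. \<exists>F. ft f F \<and> ft (T f) (\<lambda>\<xi>. \<phi> \<xi> * F \<xi>))"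

definition weak_type_bound ::
  "real \<Rightarrow> 'g measure \<Rightarrow> (('g \<Rightarrow> complex) \<Rightarrow> 'g \<Rightarrow> complex) \<Rightarrow> real \<Rightarrow> bool" where
  "weak_type_bound p M T C \<longleftrightarrow> 0 \<le> C \<and>
     (\<forall>f\<in>Lp p M. \<forall>t>0. emeasure M {x \<in> space M. norm (T f x) > t}
        \<le> ennreal (C powr p / t powr p * (LINT x|M. norm (f x) powr p)))"

definition weak_multipliers ::
  "real \<Rightarrow> 'g measure \<Rightarrow> ('g \<Rightarrow> 'g \<Rightarrow> 'g) \<Rightarrow> 'd measure
    \<Rightarrow> (('g \<Rightarrow> complex) \<Rightarrow> ('d \<Rightarrow> complex) \<Rightarrow> bool) \<Rightarrow> ('d \<Rightarrow> complex) set" where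
  "weak_multipliers p M tr N ft =
     {\<phi> \<in> Linfty N. \<exists>T C. is_multiplier_operator p M tr ft \<phi> T \<and> weak_type_bound p M T C}"

(* The operator of a multiplier is unique by density of L^2 \<inter> L^p in L^p, so the infimum
   is the smallest constant.  The value is meaningful for multipliers only. *)
definition weak_multiplier_norm ::
  "real \<Rightarrow> 'g measure \<Rightarrow> ('g \<Rightarrow> 'g \<Rightarrow> 'g)
    \<Rightarrow> (('g \<Rightarrow> complex) \<Rightarrow> ('d \<Rightarrow> complex) \<Rightarrow> bool) \<Rightarrow> ('d \<Rightarrow> complex) \<Rightarrow> real" where
  "weak_multiplier_norm p M tr ft \<phi> =
     Inf {C. \<exists>T. is_multiplier_operator p M tr ft \<phi> T \<and> weak_type_bound p M T C}"

definition fourier_integral :: "(real \<Rightarrow> complex) \<Rightarrow> real \<Rightarrow> complex" where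
  "fourier_integral f \<xi> = (LINT x|lebesgue. f x * cis (- (2 * pi * \<xi> * x)))"

(* The transform on L^2(R) is the continuous extension from L^1 \<inter> L^2. *)
definition has_fourier_real :: "(real \<Rightarrow> complex) \<Rightarrow> (real \<Rightarrow> complex) \<Rightarrow> bool" where
  "has_fourier_real f F \<longleftrightarrow> f \<in> Lp 2 lebesgue \<and> F \<in> Lp 2 lebesgue \<and>
     (\<exists>g :: nat \<Rightarrow> real \<Rightarrow> complex.
        (\<forall>n. g n \<in> Lp 1 lebesgue \<inter> Lp 2 lebesgue) \<and>
        (\<lambda>n. \<integral>\<^sup>+x. ennreal ((norm (g n x - f x))\<^sup>2) \<partial>lebesgue) \<longlonglongrightarrow> 0 \<and>
        (\<lambda>n. \<integral>\<^sup>+\<xi>. ennreal ((norm (fourier_integral (g n) \<xi> - F \<xi>))\<^sup>2) \<partial>lebesgue) \<longlonglongrightarrow> 0)"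

abbreviation circle :: "real measure" where
  "circle \<equiv> lebesgue_on {0..<1}"

(* L^2 is contained in L^1 here, so the coefficients are given by the integral. *)
definition has_fourier_circle :: "(real \<Rightarrow> complex) \<Rightarrow> (int \<Rightarrow> complex) \<Rightarrow> bool" where
  "has_fourier_circle f F \<longleftrightarrow> f \<in> Lp 2 circle \<and>
     (\<forall>n. F n = (LINT x|circle. f x * cis (- (2 * pi * of_int n * x))))"

definition weak_multipliers_real :: "real \<Rightarrow> (real \<Rightarrow> complex) set" where
  "weak_multipliers_real p =
     weak_multipliers p lebesgue (\<lambda>y x. x - y) lebesgue has_fourier_real"

definition weak_norm_real :: "real \<Rightarrow> (real \<Rightarrow> complex) \<Rightarrow> real" where
  "weak_norm_real p = weak_multiplier_norm p lebesgue (\<lambda>y x. x - y) has_fourier_real"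

definition weak_multipliers_int :: "real \<Rightarrow> (int \<Rightarrow> complex) set" where
  "weak_multipliers_int p =
     weak_multipliers p circle (\<lambda>y x. frac (x - y)) (count_space UNIV) has_fourier_circle"

definition weak_norm_int :: "real \<Rightarrow> (int \<Rightarrow> complex) \<Rightarrow> real" where
  "weak_norm_int p = weak_multiplier_norm p circle (\<lambda>y x. frac (x - y)) has_fourier_circle"

end

theory Submission imports Defs "HOL-Probability.Sinc_Integral"
begin

text \<open>
  Why the theorem holds. Take \<open>f\<close> on the line, of compact support contained in \<open>[0, S]\<close>. If \<open>\<epsilon> S < 1\<close>, the
  function \<open>x \<mapsto> f (x / \<epsilon>)\<close> lives on one period of the circle and its \<open>n\<close>-th Fourier coefficient is \<open>\<epsilon>\<close>
  times the Fourier transform of \<open>f\<close> at \<open>\<epsilon> n\<close>. The operator with symbol \<open>\<Phi> \<epsilon>\<close> therefore sends it to a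
  character series whose value at \<open>\<epsilon> y\<close> is a Riemann sum, with mesh \<open>\<epsilon>\<close>, for the integral that defines the
  multiplier transform of \<open>f\<close> with symbol \<open>\<phi>\<close> at \<open>y\<close>; when the transform of \<open>f\<close> decays quadratically,
  dominated convergence gives the limit (\<open>sampled_series_tendsto\<close>). The dilation by \<open>\<epsilon>\<close> changes the measure
  of a level set and the \<open>p\<close>-th power of the norm by the same factor, so the weak type constant is
  unchanged (\<open>rescaled_series_weak_bound\<close>), and Fatou's lemma carries the inequality to the limit
  (\<open>test_function_weak_bound\<close>). Functions whose support is not in \<open>[0, S]\<close> are translated there.

  This controls the multiplier transform on a class of test functions. They are dense in \<open>L\<^sup>p\<close> and in
  \<open>L\<^sup>2\<close> at once (\<open>test_functions_dense\<close>), and by the weak type bound the images of an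
  approximating sequence are Cauchy in measure. Hence the operator extends to \<open>L\<^sup>p\<close> with the same
  constant; that bound also makes the extension unique up to null sets, which yields linearity and
  translation invariance (\<open>multiplier_operator_exists\<close>).

  The extended operator must multiply Fourier transforms by \<open>\<phi>\<close> on all of \<open>L\<^sup>2 \<inter> L\<^sup>p\<close>. The \<open>L\<^sup>2\<close> theory
  used for that rests on one completeness statement, the uniqueness of Fourier coefficients on the
  circle (\<open>fourier_coefficients_unique\<close>). The Riemann sum argument with the constant symbol 1
  turns it into Fourier inversion for test functions; inversion and Fubini give Plancherel's identity,
  and density gives the inverse transform of any function in \<open>L\<^sup>1 \<inter> L\<^sup>2\<close> (\<open>inverse_fourier_transform\<close>).

  A multiplier norm is defined as an infimum, so on the circle only operators with a constant slightly
  above the supremum \<open>K\<close> are at hand. The bound for test functions is proved with the constants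
  \<open>K + 1 / (n + 1)\<close>, and letting \<open>n\<close> tend to infinity gives it with \<open>K\<close> itself.
\<close>

section \<open>Powers of norms and convergence in measure\<close>

text \<open>One of the two summands dominates: if \<open>b\<close> is at most \<open>s\<close> times as large as \<open>a\<close>, the sum is
  at most \<open>1 + s\<close> times \<open>a\<close>, and otherwise at most \<open>1 + 1/s\<close> times \<open>b\<close>. A small \<open>s\<close> makes the
  first coefficient almost 1. This replaces Minkowski's inequality when norms pass to a limit
  without loss in the constant; \<open>s = 1\<close> serves as a triangle inequality elsewhere.\<close>
lemma norm_add_powr_le:
  fixes a b :: "'a::real_normed_vector"
  assumes s: "s > 0" and q: "q > 0"
  shows "norm (a + b) powr q \<le> (1 + s) powr q * norm a powr q + (1 + 1/s) powr q * norm b powr q"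
proof (cases "norm b \<le> s * norm a")
  case True
  have "norm (a + b) \<le> (1 + s) * norm a"
    using True norm_triangle_ineq[of a b] by (simp add: algebra_simps)
  then have "norm (a + b) powr q \<le> ((1 + s) * norm a) powr q"
    using q by (intro powr_mono2) auto
  also have "\<dots> = (1 + s) powr q * norm a powr q"
    using s by (simp add: powr_mult)
  finally show ?thesis
    by (smt (verit) mult_nonneg_nonneg powr_ge_zero)
next
  case False
  then have "norm a \<le> (1/s) * norm b"
    using s by (simp add: field_simps)
  then have "norm (a + b) \<le> (1 + 1/s) * norm b"
    using norm_triangle_ineq[of a b] by (simp add: algebra_simps)
  then have "norm (a + b) powr q \<le> ((1 + 1/s) * norm b) powr q"
    using q by (intro powr_mono2) auto
  also have "\<dots> = (1 + 1/s) powr q * norm b powr q"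
    using s by (simp add: powr_mult)
  finally show ?thesis
    by (smt (verit) mult_nonneg_nonneg powr_ge_zero)
qed

text \<open>The \<open>q\<close>-th power of the \<open>L\<^sup>q\<close> norm, as an extended nonnegative number, so that it can be
  estimated before it is known to be finite.\<close>
definition power_mass :: "real \<Rightarrow> 'g measure \<Rightarrow> ('g \<Rightarrow> complex) \<Rightarrow> ennreal" where
  "power_mass q M f = (\<integral>\<^sup>+x. ennreal (norm (f x) powr q) \<partial>M)"

lemma power_mass_two: "power_mass 2 M f = (\<integral>\<^sup>+x. ennreal ((norm (f x))\<^sup>2) \<partial>M)"
  unfolding power_mass_def by (simp add: powr_numeral)

lemma Lp_iff: "f \<in> Lp q M \<longleftrightarrow> f \<in> borel_measurable M \<and> power_mass q M f < \<infinity>"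
  unfolding Lp_def power_mass_def by (auto simp: integrable_iff_bounded)

lemma Lp_measurable: "f \<in> Lp q M \<Longrightarrow> f \<in> borel_measurable M"
  by (simp add: Lp_def)

lemma power_mass_eq_integral:
  "f \<in> Lp q M \<Longrightarrow> power_mass q M f = ennreal (LINT x|M. norm (f x) powr q)"
  unfolding Lp_def power_mass_def by (subst nn_integral_eq_integral) auto

lemma power_mass_cong_AE:
  "AE x in M. f x = g x \<Longrightarrow> power_mass q M f = power_mass q M g"
  unfolding power_mass_def by (intro nn_integral_cong_AE) auto

lemma power_mass_mono_AE:
  "AE x in M. norm (f x) \<le> norm (g x) \<Longrightarrow> q \<ge> 0 \<Longrightarrow> power_mass q M f \<le> power_mass q M g"
  unfolding power_mass_def by (intro nn_integral_mono_AE) (auto intro!: ennreal_leI powr_mono2)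

lemma power_mass_add:
  assumes [measurable]: "f \<in> borel_measurable M" "g \<in> borel_measurable M"
    and s: "s > 0" and q: "q > 0"
  shows "power_mass q M (\<lambda>x. f x + g x)
    \<le> ennreal ((1 + s) powr q) * power_mass q M f + ennreal ((1 + 1/s) powr q) * power_mass q M g"
proof -
  have "power_mass q M (\<lambda>x. f x + g x) \<le>
    (\<integral>\<^sup>+x. ennreal ((1 + s) powr q) * ennreal (norm (f x) powr q)
        + ennreal ((1 + 1/s) powr q) * ennreal (norm (g x) powr q) \<partial>M)"
    unfolding power_mass_def
    by (intro nn_integral_mono)
      (simp add: norm_add_powr_le[OF s q] ennreal_leI flip: ennreal_mult ennreal_plus)
  also have "\<dots> = ennreal ((1 + s) powr q) * power_mass q M f
      + ennreal ((1 + 1/s) powr q) * power_mass q M g"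
    unfolding power_mass_def by (simp add: nn_integral_add nn_integral_cmult)
  finally show ?thesis .
qed

lemma power_mass_cmult:
  assumes [measurable]: "f \<in> borel_measurable M"
  shows "power_mass q M (\<lambda>x. c * f x) = ennreal (norm c powr q) * power_mass q M f"
  unfolding power_mass_def
  by (simp add: norm_mult powr_mult ennreal_mult nn_integral_cmult)

abbreviation diff_mass :: "real \<Rightarrow> (real \<Rightarrow> complex) \<Rightarrow> (real \<Rightarrow> complex) \<Rightarrow> ennreal" where
  "diff_mass q f g \<equiv> power_mass q lebesgue (\<lambda>x. f x - g x)"

abbreviation converges_Lp :: "real \<Rightarrow> (nat \<Rightarrow> real \<Rightarrow> complex) \<Rightarrow> (real \<Rightarrow> complex) \<Rightarrow> bool" where
  "converges_Lp q d f \<equiv> (\<lambda>n. diff_mass q (d n) f) \<longlonglongrightarrow> 0"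

lemma power_mass_minus_commute:
  "power_mass q M (\<lambda>x. f x - g x) = power_mass q M (\<lambda>x. g x - f x)"
  unfolding power_mass_def by (simp add: norm_minus_commute)

lemma power_mass_diff_triangle:
  assumes [measurable]: "f \<in> borel_measurable M" "g \<in> borel_measurable M" "h \<in> borel_measurable M"
    and q: "q > 0"
  shows "power_mass q M (\<lambda>x. f x - h x)
    \<le> ennreal (2 powr q) * (power_mass q M (\<lambda>x. f x - g x) + power_mass q M (\<lambda>x. g x - h x))"
  using power_mass_add[of "\<lambda>x. f x - g x" M "\<lambda>x. g x - h x" 1 q] q
  by (simp add: distrib_left)

lemma Lp_linear:
  assumes f: "f \<in> Lp q M" and g: "g \<in> Lp q M" and q: "q > 0"
  shows "(\<lambda>x. a * f x + b * g x) \<in> Lp q M"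
proof -
  note [measurable] = Lp_measurable[OF f] Lp_measurable[OF g]
  have "power_mass q M (\<lambda>x. a * f x + b * g x) \<le>
    ennreal ((1 + 1) powr q) * (ennreal (norm a powr q) * power_mass q M f)
    + ennreal ((1 + 1/1) powr q) * (ennreal (norm b powr q) * power_mass q M g)"
    using power_mass_add[of "\<lambda>x. a * f x" M "\<lambda>x. b * g x" 1 q] q
    by (simp add: power_mass_cmult)
  also have "\<dots> < \<infinity>"
    using f g by (auto simp: Lp_iff ennreal_mult_less_top)
  finally show ?thesis by (simp add: Lp_iff)
qed

text \<open>A measurable function at finite distance from an element of \<open>L\<^sup>q\<close> belongs to it; this puts
  the limits constructed below into the right space.\<close>
lemma Lp_if_close:
  assumes f: "f \<in> Lp q M" and g: "g \<in> borel_measurable M" and q: "q > 0"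
    and fin: "power_mass q M (\<lambda>x. g x - f x) < \<infinity>"
  shows "g \<in> Lp q M"
  using Lp_linear[of "\<lambda>x. g x - f x" q M f 1 1] f g q fin Lp_measurable[OF f]
  by (simp add: Lp_iff)

lemma power_mass_Fatou:
  assumes [measurable]: "\<And>n. u n \<in> borel_measurable M" "v \<in> borel_measurable M"
    and lim: "AE x in M. (\<lambda>n. u n x) \<longlonglongrightarrow> v x" and q: "q > 0"
  shows "power_mass q M v \<le> liminf (\<lambda>n. power_mass q M (u n))"
proof -
  have "power_mass q M v = (\<integral>\<^sup>+x. liminf (\<lambda>n. ennreal (norm (u n x) powr q)) \<partial>M)"
    unfolding power_mass_def
  proof (intro nn_integral_cong_AE, use lim in eventually_elim)
    case (elim x)
    have "(\<lambda>n. norm (u n x) powr q) \<longlonglongrightarrow> norm (v x) powr q"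
      using elim q by (intro tendsto_powr2 tendsto_norm tendsto_const) auto
    then have "(\<lambda>n. ennreal (norm (u n x) powr q)) \<longlonglongrightarrow> ennreal (norm (v x) powr q)"
      by (rule tendsto_ennrealI)
    from lim_imp_Liminf[OF _ this] show ?case by simp
  qed
  also have "\<dots> \<le> liminf (\<lambda>n. power_mass q M (u n))"
    unfolding power_mass_def by (intro nn_integral_liminf) auto
  finally show ?thesis .
qed

lemma tendsto_0_if_eventually_le_ennreal:
  fixes u :: "'b \<Rightarrow> ennreal"
  assumes "\<And>\<eta>. \<eta> > 0 \<Longrightarrow> eventually (\<lambda>n. u n \<le> ennreal \<eta>) F"
  shows "(u \<longlongrightarrow> 0) F"
proof (rule order_tendstoI)
  fix a :: ennreal assume "0 < a"
  then obtain e where e: "0 < e" "e < a" using dense by blast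
  then have "e < top" by (meson less_le_trans top_greatest)
  then have "ennreal (enn2real e) = e" by simp
  moreover have "enn2real e > 0" using e \<open>e < top\<close> by (simp add: enn2real_positive_iff)
  ultimately show "eventually (\<lambda>n. u n < a) F"
    using assms[of "enn2real e"] e by (auto elim!: eventually_mono)
qed (auto)

lemma liminf_le_if_eventually:
  fixes c :: ennreal
  assumes "eventually (\<lambda>n. u n \<le> c) sequentially"
  shows "liminf u \<le> c"
proof -
  have "liminf u \<le> liminf (\<lambda>_. c)" using assms by (rule Liminf_mono)
  then show ?thesis by (simp add: Liminf_const)
qed

lemma power_mass_le_of_AE_limit:
  assumes "\<And>n. u n \<in> borel_measurable M" "v \<in> borel_measurable M"
    and "AE x in M. (\<lambda>n. u n x) \<longlonglongrightarrow> v x" and "q > 0"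
    and "eventually (\<lambda>n. power_mass q M (u n) \<le> c) sequentially"
  shows "power_mass q M v \<le> c"
  using power_mass_Fatou[OF assms(1-4)] liminf_le_if_eventually[OF assms(5)] by (rule order_trans)

text \<open>If the limit exceeds \<open>t\<close> at a point, the approximants eventually do so too, because the
  inequality is strict. The claim is then Fatou's lemma for indicator functions. This is how weak
  type bounds survive limits.\<close>
lemma emeasure_level_Fatou:
  fixes u :: "nat \<Rightarrow> 'g \<Rightarrow> complex"
  assumes [measurable]: "\<And>n. u n \<in> borel_measurable M" "v \<in> borel_measurable M"
    and lim: "AE x in M. (\<lambda>n. u n x) \<longlonglongrightarrow> v x"
  shows "emeasure M {x \<in> space M. norm (v x) > t} \<le> liminf (\<lambda>n. emeasure M {x \<in> space M. norm (u n x) > t})"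
proof -
  have "emeasure M {x \<in> space M. norm (v x) > t}
      = (\<integral>\<^sup>+x. indicator {x \<in> space M. norm (v x) > t} x \<partial>M)"
    by (subst nn_integral_indicator) auto
  also have "\<dots> \<le> (\<integral>\<^sup>+x. liminf (\<lambda>n. indicator {x \<in> space M. norm (u n x) > t} x) \<partial>M)"
  proof (intro nn_integral_mono_AE, use lim in eventually_elim)
    case (elim x)
    show ?case
    proof (cases "x \<in> space M \<and> norm (v x) > t")
      case True
      have "(\<lambda>n. norm (u n x)) \<longlonglongrightarrow> norm (v x)"
        using elim by (rule tendsto_norm)
      then have "eventually (\<lambda>n. norm (u n x) > t) sequentially"
        using True by (auto dest: order_tendstoD)
      then have "eventually (\<lambda>n. (1::ennreal) \<le> indicator {x \<in> space M. norm (u n x) > t} x) sequentially"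
        by eventually_elim (use True in auto)
      then have "(1::ennreal) \<le> liminf (\<lambda>n. indicator {x \<in> space M. norm (u n x) > t} x)"
        by (rule Liminf_bounded)
      then show ?thesis using True by (simp add: indicator_def)
    qed auto
  qed
  also have "\<dots> \<le> liminf (\<lambda>n. \<integral>\<^sup>+x. indicator {x \<in> space M. norm (u n x) > t} x \<partial>M)"
    by (intro nn_integral_liminf) auto
  also have "\<dots> = liminf (\<lambda>n. emeasure M {x \<in> space M. norm (u n x) > t})"
    by (subst nn_integral_indicator) auto
  finally show ?thesis .
qed

lemma emeasure_level_le_of_AE_limit:
  fixes u :: "nat \<Rightarrow> 'g \<Rightarrow> complex"
  assumes "\<And>n. u n \<in> borel_measurable M" "v \<in> borel_measurable M"
    and "AE x in M. (\<lambda>n. u n x) \<longlonglongrightarrow> v x"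
    and "eventually (\<lambda>n. emeasure M {x \<in> space M. norm (u n x) > t} \<le> c) sequentially"
  shows "emeasure M {x \<in> space M. norm (v x) > t} \<le> c"
  using emeasure_level_Fatou[OF assms(1-3)] liminf_le_if_eventually[OF assms(4)] by (rule order_trans)

lemma emeasure_level_le_power_mass:
  assumes [measurable]: "f \<in> borel_measurable M" and t: "t > 0" and q: "q > 0"
  shows "emeasure M {x \<in> space M. norm (f x) > t} \<le> ennreal (1 / t powr q) * power_mass q M f"
proof -
  have "emeasure M {x \<in> space M. norm (f x) > t}
      = (\<integral>\<^sup>+x. indicator {x \<in> space M. norm (f x) > t} x \<partial>M)"
    by (subst nn_integral_indicator) auto
  also have "\<dots> \<le> (\<integral>\<^sup>+x. ennreal (1 / t powr q) * ennreal (norm (f x) powr q) \<partial>M)"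
  proof (intro nn_integral_mono)
    fix x
    have "1 \<le> 1 / t powr q * norm (f x) powr q" if "norm (f x) > t"
      using that t q powr_mono2[of q t "norm (f x)"] by (simp add: field_simps)
    then show "indicator {x \<in> space M. norm (f x) > t} x \<le> ennreal (1 / t powr q) * ennreal (norm (f x) powr q)"
      by (cases "norm (f x) > t") (simp_all add: indicator_def flip: ennreal_mult)
  qed
  also have "\<dots> = ennreal (1 / t powr q) * power_mass q M f"
    unfolding power_mass_def by (simp add: nn_integral_cmult)
  finally show ?thesis .
qed

text \<open>Along a subsequence, consecutive terms differ by more than \<open>2\<^sup>-\<^sup>k\<close> only on a set of
  measure at most \<open>2\<^sup>-\<^sup>k\<close>. By the Borel--Cantelli lemma almost every point lies in finitely many
  of these sets, and there the differences are dominated by a geometric series.\<close>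
lemma Cauchy_in_measure_imp_AE_subseq:
  fixes u :: "nat \<Rightarrow> 'g \<Rightarrow> complex"
  assumes meas[measurable]: "\<And>n. u n \<in> borel_measurable M"
    and cauchy: "\<And>t \<eta>. t > 0 \<Longrightarrow> \<eta> > 0 \<Longrightarrow>
      \<exists>N. \<forall>n\<ge>N. \<forall>m\<ge>N. emeasure M {x \<in> space M. norm (u n x - u m x) > t} \<le> ennreal \<eta>"
  obtains r h where "strict_mono r" "h \<in> borel_measurable M" "AE x in M. (\<lambda>k. u (r k) x) \<longlonglongrightarrow> h x"
proof -
  have "\<exists>N. \<forall>k. \<forall>n\<ge>N k. \<forall>m\<ge>N k.
      emeasure M {x \<in> space M. norm (u n x - u m x) > (1/2)^k} \<le> ennreal ((1/2)^k)"
  proof (rule choice, rule allI)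
    fix k :: nat
    have "(0::real) < (1/2)^k" by simp
    then show "\<exists>y. \<forall>n\<ge>y. \<forall>m\<ge>y. emeasure M {x \<in> space M. norm (u n x - u m x) > (1/2)^k} \<le> ennreal ((1/2)^k)"
      using cauchy by blast
  qed
  then obtain N where N: "\<And>k n m. n \<ge> N k \<Longrightarrow> m \<ge> N k \<Longrightarrow>
      emeasure M {x \<in> space M. norm (u n x - u m x) > (1/2)^k} \<le> ennreal ((1/2)^k)"
    by blast
  \<comment> \<open>Summing the thresholds makes the subsequence strictly increasing.\<close>
  define r where "r k = (\<Sum>i\<le>k. N i) + k" for k
  have r: "strict_mono r" unfolding strict_mono_Suc_iff r_def by simp
  have rN: "r k \<ge> N k" for k
    unfolding r_def using member_le_sum[of k "{..k}" N] by simp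
  define A where "A k = {x \<in> space M. norm (u (r k) x - u (r (Suc k)) x) > (1/2)^k}" for k
  have [measurable]: "A k \<in> sets M" for k unfolding A_def by measurable
  have Ale: "emeasure M (A k) \<le> ennreal ((1/2)^k)" for k
  proof -
    have "r (Suc k) \<ge> r k" using r by (simp add: strict_mono_less_eq)
    then show ?thesis unfolding A_def using rN[of k] by (intro N) auto
  qed
  have fin: "emeasure M (A k) < \<infinity>" for k
    by (rule le_less_trans[OF Ale]) simp
  have mle: "norm (measure M (A k)) \<le> (1/2)^k" for k
    using Ale[of k] fin[of k] by (simp add: emeasure_eq_ennreal_measure)
  have "summable (\<lambda>k. (1/2::real)^k)" by (rule summable_geometric) simp
  then have "summable (\<lambda>k. measure M (A k))"
    by (rule summable_comparison_test') (rule mle)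
  from borel_cantelli_AE1[OF _ fin this]
  have "AE x in M. eventually (\<lambda>k. x \<in> space M - A k) sequentially" by simp
  then have conv: "AE x in M. convergent (\<lambda>k. u (r k) x)"
  proof eventually_elim
    case (elim x)
    then have "eventually (\<lambda>k. norm (u (r (Suc k)) x - u (r k) x) \<le> (1/2)^k) sequentially"
      by eventually_elim (auto simp: A_def norm_minus_commute)
    then have "summable (\<lambda>k. u (r (Suc k)) x - u (r k) x)"
      by (rule summable_comparison_test_ev) auto
    then have "convergent (\<lambda>n. \<Sum>k<n. u (r (Suc k)) x - u (r k) x)"
      by (simp add: summable_iff_convergent)
    then have "convergent (\<lambda>n. u (r n) x - u (r 0) x)"
      by (simp only: sum_lessThan_telescope[of "\<lambda>n. u (r n) x"])
    then have "convergent (\<lambda>n. (u (r n) x - u (r 0) x) + u (r 0) x)"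
      by (intro convergent_add convergent_const)
    then show ?case by simp
  qed
  define h where "h x = lim (\<lambda>k. u (r k) x)" for x
  have "h \<in> borel_measurable M" unfolding h_def by measurable
  moreover have "AE x in M. (\<lambda>k. u (r k) x) \<longlonglongrightarrow> h x"
    using conv by eventually_elim (simp add: h_def convergent_LIMSEQ_iff)
  ultimately show thesis using r that by blast
qed

text \<open>Turns smallness in \<open>L\<^sup>q\<close> into smallness of level sets, in the form that the Cauchy
  condition in measure asks for.\<close>
lemma emeasure_level_small:
  assumes t: "t > 0" and q: "q > 0" and \<eta>: "\<eta> > 0" and C: "C \<ge> 0"
  obtains \<delta> where "\<delta> > 0" "\<And>y. y < ennreal \<delta> \<Longrightarrow> ennreal (C / t powr q) * y \<le> ennreal \<eta>"
proof
  define \<delta> where "\<delta> = \<eta> / (C / t powr q + 1)"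
  have pos: "C / t powr q \<ge> 0" using C by simp
  show "\<delta> > 0" unfolding \<delta>_def using \<eta> pos by (intro divide_pos_pos) auto
  fix y assume "y < ennreal \<delta>"
  then have "ennreal (C / t powr q) * y \<le> ennreal (C / t powr q) * ennreal \<delta>"
    by (intro mult_left_mono) auto
  also have "\<dots> = ennreal (C / t powr q * \<delta>)"
    using pos \<open>\<delta> > 0\<close> by (intro ennreal_mult[symmetric]) auto
  also have "\<dots> \<le> ennreal \<eta>"
  proof (rule ennreal_leI)
    show "C / t powr q * \<delta> \<le> \<eta>"
      unfolding \<delta>_def using pos \<eta> by (simp only: times_divide_eq_right) (subst pos_divide_le_eq, auto simp: algebra_simps)
  qed
  finally show "ennreal (C / t powr q) * y \<le> ennreal \<eta>" .
qed

text \<open>An \<open>L\<^sup>q\<close> Cauchy sequence is Cauchy in measure by Chebyshev's inequality, so a subsequence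
  converges almost everywhere; Fatou's lemma, applied to \<open>f\<^sub>n - f\<^sub>r\<^sub>k\<close> as \<open>k\<close> grows, bounds the
  distance of \<open>f\<^sub>n\<close> from that limit.\<close>
lemma Lp_complete:
  assumes f: "\<And>n. f n \<in> Lp q M" and q: "q > 0"
    and cauchy: "\<And>\<eta>. \<eta> > 0 \<Longrightarrow> \<exists>N. \<forall>n\<ge>N. \<forall>m\<ge>N. power_mass q M (\<lambda>x. f n x - f m x) < ennreal \<eta>"
  obtains h r where "h \<in> Lp q M" "(\<lambda>n. power_mass q M (\<lambda>x. f n x - h x)) \<longlonglongrightarrow> 0"
    "strict_mono r" "AE x in M. (\<lambda>k. f (r k) x) \<longlonglongrightarrow> h x"
proof -
  note [measurable] = Lp_measurable[OF f]
  have 1: "\<exists>N. \<forall>n\<ge>N. \<forall>m\<ge>N. emeasure M {x \<in> space M. norm (f n x - f m x) > t} \<le> ennreal \<eta>"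
    if t: "t > 0" and \<eta>: "\<eta> > 0" for t \<eta>
  proof -
    obtain \<delta> where \<delta>: "\<delta> > 0" "\<And>y. y < ennreal \<delta> \<Longrightarrow> ennreal (1 / t powr q) * y \<le> ennreal \<eta>"
      using emeasure_level_small[OF t q \<eta>, of 1] by auto
    obtain N where N: "\<forall>n\<ge>N. \<forall>m\<ge>N. power_mass q M (\<lambda>x. f n x - f m x) < ennreal \<delta>"
      using cauchy[OF \<delta>(1)] by blast
    show ?thesis
    proof (intro exI[of _ N] allI impI)
      fix n m assume "N \<le> n" "N \<le> m"
      then have "ennreal (1 / t powr q) * power_mass q M (\<lambda>x. f n x - f m x) \<le> ennreal \<eta>"
        using N \<delta> by blast
      moreover have "emeasure M {x \<in> space M. norm (f n x - f m x) > t}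
        \<le> ennreal (1 / t powr q) * power_mass q M (\<lambda>x. f n x - f m x)"
        by (intro emeasure_level_le_power_mass t q) measurable
      ultimately show "emeasure M {x \<in> space M. norm (f n x - f m x) > t} \<le> ennreal \<eta>" by simp
    qed
  qed
  obtain r h where r: "strict_mono r" and [measurable]: "h \<in> borel_measurable M"
    and lim: "AE x in M. (\<lambda>k. f (r k) x) \<longlonglongrightarrow> h x"
    by (rule Cauchy_in_measure_imp_AE_subseq[of f M]) (use 1 in auto)
  have le: "\<exists>N. \<forall>n\<ge>N. power_mass q M (\<lambda>x. f n x - h x) \<le> ennreal \<eta>" if \<eta>: "\<eta> > 0" for \<eta>
  proof -
    obtain N where N: "\<forall>n\<ge>N. \<forall>m\<ge>N. power_mass q M (\<lambda>x. f n x - f m x) < ennreal \<eta>"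
      using cauchy[OF \<eta>] by blast
    have "power_mass q M (\<lambda>x. f n x - h x) \<le> ennreal \<eta>" if n: "n \<ge> N" for n
    proof (rule power_mass_le_of_AE_limit[where u="\<lambda>k x. f n x - f (r k) x"])
      show "AE x in M. (\<lambda>k. f n x - f (r k) x) \<longlonglongrightarrow> f n x - h x"
        using lim by eventually_elim (intro tendsto_intros)
      have "r k \<ge> N" if "k \<ge> N" for k
        using that seq_suble[OF r, of k] by linarith
      then show "\<forall>\<^sub>F k in sequentially. power_mass q M (\<lambda>x. f n x - f (r k) x) \<le> ennreal \<eta>"
        using N n by (intro eventually_sequentiallyI[of N]) (auto intro: less_imp_le)
    qed (use q in measurable)
    then show ?thesis by blast
  qed
  have "(\<lambda>n. power_mass q M (\<lambda>x. f n x - h x)) \<longlonglongrightarrow> 0"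
  proof (rule tendsto_0_if_eventually_le_ennreal)
    fix \<eta> :: real assume "\<eta> > 0"
    then show "eventually (\<lambda>n. power_mass q M (\<lambda>x. f n x - h x) \<le> ennreal \<eta>) sequentially"
      using le by (simp add: eventually_sequentially)
  qed
  moreover have "h \<in> Lp q M"
  proof -
    obtain N where N: "\<forall>n\<ge>N. power_mass q M (\<lambda>x. f n x - h x) \<le> ennreal 1"
      using le[of 1] zero_less_one by blast
    then have "power_mass q M (\<lambda>x. h x - f N x) \<le> ennreal 1"
      by (subst power_mass_minus_commute) simp
    then have "power_mass q M (\<lambda>x. h x - f N x) < \<infinity>"
      by (rule le_less_trans) simp
    with f \<open>h \<in> borel_measurable M\<close> q show ?thesis by (rule Lp_if_close)
  qed
  ultimately show thesis using that r lim by blast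
qed

section \<open>Density of test functions\<close>

text \<open>A measurable function is an almost everywhere limit of continuous functions. Composing
  these with the nearest-point map of a disc makes them uniformly bounded without moving the
  limit, and a trapezoidal cutoff makes them vanish outside the interval. They vanish at both end
  points, hence also define continuous functions on the circle when the interval is the unit
  interval.\<close>
lemma bounded_function_continuous_approx:
  fixes u :: "real \<Rightarrow> complex"
  assumes u: "u \<in> borel_measurable lebesgue" and M: "\<And>x. norm (u x) \<le> M"
    and supp: "\<And>x. x \<notin> {a..b} \<Longrightarrow> u x = 0"
  obtains c :: "nat \<Rightarrow> real \<Rightarrow> complex" where
    "\<And>k. continuous_on UNIV (c k)" "\<And>k x. norm (c k x) \<le> M"
    "\<And>k x. x \<notin> {a<..<b} \<Longrightarrow> c k x = 0" "AE x in lebesgue. (\<lambda>k. c k x) \<longlonglongrightarrow> u x"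
proof -
  have M0: "M \<ge> 0" using M[of 0] norm_ge_zero[of "u 0"] by linarith
  have "u measurable_on UNIV"
    using u by (simp add: lebesgue_measurable_imp_measurable_on)
  then obtain N g where N: "negligible N" and g: "\<And>n. continuous_on UNIV (g n)"
    and lim: "\<And>x. x \<notin> N \<Longrightarrow> (\<lambda>n. g n x) \<longlonglongrightarrow> u x"
    unfolding measurable_on_def by auto
  define cp where "cp = closest_point (cball (0::complex) M)"
  have cp_cont: "continuous_on UNIV cp"
    unfolding cp_def using M0 by (intro continuous_on_closest_point) auto
  have cp_le: "norm (cp z) \<le> M" for z
    using closest_point_in_set[of "cball 0 M" z] M0 by (auto simp: cp_def)
  have cp_id: "cp z = z" if "norm z \<le> M" for z
    using that by (simp add: cp_def closest_point_self)
  define ct where "ct k x = min 1 (real k * max 0 (min (x - a) (b - x)))" for k x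
  have ct_cont: "continuous_on UNIV (ct k)" for k
    unfolding ct_def by (intro continuous_intros)
  have ct01: "0 \<le> ct k x" "ct k x \<le> 1" for k x unfolding ct_def by auto
  have ct0: "ct k x = 0" if "x \<notin> {a<..<b}" for k x
  proof -
    have "min (x - a) (b - x) \<le> 0" using that by (auto simp: min_le_iff_disj)
    then show ?thesis unfolding ct_def by (simp add: max_absorb1)
  qed
  have ct_lim: "(\<lambda>k. ct k x) \<longlonglongrightarrow> 1" if x: "x \<in> {a<..<b}" for x
  proof -
    define m where "m = max 0 (min (x - a) (b - x))"
    have m: "m > 0" using x by (auto simp: m_def)
    obtain K where K: "1 / m < real K" using reals_Archimedean2 by blast
    have "ct k x = 1" if "k \<ge> K" for k
    proof -
      have "1 / m \<le> real k" using K that by linarith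
      then have "1 \<le> real k * m" using m by (simp add: field_simps)
      then show ?thesis unfolding ct_def m_def[symmetric] by simp
    qed
    then have "eventually (\<lambda>k. ct k x = 1) sequentially"
      by (rule eventually_sequentiallyI)
    then show ?thesis by (rule tendsto_eventually)
  qed
  define c where "c k x = of_real (ct k x) * cp (g k x)" for k x
  show thesis
  proof
    show "continuous_on UNIV (c k)" for k
      unfolding c_def using ct_cont g
      by (intro continuous_intros continuous_on_compose2[OF cp_cont]) auto
    show "norm (c k x) \<le> M" for k x
      unfolding c_def using ct01[of k x] cp_le[of "g k x"] mult_mono[of "ct k x" 1 "norm (cp (g k x))" M]
      by (simp add: norm_mult)
    show "c k x = 0" if "x \<notin> {a<..<b}" for k x
      using ct0[OF that] by (simp add: c_def)
    have "AE x in lebesgue. x \<notin> N \<union> {a, b}"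
      using N by (intro AE_not_in) (auto simp: negligible_iff_null_sets[symmetric])
    then show "AE x in lebesgue. (\<lambda>k. c k x) \<longlonglongrightarrow> u x"
    proof eventually_elim
      case (elim x)
      show ?case
      proof (cases "x \<in> {a<..<b}")
        case True
        have "isCont cp (u x)" using cp_cont by (simp add: continuous_on_eq_continuous_at)
        then have "(\<lambda>k. cp (g k x)) \<longlonglongrightarrow> cp (u x)"
          using lim[of x] elim by (intro isCont_tendsto_compose[of _ cp]) auto
        then have "(\<lambda>k. of_real (ct k x) * cp (g k x)) \<longlonglongrightarrow> of_real 1 * cp (u x)"
          using ct_lim[OF True] by (intro tendsto_intros)
        then show ?thesis using M by (simp add: c_def cp_id)
      next
        case False
        then have "u x = 0" using supp[of x] elim by auto
        then show ?thesis using ct0[OF False] by (simp add: c_def)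
      qed
    qed
  qed
qed

text \<open>The Fourier decay is part of the definition because it is all that the Riemann sum
  argument needs from the smoothness of \<open>f\<close>: the transform is integrable and its samples are
  dominated. The class is invariant under translations and linear combinations.\<close>
definition test_function :: "(real \<Rightarrow> complex) \<Rightarrow> bool" where
  "test_function f \<longleftrightarrow> continuous_on UNIV f \<and> (\<exists>R. \<forall>x. \<bar>x\<bar> > R \<longrightarrow> f x = 0) \<and>
     (\<exists>C. \<forall>\<xi>. norm (fourier_integral f \<xi>) \<le> C / (1 + \<xi>\<^sup>2))"

lemma fourier_integral_compact_support:
  assumes cont: "continuous_on UNIV f" and supp: "\<And>x. \<bar>x\<bar> > R \<Longrightarrow> f x = 0"
  shows "((\<lambda>x. f x * cis (- (2 * pi * \<xi> * x))) has_integral fourier_integral f \<xi>) {-R..R}"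
proof -
  let ?g = "\<lambda>x. f x * cis (- (2 * pi * \<xi> * x))"
  have cg: "continuous_on UNIV ?g" by (intro continuous_intros cont)
  then have bg: "?g \<in> borel_measurable borel" by (rule borel_measurable_continuous_onI)
  have si: "set_integrable lborel {-R..R} ?g"
    by (rule borel_integrable_atLeastAtMost') (rule continuous_on_subset[OF cg], simp)
  have "fourier_integral f \<xi> = (LINT x|lborel. ?g x)"
    unfolding fourier_integral_def using bg by (intro integral_completion) simp
  also have "\<dots> = (LINT x:{-R..R}|lborel. ?g x)"
    unfolding set_lebesgue_integral_def
    by (intro Bochner_Integration.integral_cong refl) (use supp in \<open>auto simp: indicator_def abs_if split: if_splits\<close>)
  also have "\<dots> = integral {-R..R} ?g"
    by (rule set_borel_integral_eq_integral[OF si])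
  finally show ?thesis
    using set_borel_integral_eq_integral(1)[OF si] by (simp add: has_integral_integral)
qed

text \<open>On its support the function agrees with a polynomial \<open>v\<close> that vanishes to second order at
  \<open>R\<close> and \<open>-R\<close>. For a character \<open>e\<close> of frequency \<open>k\<close> the derivative of \<open>v' e - v e'\<close> is \<open>v'' e +
  k\<^sup>2 v e\<close>, and this primitive vanishes at both ends. So \<open>k\<^sup>2\<close> times the Fourier integral is
  bounded by the integral of the absolute value of \<open>v''\<close>: two integrations by parts in one step.\<close>
lemma test_function_bump_times_polynomial:
  fixes p :: "real \<Rightarrow> complex"
  assumes p: "polynomial_function p" and R: "R > 0"
  shows "test_function (\<lambda>x. of_real ((max 0 (R\<^sup>2 - x\<^sup>2))\<^sup>2) * p x)" (is "test_function ?f")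
proof -
  obtain p1 where p1: "polynomial_function p1" "\<And>x. (p has_vector_derivative p1 x) (at x)"
    using has_vector_derivative_polynomial_function[OF p] by blast
  \<comment> \<open>The maximum in the bump is inactive on \<open>[-R, R]\<close>, so there the function is the polynomial \<open>v\<close>.\<close>
  define w where "w x = complex_of_real (R\<^sup>2 - x\<^sup>2)" for x
  define v1 where "v1 x = w x * (of_real (-4 * x) * p x + w x * p1 x)" for x
  define v where "v x = (w x)\<^sup>2 * p x" for x
  have cp: "continuous_on S p" for S using p by (rule continuous_on_polymonial_function)
  have cf: "continuous_on UNIV ?f" by (intro continuous_intros cp)
  have supp: "?f x = 0" if "\<bar>x\<bar> > R" for x
    using that R abs_le_square_iff[of x R] by (auto simp: max_def)
  have fv: "?f x = v x" if "x \<in> {-R..R}" for x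
    using that R abs_le_square_iff[of x R] by (auto simp: v_def w_def max_def)
  have w_deriv: "(w has_vector_derivative of_real (- 2 * x)) (at x)" for x
    unfolding w_def
  proof (rule bounded_linear.has_vector_derivative[OF bounded_linear_of_real])
    have "((\<lambda>x. R\<^sup>2 - x\<^sup>2) has_real_derivative - 2 * x) (at x)"
      by (auto intro!: derivative_eq_intros)
    then show "((\<lambda>x. R\<^sup>2 - x\<^sup>2) has_vector_derivative - 2 * x) (at x)"
      by (simp add: has_real_derivative_iff_has_vector_derivative)
  qed
  have w2: "((\<lambda>x. (w x)\<^sup>2) has_vector_derivative (2 * w x * of_real (- 2 * x))) (at x)" for x
    unfolding power2_eq_square
    by (rule has_vector_derivative_eq_rhs[OF has_vector_derivative_mult[OF w_deriv w_deriv]]) simp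
  have v_deriv: "(v has_vector_derivative v1 x) (at x)" for x
    unfolding v_def
    by (rule has_vector_derivative_eq_rhs[OF has_vector_derivative_mult[OF w2 p1(2)]])
      (simp add: v1_def algebra_simps power2_eq_square)
  have "polynomial_function (\<lambda>x::real. R\<^sup>2 - x *\<^sub>R x)" by (intro polynomial_function_diff polynomial_function_mult) auto
  then have "polynomial_function (\<lambda>x. (R\<^sup>2 - x *\<^sub>R x) *\<^sub>R ((-4 *\<^sub>R x) *\<^sub>R p x + (R\<^sup>2 - x *\<^sub>R x) *\<^sub>R p1 x))"
    by (intro polynomial_function_mult polynomial_function_add p p1 polynomial_function_cmul polynomial_function_id)
  moreover have "v1 = (\<lambda>x. (R\<^sup>2 - x *\<^sub>R x) *\<^sub>R ((-4 *\<^sub>R x) *\<^sub>R p x + (R\<^sup>2 - x *\<^sub>R x) *\<^sub>R p1 x))"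
    by (simp add: fun_eq_iff v1_def w_def scaleR_conv_of_real power2_eq_square)
  ultimately have "polynomial_function v1" by simp
  then obtain v2 where v2: "polynomial_function v2" "\<And>x. (v1 has_vector_derivative v2 x) (at x)"
    using has_vector_derivative_polynomial_function by blast
  have cv2: "continuous_on {-R..R} v2" using v2 by (intro continuous_on_polymonial_function)
  have cv: "continuous_on {-R..R} v"
    using v_deriv by (meson continuous_at_imp_continuous_on has_vector_derivative_continuous)
  have "\<exists>A. \<forall>x\<in>{-R..R}. norm (v x) \<le> A"
    using compact_imp_bounded[OF compact_continuous_image[OF cv compact_Icc]] unfolding bounded_iff by auto
  then obtain A where A: "\<And>x. x \<in> {-R..R} \<Longrightarrow> norm (v x) \<le> A" by blast
  have "\<exists>B. \<forall>x\<in>{-R..R}. norm (v2 x) \<le> B"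
    using compact_imp_bounded[OF compact_continuous_image[OF cv2 compact_Icc]] unfolding bounded_iff by auto
  then obtain B where B: "\<And>x. x \<in> {-R..R} \<Longrightarrow> norm (v2 x) \<le> B" by blast
  have A0: "A \<ge> 0" using A[of 0] R order_trans[OF norm_ge_zero] by auto
  have B0: "B \<ge> 0" using B[of 0] R order_trans[OF norm_ge_zero] by auto
  define C where "C = 2 * R * A + 2 * R * B"
  have "norm (fourier_integral ?f \<xi>) \<le> C / (1 + \<xi>\<^sup>2)" for \<xi>
  proof -
    define k where "k = - (2 * pi * \<xi>)"
    define e where "e x = exp (\<i> * of_real k * of_real x)" for x
    have e_cis: "cis (- (2 * pi * \<xi> * x)) = e x" for x
      by (simp add: e_def k_def cis_conv_exp mult.assoc)
    have ne: "norm (e x) = 1" for x using e_cis[of x] by (metis norm_cis)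
    have e_deriv: "(e has_vector_derivative (\<i> * of_real k * e x)) (at x)" for x
      unfolding e_def
      by (rule has_vector_derivative_real_field) (auto intro!: derivative_eq_intros)
    have I1: "((\<lambda>x. v x * e x) has_integral fourier_integral ?f \<xi>) {-R..R}"
    proof (rule has_integral_eq)
      show "((\<lambda>x. ?f x * cis (- (2 * pi * \<xi> * x))) has_integral fourier_integral ?f \<xi>) {-R..R}"
        by (rule fourier_integral_compact_support[OF cf supp])
      show "?f x * cis (- (2 * pi * \<xi> * x)) = v x * e x" if "x \<in> {-R..R}" for x
        using fv[OF that] e_cis[of x] by simp
    qed
    have n1: "norm (fourier_integral ?f \<xi>) \<le> A * (2 * R)"
      using has_integral_bound_real[OF A0 finite.emptyI I1] A R by (simp add: norm_mult ne)
    have "((\<lambda>x. v1 x * e x - v x * (\<i> * of_real k * e x)) has_vector_derivative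
        (v2 x * e x + of_real (k\<^sup>2) * (v x * e x))) (at x)" for x
      by (rule has_vector_derivative_eq_rhs[OF has_vector_derivative_diff[OF
          has_vector_derivative_mult[OF v2(2) e_deriv]
          has_vector_derivative_mult[OF v_deriv has_vector_derivative_mult_right[OF e_deriv]]]])
        (simp add: algebra_simps power2_eq_square)
    then have "((\<lambda>x. v2 x * e x + of_real (k\<^sup>2) * (v x * e x)) has_integral
       ((v1 R * e R - v R * (\<i> * of_real k * e R)) - (v1 (-R) * e (-R) - v (-R) * (\<i> * of_real k * e (-R))))) {-R..R}"
      using R by (intro fundamental_theorem_of_calculus) (auto intro: has_vector_derivative_at_within)
    then have "((\<lambda>x. v2 x * e x + of_real (k\<^sup>2) * (v x * e x)) has_integral 0) {-R..R}"
      by (simp add: v1_def v_def w_def)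
    from has_integral_diff[OF this has_integral_mult_right[OF I1, of "of_real (k\<^sup>2)"]]
    have I2: "((\<lambda>x. v2 x * e x) has_integral - (of_real (k\<^sup>2) * fourier_integral ?f \<xi>)) {-R..R}"
      by simp
    have "norm (of_real (k\<^sup>2) * fourier_integral ?f \<xi>) \<le> B * (2 * R)"
      using has_integral_bound_real[OF B0 finite.emptyI I2] B R by (simp add: norm_mult ne)
    then have n2: "k\<^sup>2 * norm (fourier_integral ?f \<xi>) \<le> B * (2 * R)"
      by (simp add: norm_mult norm_power power2_eq_square)
    have "1 \<le> (2 * pi)\<^sup>2" using pi_gt3 by (intro one_le_power) linarith
    then have "\<xi>\<^sup>2 \<le> k\<^sup>2"
      unfolding k_def using mult_right_mono[of 1 "(2 * pi)\<^sup>2" "\<xi>\<^sup>2"] by (simp add: power_mult_distrib)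
    then have "\<xi>\<^sup>2 * norm (fourier_integral ?f \<xi>) \<le> B * (2 * R)"
      using n2 mult_right_mono[OF _ norm_ge_zero] order_trans by blast
    with n1 have "norm (fourier_integral ?f \<xi>) * (1 + \<xi>\<^sup>2) \<le> C"
      by (simp add: C_def algebra_simps)
    then show ?thesis by (subst pos_le_divide_eq) (auto intro: add_pos_nonneg)
  qed
  then show ?thesis
    unfolding test_function_def using cf supp by blast
qed

lemma power_mass_le_uniform_bound:
  assumes [measurable]: "f \<in> borel_measurable lebesgue" and "R \<ge> 0" "q > 0"
    and "\<And>x. norm (f x) \<le> \<kappa>" and "\<And>x. x \<notin> {-R..R} \<Longrightarrow> f x = 0"
  shows "power_mass q lebesgue f \<le> ennreal (\<kappa> powr q * (2 * R))"
proof -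
  have "\<kappa> \<ge> 0" using assms(4)[of 0] norm_ge_zero order_trans by blast
  have "power_mass q lebesgue f \<le> (\<integral>\<^sup>+x. ennreal (\<kappa> powr q) * indicator {-R..R} x \<partial>lebesgue)"
    unfolding power_mass_def
  proof (intro nn_integral_mono)
    fix x
    show "ennreal (norm (f x) powr q) \<le> ennreal (\<kappa> powr q) * indicator {-R..R} x"
      using assms(3-5) by (cases "x \<in> {-R..R}") (auto intro!: ennreal_leI powr_mono2)
  qed
  also have "\<dots> = ennreal (\<kappa> powr q) * ennreal (2 * R)"
    using assms(2) by (subst nn_integral_cmult_indicator) auto
  finally show ?thesis using assms(2) by (simp add: ennreal_mult)
qed

text \<open>Divide by the bump \<open>(R\<^sup>2 - x\<^sup>2)\<^sup>2\<close>, which is bounded away from zero on the support of \<open>c\<close>,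
  approximate the quotient by a polynomial on \<open>[-R, R]\<close>, and multiply back. Uniform convergence on
  a bounded set is convergence in every \<open>L\<^sup>q\<close>.\<close>
lemma continuous_imp_test_function_approx:
  fixes c :: "real \<Rightarrow> complex"
  assumes cont: "continuous_on UNIV c" and supp: "\<And>x. \<bar>x\<bar> > r \<Longrightarrow> c x = 0"
    and Q: "finite Q" "\<And>q. q \<in> Q \<Longrightarrow> q > 0" and \<eta>: "\<eta> > 0"
  obtains d where "test_function d" "\<And>q. q \<in> Q \<Longrightarrow> diff_mass q d c < ennreal \<eta>"
proof -
  define R where "R = \<bar>r\<bar> + 1"
  have R: "R > 0" by (simp add: R_def)
  \<comment> \<open>The maximum only prevents a division by zero outside the support of \<open>c\<close>.\<close>
  define c0 where "c0 x = c x / of_real ((max 1 (R\<^sup>2 - x\<^sup>2))\<^sup>2)" for x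
  have c0: "continuous_on {-R..R} c0"
    unfolding c0_def by (intro continuous_intros continuous_on_subset[OF cont]) (auto simp: max_def)
  have c0w: "of_real ((max 0 (R\<^sup>2 - x\<^sup>2))\<^sup>2) * c0 x = c x" for x
  proof (cases "\<bar>x\<bar> \<le> \<bar>r\<bar>")
    case True
    then have "x\<^sup>2 \<le> \<bar>r\<bar>\<^sup>2" using abs_le_square_iff[of x "\<bar>r\<bar>"] by simp
    then have "R\<^sup>2 - x\<^sup>2 \<ge> 1" unfolding R_def by (simp add: power2_sum)
    then have "max 0 (R\<^sup>2 - x\<^sup>2) = R\<^sup>2 - x\<^sup>2" "max 1 (R\<^sup>2 - x\<^sup>2) = R\<^sup>2 - x\<^sup>2" "R\<^sup>2 - x\<^sup>2 \<noteq> 0" by auto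
    then show ?thesis unfolding c0_def
      by (metis nonzero_mult_div_cancel_left of_real_eq_0_iff power_not_zero times_divide_eq_right)
  next
    case False
    then show ?thesis using supp[of x] by (simp add: c0_def)
  qed
  have "\<exists>p. polynomial_function p \<and> (\<forall>x\<in>{-R..R}. norm (c0 x - p x) < \<kappa>)" if "\<kappa> > 0" for \<kappa>
    by (rule Stone_Weierstrass_polynomial_function[OF compact_Icc c0 that])
  then have "\<exists>p. polynomial_function p \<and> (\<forall>x\<in>{-R..R}. norm (c0 x - p x) < 1 / real (Suc j))" for j
    by simp
  then obtain p where p: "\<And>j. polynomial_function (p j)"
    and pc: "\<And>j x. x \<in> {-R..R} \<Longrightarrow> norm (c0 x - p j x) < 1 / real (Suc j)"
    by metis
  define d where "d j x = of_real ((max 0 (R\<^sup>2 - x\<^sup>2))\<^sup>2) * p j x" for j x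
  have d: "test_function (d j)" for j
    unfolding d_def by (rule test_function_bump_times_polynomial[OF p R])
  have out: "max 0 (R\<^sup>2 - x\<^sup>2) = 0" if "x \<notin> {-R..R}" for x
    using that R abs_le_square_iff[of R x] by (auto simp: max_def)
  have dc0: "d j x - c x = 0" if "x \<notin> {-R..R}" for j x
    using out[OF that] c0w[of x] by (simp add: d_def)
  have dc: "norm (d j x - c x) \<le> R ^ 4 * (1 / real (Suc j))" for j x
  proof (cases "x \<in> {-R..R}")
    case True
    have "norm (d j x - c x) = (max 0 (R\<^sup>2 - x\<^sup>2))\<^sup>2 * norm (p j x - c0 x)"
      unfolding c0w[of x, symmetric] d_def by (simp add: norm_mult norm_power flip: right_diff_distrib)
    also have "\<dots> \<le> (R\<^sup>2)\<^sup>2 * (1 / real (Suc j))"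
      using pc[OF True, of j] by (intro mult_mono power_mono) (auto simp: norm_minus_commute)
    finally show ?thesis by (simp flip: power_mult)
  qed (use dc0 R in auto)
  have meas[measurable]: "(\<lambda>x. d j x - c x) \<in> borel_measurable lebesgue" for j
    using d[of j] cont unfolding test_function_def
    by (intro measurable_completion) (auto intro!: borel_measurable_continuous_onI continuous_intros)
  have "eventually (\<lambda>j. \<forall>q\<in>Q. diff_mass q (d j) c < ennreal \<eta>) sequentially"
  proof (rule eventually_ball_finite[OF Q(1)], rule ballI)
    fix q assume q: "q \<in> Q"
    have "(\<lambda>j. 1 / real (Suc j)) \<longlonglongrightarrow> 0"
      using LIMSEQ_inverse_real_of_nat by (simp only: inverse_eq_divide)
    then have l1: "(\<lambda>j. R ^ 4 * (1 / real (Suc j))) \<longlonglongrightarrow> R ^ 4 * 0"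
      by (intro tendsto_mult tendsto_const)
    have "(\<lambda>j. (R ^ 4 * (1 / real (Suc j))) powr q * (2 * R)) \<longlonglongrightarrow> (R ^ 4 * 0) powr q * (2 * R)"
      using Q(2)[OF q] R by (intro tendsto_mult[OF _ tendsto_const] tendsto_powr2[OF l1 tendsto_const]) auto
    then have "eventually (\<lambda>j. (R ^ 4 * (1 / real (Suc j))) powr q * (2 * R) < \<eta>) sequentially"
      using \<eta> by (intro order_tendstoD) auto
    then show "eventually (\<lambda>j. diff_mass q (d j) c < ennreal \<eta>) sequentially"
    proof eventually_elim
      case (elim j)
      have "diff_mass q (d j) c \<le> ennreal ((R ^ 4 * (1 / real (Suc j))) powr q * (2 * R))"
        using R Q(2)[OF q] by (intro power_mass_le_uniform_bound meas dc dc0) auto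
      also have "\<dots> < ennreal \<eta>" using elim R \<eta> by (intro ennreal_lessI) auto
      finally show ?case .
    qed
  qed
  then obtain j where "\<forall>q\<in>Q. diff_mass q (d j) c < ennreal \<eta>"
    by (auto simp: eventually_sequentially)
  with d[of j] show thesis using that by blast
qed

lemma power_mass_tendsto_0_dominated:
  assumes [measurable]: "\<And>n. u n \<in> borel_measurable M" "v \<in> borel_measurable M"
    "w \<in> borel_measurable M"
    and lim: "AE x in M. (\<lambda>n. u n x) \<longlonglongrightarrow> v x"
    and dom: "\<And>n x. norm (u n x - v x) \<le> norm (w x)" and q: "q > 0"
    and fin: "power_mass q M w < \<infinity>"
  shows "(\<lambda>n. power_mass q M (\<lambda>x. u n x - v x)) \<longlonglongrightarrow> 0"
proof -
  have "(\<lambda>n. \<integral>\<^sup>+x. ennreal (norm (u n x - v x) powr q) \<partial>M) \<longlonglongrightarrow> (\<integral>\<^sup>+x. 0 \<partial>M)"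
  proof (rule nn_integral_dominated_convergence[where w="\<lambda>x. ennreal (norm (w x) powr q)"])
    show "AE x in M. ennreal (norm (u j x - v x) powr q) \<le> ennreal (norm (w x) powr q)" for j
      using dom q by (intro AE_I2 ennreal_leI powr_mono2) auto
    show "AE x in M. (\<lambda>i. ennreal (norm (u i x - v x) powr q)) \<longlonglongrightarrow> 0"
      using lim
    proof eventually_elim
      case (elim x)
      then have "(\<lambda>i. norm (u i x - v x)) \<longlonglongrightarrow> 0"
        using LIM_zero tendsto_norm_zero by blast
      then have "(\<lambda>i. norm (u i x - v x) powr q) \<longlonglongrightarrow> 0 powr q"
        using q by (intro tendsto_powr2) auto
      then show ?case using q by (simp flip: ennreal_0 add: tendsto_ennrealI)
    qed
  qed (use fin in \<open>auto simp: power_mass_def\<close>)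
  then show ?thesis by (simp add: power_mass_def)
qed

lemma ident_measurable_lebesgue: "(\<lambda>x::real. x) \<in> borel_measurable lebesgue"
  by (intro measurable_completion) simp

text \<open>Three approximations: truncate in the domain and in the range, pass to continuous
  functions, pass to test functions. A single test function is close for all exponents of a finite
  set; exponents 2 and \<open>p\<close> are needed together to relate the operator on \<open>L\<^sup>p\<close> to the Fourier
  transform on \<open>L\<^sup>2\<close>.\<close>
theorem test_functions_dense:
  fixes u :: "real \<Rightarrow> complex"
  assumes Q: "finite Q" "Q \<noteq> {}" "\<And>q. q \<in> Q \<Longrightarrow> q > 0"
    and u: "\<And>q. q \<in> Q \<Longrightarrow> u \<in> Lp q lebesgue" and \<eta>: "\<eta> > 0"
  obtains d where "test_function d" "\<And>q. q \<in> Q \<Longrightarrow> diff_mass q d u < ennreal \<eta>"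
proof -
  have um[measurable]: "u \<in> borel_measurable lebesgue"
    using u Q(2) Lp_measurable by blast
  define m where "m = 1 + (\<Sum>q\<in>Q. 2 powr q)"
  have m: "2 powr q \<le> m" if "q \<in> Q" for q
    using member_le_sum[of q Q "\<lambda>q. 2 powr q"] that Q(1) by (simp add: m_def)
  have m1: "m \<ge> 1" unfolding m_def by (simp add: sum_nonneg)
  \<comment> \<open>Two uses of the triangle inequality turn three errors \<open>\<delta>\<close> into \<open>m (\<delta> + 2 m \<delta>)\<close>.\<close>
  define \<delta> where "\<delta> = \<eta> / (m + 2 * m\<^sup>2 + 1)"
  have den: "m + 2 * m\<^sup>2 + 1 > 0" using m1 by (intro add_nonneg_pos) auto
  have \<delta>: "\<delta> > 0" unfolding \<delta>_def using \<eta> den by simp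
  have \<delta>\<eta>: "m * (\<delta> + m * (\<delta> + \<delta>)) < \<eta>"
  proof -
    have "m * (\<delta> + m * (\<delta> + \<delta>)) = (m + 2 * m\<^sup>2 + 1) * \<delta> - \<delta>"
      by (simp add: algebra_simps power2_eq_square)
    also have "(m + 2 * m\<^sup>2 + 1) * \<delta> = \<eta>" unfolding \<delta>_def using den by simp
    finally show ?thesis using \<delta> by simp
  qed
  define t where "t n x = (if \<bar>x\<bar> \<le> real n \<and> norm (u x) \<le> real n then u x else 0)" for n x
  note ident_measurable_lebesgue [measurable]
  have tm[measurable]: "t n \<in> borel_measurable lebesgue" for n
    unfolding t_def by measurable
  have "eventually (\<lambda>n. \<forall>q\<in>Q. diff_mass q (t n) u < ennreal \<delta>) sequentially"
  proof (rule eventually_ball_finite[OF Q(1)], rule ballI)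
    fix q assume q: "q \<in> Q"
    have "converges_Lp q t u"
    proof (rule power_mass_tendsto_0_dominated[where w=u])
      show "AE x in lebesgue. (\<lambda>n. t n x) \<longlonglongrightarrow> u x"
      proof (intro AE_I2 tendsto_eventually)
        fix x
        obtain N where "max \<bar>x\<bar> (norm (u x)) \<le> real N" using real_arch_simple by blast
        then show "eventually (\<lambda>n. t n x = u x) sequentially"
          by (intro eventually_sequentiallyI[of N]) (auto simp: t_def)
      qed
    qed (use u[OF q] Q(3)[OF q] in \<open>auto simp: t_def Lp_iff\<close>)
    then show "eventually (\<lambda>n. diff_mass q (t n) u < ennreal \<delta>) sequentially"
      using \<delta> by (intro order_tendstoD) auto
  qed
  then obtain n where n: "\<And>q. q \<in> Q \<Longrightarrow> diff_mass q (t n) u < ennreal \<delta>"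
    by (auto simp: eventually_sequentially)
  obtain c where c: "\<And>k. continuous_on UNIV (c k)" "\<And>k x. norm (c k x) \<le> real n"
    "\<And>k x. x \<notin> {- real n<..<real n} \<Longrightarrow> c k x = 0" "AE x in lebesgue. (\<lambda>k. c k x) \<longlonglongrightarrow> t n x"
    by (rule bounded_function_continuous_approx[of "t n" "real n" "- real n" "real n"])
      (auto simp: t_def)
  have [measurable]: "c k \<in> borel_measurable lebesgue" for k
    using c(1) by (intro measurable_completion) (simp add: borel_measurable_continuous_onI)
  have "eventually (\<lambda>k. \<forall>q\<in>Q. diff_mass q (c k) (t n) < ennreal \<delta>) sequentially"
  proof (rule eventually_ball_finite[OF Q(1)], rule ballI)
    fix q assume q: "q \<in> Q"
    let ?w = "\<lambda>x. indicator {- real n..real n} x * complex_of_real (2 * real n)"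
    have "(\<lambda>k. diff_mass q (c k) (t n)) \<longlonglongrightarrow> 0"
    proof (rule power_mass_tendsto_0_dominated[where w="?w"])
      show "norm (c k x - t n x) \<le> norm (?w x)" for k x
      proof (cases "x \<in> {- real n..real n}")
        case True
        have "norm (t n x) \<le> real n" by (simp add: t_def)
        then show ?thesis using norm_triangle_ineq4[of "c k x" "t n x"] c(2)[of k x] True by simp
      next
        case False
        then show ?thesis using c(3)[of x k] by (auto simp: t_def)
      qed
      have "power_mass q lebesgue ?w \<le> ennreal ((2 * real n) powr q * (2 * real n))"
        using Q(3)[OF q] by (intro power_mass_le_uniform_bound) (auto simp: indicator_def norm_mult)
      then show "power_mass q lebesgue ?w < \<infinity>" by (rule le_less_trans) simp
    qed (use c Q(3)[OF q] in auto)
    then show "eventually (\<lambda>k. diff_mass q (c k) (t n) < ennreal \<delta>) sequentially"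
      using \<delta> by (intro order_tendstoD) auto
  qed
  then obtain k where k: "\<And>q. q \<in> Q \<Longrightarrow> diff_mass q (c k) (t n) < ennreal \<delta>"
    by (auto simp: eventually_sequentially)
  have csupp: "c k x = 0" if "\<bar>x\<bar> > real n" for x
    using that by (intro c(3)) (simp, linarith)
  obtain d where d: "test_function d"
    and dq: "\<And>q. q \<in> Q \<Longrightarrow> diff_mass q d (c k) < ennreal \<delta>"
    using continuous_imp_test_function_approx[OF c(1) csupp Q(1,3) \<delta>] by blast
  have [measurable]: "d \<in> borel_measurable lebesgue"
    using d unfolding test_function_def by (intro measurable_completion) (simp add: borel_measurable_continuous_onI)
  show thesis
  proof (rule that[OF d])
    fix q assume q: "q \<in> Q"
    have "diff_mass q d u \<le> ennreal (2 powr q) *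
        (diff_mass q d (c k) + diff_mass q (c k) u)"
      using Q(3)[OF q] by (intro power_mass_diff_triangle) auto
    also have "\<dots> \<le> ennreal (2 powr q) *
        (diff_mass q d (c k) + ennreal (2 powr q) *
        (diff_mass q (c k) (t n) + diff_mass q (t n) u))"
      using Q(3)[OF q] by (intro mult_left_mono add_left_mono power_mass_diff_triangle) auto
    also have "\<dots> \<le> ennreal m * (ennreal \<delta> + ennreal m * (ennreal \<delta> + ennreal \<delta>))"
      using dq[OF q] k[OF q] n[OF q] m[OF q]
      by (intro mult_mono add_mono ennreal_leI) (auto intro: less_imp_le)
    also have "\<dots> = ennreal (m * (\<delta> + m * (\<delta> + \<delta>)))"
      using m1 \<delta> by (subst ennreal_mult ennreal_plus, simp, simp)+
    also have "\<dots> < ennreal \<eta>" using \<delta>\<eta> \<eta> by (intro ennreal_lessI) auto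
    finally show "diff_mass q d u < ennreal \<eta>" .
  qed
qed

section \<open>Uniqueness of Fourier coefficients on the circle\<close>

lemma cis_two_pi_eq_on_unit_interval:
  assumes "x \<in> {0..1}" "y \<in> {0..1}" "cis (2 * pi * x) = cis (2 * pi * y)"
  shows "x = y \<or> {x, y} = {0, 1}"
proof -
  have "sin (2 * pi * x) = sin (2 * pi * y) \<and> cos (2 * pi * x) = cos (2 * pi * y)"
    using assms(3) by (simp add: complex_eq_iff)
  then obtain n :: int where "2 * pi * x = 2 * pi * y + 2 * pi * n"
    unfolding sin_cos_eq_iff by blast
  then have "2 * pi * x = 2 * pi * (y + n)" by (simp add: algebra_simps)
  then have xy: "x = y + n" by simp
  with assms(1,2) have "-1 \<le> real_of_int n" "real_of_int n \<le> 1" by auto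
  then have "n = -1 \<or> n = 0 \<or> n = 1" by linarith
  with xy assms(1,2) show ?thesis by auto
qed

text \<open>The exponential map from the compact interval onto the unit circle is a quotient map which
  identifies just the two end points.\<close>
lemma continuous_circle_factor:
  fixes c :: "real \<Rightarrow> real"
  assumes c: "continuous_on {0..1} c" and ends: "c 0 = c 1"
  obtains q where "continuous_on (sphere (0::complex) 1) q"
    "\<And>x. x \<in> {0..1} \<Longrightarrow> q (cis (2 * pi * x)) = c x"
proof -
  define e where "e x = cis (2 * pi * x)" for x
  define q where "q z = c (SOME x. x \<in> {0..1} \<and> e x = z)" for z
  have qe: "q (e x) = c x" if x: "x \<in> {0..1}" for x
  proof -
    define y where "y = (SOME y. y \<in> {0..1} \<and> e y = e x)"
    have "y \<in> {0..1} \<and> e y = e x" unfolding y_def by (rule someI[of _ x]) (use x in simp)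
    then have "y = x \<or> {y, x} = {0, 1}" using x cis_two_pi_eq_on_unit_interval[of y x] by (simp add: e_def)
    then have "c y = c x" using ends by (auto simp: doubleton_eq_iff)
    then show ?thesis by (simp add: q_def y_def)
  qed
  have img: "e ` {0..1} = sphere 0 1"
  proof (intro equalityI subsetI)
    fix z :: complex assume "z \<in> sphere 0 1"
    then have "z = cis (Arg2pi z)" using complex_norm_eq_1_exp[of z] by (simp add: cis_conv_exp)
    moreover have "Arg2pi z / (2 * pi) \<in> {0..1}" using Arg2pi_ge_0[of z] Arg2pi_lt_2pi[of z] by simp
    ultimately show "z \<in> e ` {0..1}" unfolding e_def by (intro image_eqI[of _ _ "Arg2pi z / (2 * pi)"]) auto
  qed (auto simp: e_def)
  have ce: "continuous_on {0..1} e" unfolding e_def by (intro continuous_intros)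
  have "quotient_map (top_of_set {0..1}) (top_of_set (sphere 0 1)) e"
    using ce img by (intro T1_Spaces.continuous_imp_quotient_map)
      (auto simp: compact_space_subtopology Hausdorff_space_subtopology)
  moreover have "continuous_map (top_of_set {0..1}) euclidean (q \<circ> e)"
    using c by (simp, subst continuous_on_cong[of "{0..1}" "{0..1}" _ c]) (auto simp: qe)
  ultimately have "continuous_map (top_of_set (sphere 0 1)) euclidean q"
    by (rule continuous_compose_quotient_map)
  then have "continuous_on (sphere 0 1) q" by simp
  with qe show thesis using that by (simp add: e_def)
qed

lemma circle_measurable_borel: "f \<in> borel_measurable borel \<Longrightarrow> f \<in> borel_measurable circle"
  by (intro measurable_restrict_space1 measurable_completion) simp

lemma circle_finite: "finite_measure circle"
  by (rule finite_measureI) (simp add: emeasure_restrict_space)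

lemma measure_circle_UNIV: "measure circle (space circle) = 1"
  by (simp add: measure_restrict_space)

lemma integrable_mult_bounded:
  fixes f g :: "'a \<Rightarrow> complex"
  assumes "integrable M f" "g \<in> borel_measurable M" "\<And>x. norm (g x) \<le> B"
  shows "integrable M (\<lambda>x. f x * g x)"
proof (rule Bochner_Integration.integrable_bound)
  show "integrable M (\<lambda>x. of_real B * f x)" using assms(1) by (rule integrable_mult_right)
  have "B \<ge> 0" using assms(3)[of undefined] norm_ge_zero order_trans by blast
  then show "AE x in M. norm (f x * g x) \<le> norm (of_real B * f x)"
    using assms(3) by (intro AE_I2) (simp add: norm_mult mult.commute[of B] mult_left_mono)
  show "(\<lambda>x. f x * g x) \<in> borel_measurable M"
    using assms(1,2) by (intro borel_measurable_times) auto
qed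

lemma cis_measurable_circle: "(\<lambda>x. cis (k * x)) \<in> borel_measurable circle"
  by (intro circle_measurable_borel borel_measurable_continuous_onI continuous_intros)

lemma circle_integrable_mult_cis:
  "integrable circle h \<Longrightarrow> integrable circle (\<lambda>x. h x * cis (k * x))"
  by (rule integrable_mult_bounded[where B=1]) (auto simp: cis_measurable_circle)

text \<open>All Fourier coefficients vanish. The frequency ranges over all integers, so the sign in
  the exponent is immaterial.\<close>
definition annihilates_characters :: "(real \<Rightarrow> complex) \<Rightarrow> bool" where
  "annihilates_characters h \<longleftrightarrow> integrable circle h \<and>
     (\<forall>n::int. (LINT x|circle. h x * cis (2 * pi * of_int n * x)) = 0)"

lemma annihilates_characters_mult_cis:
  assumes "annihilates_characters h"
  shows "annihilates_characters (\<lambda>x. h x * cis (2 * pi * of_int m * x))"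
  unfolding annihilates_characters_def
proof (intro conjI allI)
  show "integrable circle (\<lambda>x. h x * cis (2 * pi * of_int m * x))"
    using assms by (intro circle_integrable_mult_cis) (simp add: annihilates_characters_def)
  fix n :: int
  have "(LINT x|circle. h x * cis (2 * pi * of_int m * x) * cis (2 * pi * of_int n * x))
      = (LINT x|circle. h x * cis (2 * pi * of_int (m + n) * x))"
    by (simp add: mult.assoc cis_mult algebra_simps)
  also have "\<dots> = 0" using assms unfolding annihilates_characters_def by blast
  finally show "(LINT x|circle. h x * cis (2 * pi * of_int m * x) * cis (2 * pi * of_int n * x)) = 0" .
qed

lemma annihilates_characters_add:
  assumes "annihilates_characters g" "annihilates_characters h"
  shows "annihilates_characters (\<lambda>x. a * g x + b * h x)"
proof -
  have i: "integrable circle g" "integrable circle h"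
    using assms by (auto simp: annihilates_characters_def)
  have "(LINT x|circle. (a * g x + b * h x) * cis (2 * pi * of_int n * x)) = 0" for n
  proof -
    have "(LINT x|circle. (a * g x + b * h x) * cis (2 * pi * of_int n * x))
      = (LINT x|circle. a * (g x * cis (2 * pi * of_int n * x)) + b * (h x * cis (2 * pi * of_int n * x)))"
      by (simp add: algebra_simps)
    also have "\<dots> = a * (LINT x|circle. g x * cis (2 * pi * of_int n * x))
        + b * (LINT x|circle. h x * cis (2 * pi * of_int n * x))"
      using circle_integrable_mult_cis[OF i(1)] circle_integrable_mult_cis[OF i(2)]
      by (subst Bochner_Integration.integral_add) auto
    also have "\<dots> = 0" using assms by (simp add: annihilates_characters_def)
    finally show ?thesis .
  qed
  then show ?thesis using i by (simp add: annihilates_characters_def)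
qed

text \<open>The functions that annihilate all characters form a module over the trigonometric
  polynomials: the real and imaginary parts of a point of the circle are combinations of the
  characters of frequency 1 and -1, and multiplication by a character only shifts the frequencies.
  Formulating the claim for all such \<open>h\<close> makes the product case of the induction immediate.\<close>
lemma annihilates_characters_mult_polynomial:
  assumes "real_polynomial_function p" "annihilates_characters h"
  shows "annihilates_characters (\<lambda>x. h x * of_real (p (cis (2 * pi * x))))"
  using assms
proof (induction p arbitrary: h rule: real_polynomial_function.induct)
  case (linear p)
  define A where "A = (of_real (p 1) - \<i> * of_real (p \<i>)) / 2"
  define B where "B = (of_real (p 1) + \<i> * of_real (p \<i>)) / 2"
  have p: "p z = Re z * p 1 + Im z * p \<i>" for z
  proof -
    have "p z = p (Re z *\<^sub>R 1 + Im z *\<^sub>R \<i>)"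
      by (rule arg_cong[of _ _ p]) (simp add: complex_eq_iff)
    also have "\<dots> = Re z * p 1 + Im z * p \<i>"
      using linear(1) by (simp add: linear_simps)
    finally show ?thesis .
  qed
  have "h x * of_real (p (cis (2 * pi * x)))
      = A * (h x * cis (2 * pi * of_int 1 * x)) + B * (h x * cis (2 * pi * of_int (-1) * x))" for x
  proof -
    have "complex_of_real (p (cis (2 * pi * x)))
      = A * cis (2 * pi * of_int 1 * x) + B * cis (2 * pi * of_int (-1) * x)"
      by (subst p) (simp add: A_def B_def complex_eq_iff field_simps)
    then show ?thesis by (simp add: algebra_simps)
  qed
  then show ?case
    using annihilates_characters_add[OF annihilates_characters_mult_cis[OF linear(2), of 1]
        annihilates_characters_mult_cis[OF linear(2), of "-1"], of A B] by simp
next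
  case (const c)
  then show ?case
    using annihilates_characters_add[of h h "of_real c" 0] by (simp add: mult.commute)
next
  case (add f g)
  from annihilates_characters_add[OF add.IH(1)[OF add.prems] add.IH(2)[OF add.prems], of 1 1]
  show ?case by (simp add: algebra_simps)
next
  case (mult f g)
  from mult.IH(2)[OF mult.IH(1)[OF mult.prems]]
  show ?case by (simp add: algebra_simps)
qed

text \<open>By the Stone--Weierstrass theorem on the circle, \<open>c\<close> is a uniform limit of real
  polynomials in the coordinates of a point, and against these the integral vanishes.\<close>
lemma annihilates_characters_real_continuous:
  fixes c :: "real \<Rightarrow> real"
  assumes h: "annihilates_characters h" and c: "continuous_on UNIV c" and ends: "c 0 = c 1"
  shows "(LINT x|circle. h x * of_real (c x)) = 0"
proof -
  have hi: "integrable circle h" using h by (simp add: annihilates_characters_def)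
  obtain q where q: "continuous_on (sphere (0::complex) 1) q"
    "\<And>x. x \<in> {0..1} \<Longrightarrow> q (cis (2 * pi * x)) = c x"
    using continuous_circle_factor[OF continuous_on_subset[OF c subset_UNIV] ends] by blast
  have cm: "c \<in> borel_measurable circle"
    using c by (intro circle_measurable_borel borel_measurable_continuous_onI)
  define I where "I = (LINT x|circle. norm (h x))"
  have I0: "I \<ge> 0" unfolding I_def by simp
  have "norm (LINT x|circle. h x * of_real (c x)) \<le> e * I" if e: "e > 0" for e
  proof -
    obtain p where p: "real_polynomial_function p" "\<And>z. z \<in> sphere 0 1 \<Longrightarrow> \<bar>q z - p z\<bar> < e"
      using Stone_Weierstrass_real_polynomial_function[OF compact_sphere q(1) e] by blast
    define P where "P x = p (cis (2 * pi * x))" for x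
    have hP: "annihilates_characters (\<lambda>x. h x * of_real (P x))"
      unfolding P_def by (rule annihilates_characters_mult_polynomial[OF p(1) h])
    then have iP: "integrable circle (\<lambda>x. h x * of_real (P x))"
      and P0: "(LINT x|circle. h x * of_real (P x)) = 0"
      unfolding annihilates_characters_def by (auto dest: spec[of _ 0])
    have cP: "\<bar>c x - P x\<bar> \<le> e" if "x \<in> {0..<1}" for x
      using p(2)[of "cis (2 * pi * x)"] q(2)[of x] that by (simp add: P_def)
    have "continuous_on UNIV p"
      using p(1) by (intro continuous_on_polymonial_function) (simp add: real_polynomial_function_eq)
    then have "continuous_on UNIV P" unfolding P_def
      by (rule continuous_on_compose2) (auto intro!: continuous_intros)
    then have Pm: "P \<in> borel_measurable circle"
      by (intro circle_measurable_borel borel_measurable_continuous_onI)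
    have bound: "norm (h x * of_real (c x - P x)) \<le> e * norm (h x)" if "x \<in> space circle" for x
    proof -
      have "\<bar>c x - P x\<bar> * norm (h x) \<le> e * norm (h x)"
        using cP[of x] that by (intro mult_right_mono) auto
      then show ?thesis by (simp only: norm_mult norm_of_real mult.commute)
    qed
    have iD: "integrable circle (\<lambda>x. h x * of_real (c x - P x))"
    proof (rule Bochner_Integration.integrable_bound)
      show "integrable circle (\<lambda>x. e * norm (h x))" using hi by simp
      show "AE x in circle. norm (h x * of_real (c x - P x)) \<le> norm (e * norm (h x))"
        using bound e by (intro AE_I2) fastforce
      show "(\<lambda>x. h x * of_real (c x - P x)) \<in> borel_measurable circle"
        using hi cm Pm by (intro borel_measurable_times borel_measurable_of_real borel_measurable_diff) auto
    qed
    have "(LINT x|circle. h x * of_real (c x)) = (LINT x|circle. h x * of_real (c x - P x) + h x * of_real (P x))"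
      by (simp add: algebra_simps)
    also have "\<dots> = (LINT x|circle. h x * of_real (c x - P x))"
      using iD iP P0 by (subst Bochner_Integration.integral_add) auto
    finally have "norm (LINT x|circle. h x * of_real (c x)) = norm (LINT x|circle. h x * of_real (c x - P x))" by simp
    also have "\<dots> \<le> (LINT x|circle. e * norm (h x))"
    proof (rule order_trans[OF integral_norm_bound])
      show "(LINT x|circle. norm (h x * of_real (c x - P x))) \<le> (LINT x|circle. e * norm (h x))"
        using bound iD hi by (intro integral_mono) auto
    qed
    finally show ?thesis by (simp add: I_def)
  qed
  then have "norm (LINT x|circle. h x * of_real (c x)) \<le> e" if "e > 0" for e
  proof -
    have "e / (I + 1) > 0" using that I0 by simp
    from \<open>\<And>e. e > 0 \<Longrightarrow> norm (LINT x|circle. h x * of_real (c x)) \<le> e * I\<close>[OF this]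
    have "norm (LINT x|circle. h x * of_real (c x)) \<le> e / (I + 1) * I" .
    also have "\<dots> \<le> e" using that I0 by (simp add: divide_le_eq algebra_simps)
    finally show ?thesis .
  qed
  note small = this
  have "norm (LINT x|circle. h x * of_real (c x)) \<le> 0"
  proof (rule field_le_epsilon)
    fix e :: real assume "0 < e"
    then show "norm (LINT x|circle. h x * of_real (c x)) \<le> 0 + e"
      unfolding add_0 by (rule small)
  qed
  then show ?thesis by (simp only: norm_le_zero_iff)
qed

lemma annihilates_characters_continuous:
  fixes c :: "real \<Rightarrow> complex"
  assumes h: "annihilates_characters h" and c: "continuous_on UNIV c" and ends: "c 0 = c 1"
    and B: "\<And>x. norm (c x) \<le> B"
  shows "(LINT x|circle. h x * c x) = 0"
proof -
  have hi: "integrable circle h" using h by (simp add: annihilates_characters_def)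
  have 1: "(LINT x|circle. h x * of_real (Re (c x))) = 0" "(LINT x|circle. h x * of_real (Im (c x))) = 0"
    using ends by (intro annihilates_characters_real_continuous[OF h] continuous_intros c; simp)+
  have m: "c \<in> borel_measurable circle"
    using c by (intro circle_measurable_borel borel_measurable_continuous_onI)
  have i: "integrable circle (\<lambda>x. h x * of_real (Re (c x)))" "integrable circle (\<lambda>x. h x * of_real (Im (c x)))"
    using B order_trans[OF abs_Re_le_cmod B] order_trans[OF abs_Im_le_cmod B] m
    by (intro integrable_mult_bounded[OF hi, where B=B]; simp)+
  have "(LINT x|circle. h x * c x)
      = (LINT x|circle. h x * of_real (Re (c x)) + \<i> * (h x * of_real (Im (c x))))"
    by (intro Bochner_Integration.integral_cong refl) (simp add: complex_eq_iff algebra_simps)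
  also have "\<dots> = 0"
    using i 1 by (subst Bochner_Integration.integral_add) auto
  finally show ?thesis .
qed

text \<open>Test \<open>h\<close> against bounded continuous functions converging almost everywhere to the
  conjugate of its phase: the integrals vanish and converge to the integral of \<open>|h|\<close>.\<close>
theorem annihilates_characters_AE_zero:
  assumes h: "annihilates_characters h"
  shows "AE x in circle. h x = 0"
proof -
  have hi: "integrable circle h" using h by (simp add: annihilates_characters_def)
  have [measurable]: "h \<in> borel_measurable circle" using hi by auto
  \<comment> \<open>The conjugate phase of \<open>h\<close>, extended by zero to the line.\<close>
  define u where "u x = (if x \<in> {0..<1} then cnj (sgn (h x)) else 0)" for x
  have um: "u \<in> borel_measurable lebesgue"
    unfolding u_def
    by (rule borel_measurable_if_I) (auto intro: borel_measurable_sgn measurable_compose[OF _ borel_measurable_continuous_onI] continuous_intros simp: comp_def)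
  obtain c where c: "\<And>k. continuous_on UNIV (c k)" "\<And>k x. norm (c k x) \<le> 1"
    "\<And>k x. x \<notin> {0<..<1} \<Longrightarrow> c k x = 0" "AE x in lebesgue. (\<lambda>k. c k x) \<longlonglongrightarrow> u x"
    by (rule bounded_function_continuous_approx[OF um, of 1 0 1]) (auto simp: u_def norm_sgn)
  have z: "(LINT x|circle. h x * c k x) = 0" for k
    using c by (intro annihilates_characters_continuous[OF h, of _ 1]) auto
  have [measurable]: "c k \<in> borel_measurable circle" for k
    using c(1) by (intro circle_measurable_borel borel_measurable_continuous_onI)
  have [measurable]: "u \<in> borel_measurable circle"
    using um by (intro measurable_restrict_space1)
  have "(\<lambda>k. LINT x|circle. h x * c k x) \<longlonglongrightarrow> (LINT x|circle. h x * u x)"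
  proof (rule integral_dominated_convergence[where w="\<lambda>x. norm (h x)"])
    show "AE x in circle. (\<lambda>k. h x * c k x) \<longlonglongrightarrow> h x * u x"
    proof (subst AE_restrict_space_iff)
      show "AE x in lebesgue. x \<in> {0..<1} \<longrightarrow> (\<lambda>k. h x * c k x) \<longlonglongrightarrow> h x * u x"
        using c(4) by eventually_elim (auto intro: tendsto_intros)
    qed auto
    show "AE x in circle. norm (h x * c k x) \<le> norm (h x)" for k
      using c(2)[of k] by (intro AE_I2) (simp add: norm_mult mult_left_le)
  qed (use hi in auto)
  then have "(\<lambda>k::nat. 0) \<longlonglongrightarrow> (LINT x|circle. h x * u x)"
    by (simp only: z)
  then have "(LINT x|circle. h x * u x) = 0"
    by (simp only: LIMSEQ_const_iff)
  moreover have "(LINT x|circle. h x * u x) = (LINT x|circle. of_real (norm (h x)))"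
  proof (intro Bochner_Integration.integral_cong refl)
    fix x assume "x \<in> space circle"
    then have "h x * u x = h x * cnj (sgn (h x))" by (simp add: u_def)
    also have "\<dots> = of_real (norm (h x))"
    proof (cases "h x = 0")
      case False
      have "h x * cnj (sgn (h x)) = h x * cnj (h x) / of_real (norm (h x))"
        by (simp add: sgn_eq)
      also have "\<dots> = of_real (norm (h x))"
        using False by (simp only: complex_norm_square[symmetric]) (simp add: power2_eq_square)
      finally show ?thesis .
    qed simp
    finally show "h x * u x = of_real (norm (h x))" .
  qed
  ultimately have "(LINT x|circle. norm (h x)) = 0" by simp
  then have "AE x in circle. norm (h x) = 0"
    using hi by (subst (asm) integral_nonneg_eq_0_iff_AE) auto
  then show ?thesis by simp
qed

theorem fourier_coefficients_unique:
  assumes u: "integrable circle u" and v: "integrable circle v"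
    and eq: "\<And>n::int. (LINT x|circle. u x * cis (- (2 * pi * of_int n * x)))
      = (LINT x|circle. v x * cis (- (2 * pi * of_int n * x)))"
  shows "AE x in circle. u x = v x"
proof -
  have iu: "integrable circle (\<lambda>x. u x * cis (2 * pi * of_int n * x))"
    and iv: "integrable circle (\<lambda>x. v x * cis (2 * pi * of_int n * x))" for n :: int
    using circle_integrable_mult_cis[OF u, of "2 * pi * of_int n"]
      circle_integrable_mult_cis[OF v, of "2 * pi * of_int n"] by auto
  have "annihilates_characters (\<lambda>x. u x - v x)"
    unfolding annihilates_characters_def
  proof (intro conjI allI)
    fix n :: int
    have "(LINT x|circle. (u x - v x) * cis (2 * pi * of_int n * x))
      = (LINT x|circle. u x * cis (2 * pi * of_int n * x)) - (LINT x|circle. v x * cis (2 * pi * of_int n * x))"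
      by (simp only: left_diff_distrib Bochner_Integration.integral_diff[OF iu iv])
    then show "(LINT x|circle. (u x - v x) * cis (2 * pi * of_int n * x)) = 0"
      using eq[of "- n"] by simp
  qed (use u v in auto)
  from annihilates_characters_AE_zero[OF this] show ?thesis by simp
qed

section \<open>Fourier integrals\<close>

lemma Lp_one_iff_integrable: "f \<in> Lp 1 M \<longleftrightarrow> integrable M f"
  unfolding Lp_def by (auto simp: integrable_iff_bounded)

lemma integrable_inverse_quadratic: "integrable lebesgue (\<lambda>\<xi>. C / (1 + \<xi>\<^sup>2) :: real)"
proof -
  have e: "einterval (-\<infinity>) \<infinity> = UNIV" by (auto simp: einterval_def)
  have "integrable lborel (\<lambda>x::real. inverse (1 + x\<^sup>2))"
    using integrable_inverse_1_plus_square unfolding set_integrable_def e by simp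
  then have "integrable lborel (\<lambda>x::real. C * inverse (1 + x\<^sup>2))" by simp
  then have "integrable lborel (\<lambda>x::real. C / (1 + x\<^sup>2))" by (simp add: divide_inverse)
  then show ?thesis by (subst integrable_completion) auto
qed

lemma fourier_integrable:
  assumes "integrable lebesgue G"
  shows "integrable lebesgue (\<lambda>x. G x * cis (k * x))"
proof (rule integrable_mult_bounded[OF assms])
  show "(\<lambda>x. cis (k * x)) \<in> borel_measurable lebesgue"
    by (intro measurable_completion) (simp, intro borel_measurable_continuous_onI continuous_intros)
  show "norm (cis (k * x)) \<le> 1" for x by simp
qed

lemma fourier_integral_linear:
  assumes f: "integrable lebesgue f" and g: "integrable lebesgue g"
  shows "fourier_integral (\<lambda>x. a * f x + b * g x) \<xi> = a * fourier_integral f \<xi> + b * fourier_integral g \<xi>"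
proof -
  have i: "integrable lebesgue (\<lambda>x. f x * cis (- (2 * pi * \<xi> * x)))"
    "integrable lebesgue (\<lambda>x. g x * cis (- (2 * pi * \<xi> * x)))"
    using fourier_integrable[OF f, of "- (2 * pi * \<xi>)"] fourier_integrable[OF g, of "- (2 * pi * \<xi>)"] by simp_all
  have "fourier_integral (\<lambda>x. a * f x + b * g x) \<xi>
    = (LINT x|lebesgue. a * (f x * cis (- (2 * pi * \<xi> * x))) + b * (g x * cis (- (2 * pi * \<xi> * x))))"
    unfolding fourier_integral_def by (simp add: algebra_simps)
  also have "\<dots> = a * fourier_integral f \<xi> + b * fourier_integral g \<xi>"
    unfolding fourier_integral_def using i by (subst Bochner_Integration.integral_add) auto
  finally show ?thesis .
qed

lemma fourier_integral_diff:
  assumes "integrable lebesgue f" "integrable lebesgue g"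
  shows "fourier_integral (\<lambda>x. f x - g x) \<xi> = fourier_integral f \<xi> - fourier_integral g \<xi>"
  using fourier_integral_linear[OF assms, of 1 "-1"] by simp

lemma norm_fourier_integral_le:
  "norm (fourier_integral f \<xi>) \<le> (LINT x|lebesgue. norm (f x))"
  unfolding fourier_integral_def
  using integral_norm_bound[of lebesgue "\<lambda>x. f x * cis (- (2 * pi * \<xi> * x))"] by (simp add: norm_mult)

text \<open>Dominated convergence, with the absolute value of the function as the bound.\<close>
lemma fourier_integral_continuous:
  assumes G: "integrable lebesgue G"
  shows "continuous_on UNIV (fourier_integral G)"
proof -
  have "(\<lambda>n. fourier_integral G (s n)) \<longlonglongrightarrow> fourier_integral G \<xi>" if s: "s \<longlonglongrightarrow> \<xi>" for s :: "nat \<Rightarrow> real" and \<xi>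
    unfolding fourier_integral_def
  proof (rule integral_dominated_convergence[where w="\<lambda>x. norm (G x)"])
    show "(\<lambda>x. G x * cis (- (2 * pi * \<xi> * x))) \<in> borel_measurable lebesgue"
      using borel_measurable_integrable[OF fourier_integrable[OF G, of "- (2 * pi * \<xi>)"]] by simp
    show "(\<lambda>x. G x * cis (- (2 * pi * s i * x))) \<in> borel_measurable lebesgue" for i
      using borel_measurable_integrable[OF fourier_integrable[OF G, of "- (2 * pi * s i)"]] by simp
    show "AE x in lebesgue. (\<lambda>i. G x * cis (- (2 * pi * s i * x))) \<longlonglongrightarrow> G x * cis (- (2 * pi * \<xi> * x))"
      using s by (intro AE_I2 tendsto_intros)
  qed (use G in \<open>auto simp: norm_mult\<close>)
  then show ?thesis
    by (auto simp: continuous_on_eq_continuous_at continuous_at_sequentially comp_def)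
qed

lemma fourier_integral_measurable:
  "integrable lebesgue G \<Longrightarrow> fourier_integral G \<in> borel_measurable borel"
  by (intro borel_measurable_continuous_onI fourier_integral_continuous)

lemma emeasure_lebesgue_affine_preimage:
  fixes c s :: real
  assumes A: "A \<in> sets lebesgue" and c: "c \<noteq> 0"
  shows "emeasure lebesgue A = ennreal \<bar>c\<bar> * emeasure lebesgue {y. s + c * y \<in> A}"
proof -
  have T: "(\<lambda>x. s + c * x) \<in> lebesgue \<rightarrow>\<^sub>M lebesgue"
    using lebesgue_affine_measurable[where c="\<lambda>_::real. c" and t=s] c by simp
  have B: "{y. s + c * y \<in> A} \<in> sets lebesgue"
    using measurable_sets[OF T A] by (simp add: vimage_def)
  have "emeasure lebesgue A = (\<integral>\<^sup>+x. indicator A x \<partial>lebesgue)" using A by simp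
  also have "\<dots> = ennreal \<bar>c\<bar> * (\<integral>\<^sup>+x. indicator A (s + c * x) \<partial>lebesgue)"
    using A c by (intro nn_integral_real_affine_lebesgue) auto
  also have "(\<integral>\<^sup>+x. indicator A (s + c * x) \<partial>lebesgue) = (\<integral>\<^sup>+x. indicator {y. s + c * y \<in> A} x \<partial>lebesgue)"
    by (simp add: indicator_def)
  also have "\<dots> = emeasure lebesgue {y. s + c * y \<in> A}" using B by simp
  finally show ?thesis .
qed

text \<open>An affine bijection pulls null sets back to null sets. The property need not be
  measurable, because the exceptional set is first enlarged to a null set.\<close>
lemma AE_lebesgue_affine:
  fixes c t :: real
  assumes P: "AE x in lebesgue. P x" and c: "c \<noteq> 0"
  shows "AE x in lebesgue. P (t + c * x)"
proof -
  obtain N where N: "\<And>x. x \<in> space lebesgue - N \<Longrightarrow> P x" "N \<in> null_sets lebesgue"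
    using AE_E3[OF P] by blast
  have T: "(\<lambda>x. t + c * x) \<in> lebesgue \<rightarrow>\<^sub>M lebesgue"
    using lebesgue_affine_measurable[where c="\<lambda>_::real. c" and t=t] c by simp
  have A: "{x. t + c * x \<in> N} \<in> sets lebesgue"
    using measurable_sets[OF T, of N] N(2) by (auto simp: vimage_def)
  have "emeasure lebesgue {x. t + c * x \<in> N} = 0"
    using emeasure_lebesgue_affine_preimage[of N c t] N(2) c by (auto simp: null_sets_def)
  then have "{x. t + c * x \<in> N} \<in> null_sets lebesgue" using A by auto
  from AE_not_in[OF this] show ?thesis
    by eventually_elim (use N(1) in auto)
qed

lemma test_function_continuous: "test_function f \<Longrightarrow> continuous_on UNIV f"
  by (simp add: test_function_def)

lemma test_function_measurable_borel: "test_function f \<Longrightarrow> f \<in> borel_measurable borel"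
  by (intro borel_measurable_continuous_onI test_function_continuous)

lemma test_function_measurable: "test_function f \<Longrightarrow> f \<in> borel_measurable lebesgue"
  by (intro measurable_completion) (simp add: test_function_measurable_borel)

lemma test_function_bounded_support:
  assumes "test_function f"
  obtains R B where "R > 0" "\<And>x. norm (f x) \<le> B" "\<And>x. \<bar>x\<bar> > R \<Longrightarrow> f x = 0"
proof -
  obtain R where R: "\<And>x. \<bar>x\<bar> > R \<Longrightarrow> f x = 0" using assms unfolding test_function_def by blast
  define S where "S = \<bar>R\<bar> + 1"
  have "compact (f ` {-S..S})"
    using assms by (intro compact_continuous_image continuous_on_subset[OF test_function_continuous]) auto
  then have "bounded (f ` {-S..S})" by (rule compact_imp_bounded)
  then have "\<exists>B. \<forall>x\<in>{-S..S}. norm (f x) \<le> B" by (auto simp: bounded_iff)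
  then obtain B where B: "\<And>x. x \<in> {-S..S} \<Longrightarrow> norm (f x) \<le> B" by blast
  have S: "f x = 0" if "\<bar>x\<bar> > S" for x using that by (intro R) (simp add: S_def)
  show thesis
  proof (rule that[of S "max B 0"])
    show "norm (f x) \<le> max B 0" for x
    proof (cases "x \<in> {-S..S}")
      case False
      then have "\<bar>x\<bar> > S" by (auto simp: abs_if)
      then show ?thesis by (simp add: S)
    qed (use B in \<open>simp add: le_max_iff_disj\<close>)
  qed (use S in \<open>auto simp: S_def\<close>)
qed

lemma test_function_Lp:
  assumes f: "test_function f" and q: "q > 0"
  shows "f \<in> Lp q lebesgue"
proof -
  obtain R B where R: "R > 0" "\<And>x. norm (f x) \<le> B" "\<And>x. \<bar>x\<bar> > R \<Longrightarrow> f x = 0"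
    using test_function_bounded_support[OF f] by blast
  have "power_mass q lebesgue f \<le> ennreal (B powr q * (2 * R))"
    using R q by (intro power_mass_le_uniform_bound test_function_measurable f) (auto simp: abs_if)
  then have "power_mass q lebesgue f < \<infinity>" by (rule le_less_trans) simp
  then show ?thesis using f by (simp add: Lp_iff test_function_measurable)
qed

lemma test_function_integrable: "test_function f \<Longrightarrow> integrable lebesgue f"
  using test_function_Lp[of f 1] by (simp add: Lp_one_iff_integrable)

lemma test_function_fourier_decay:
  assumes "test_function f"
  obtains C where "C \<ge> 0" "\<And>\<xi>. norm (fourier_integral f \<xi>) \<le> C / (1 + \<xi>\<^sup>2)"
proof -
  obtain C where C: "\<And>\<xi>. norm (fourier_integral f \<xi>) \<le> C / (1 + \<xi>\<^sup>2)"
    using assms unfolding test_function_def by blast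
  have "C \<ge> 0" using C[of 0] norm_ge_zero[of "fourier_integral f 0"] by (simp, linarith)
  then show thesis using C that by blast
qed

lemma test_function_linear:
  assumes f: "test_function f" and g: "test_function g"
  shows "test_function (\<lambda>x. a * f x + b * g x)"
proof -
  obtain R where R: "\<And>x. \<bar>x\<bar> > R \<Longrightarrow> f x = 0" using f unfolding test_function_def by blast
  obtain S where S: "\<And>x. \<bar>x\<bar> > S \<Longrightarrow> g x = 0" using g unfolding test_function_def by blast
  obtain C where C: "\<And>\<xi>. norm (fourier_integral f \<xi>) \<le> C / (1 + \<xi>\<^sup>2)" using f unfolding test_function_def by blast
  obtain D where D: "\<And>\<xi>. norm (fourier_integral g \<xi>) \<le> D / (1 + \<xi>\<^sup>2)" using g unfolding test_function_def by blast
  have "continuous_on UNIV (\<lambda>x. a * f x + b * g x)"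
    by (intro continuous_intros test_function_continuous f g)
  moreover have "a * f x + b * g x = 0" if "\<bar>x\<bar> > max R S" for x
    using R[of x] S[of x] that by simp
  moreover have "norm (fourier_integral (\<lambda>x. a * f x + b * g x) \<xi>) \<le> (norm a * C + norm b * D) / (1 + \<xi>\<^sup>2)" for \<xi>
  proof -
    have "norm (fourier_integral (\<lambda>x. a * f x + b * g x) \<xi>)
      \<le> norm a * norm (fourier_integral f \<xi>) + norm b * norm (fourier_integral g \<xi>)"
      using norm_triangle_ineq[of "a * fourier_integral f \<xi>" "b * fourier_integral g \<xi>"]
      by (simp add: fourier_integral_linear test_function_integrable f g norm_mult)
    also have "\<dots> \<le> norm a * (C / (1 + \<xi>\<^sup>2)) + norm b * (D / (1 + \<xi>\<^sup>2))"
      by (intro add_mono mult_left_mono C D) auto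
    finally show ?thesis by (simp add: add_divide_distrib)
  qed
  ultimately show ?thesis unfolding test_function_def by blast
qed

lemma test_function_diff:
  "test_function f \<Longrightarrow> test_function g \<Longrightarrow> test_function (\<lambda>x. f x - g x)"
  using test_function_linear[of f g 1 "-1"] by simp

lemma fourier_integral_translate:
  assumes f: "test_function f"
  shows "fourier_integral (\<lambda>x. f (x - A)) \<xi> = cis (- (2 * pi * \<xi> * A)) * fourier_integral f \<xi>"
proof -
  have [measurable]: "f \<in> borel_measurable borel" by (rule test_function_measurable_borel[OF f])
  have c[measurable]: "(\<lambda>x. cis (- (2 * pi * \<xi> * x))) \<in> borel_measurable borel"
    by (intro borel_measurable_continuous_onI continuous_intros)
  have "fourier_integral (\<lambda>x. f (x - A)) \<xi> = (LINT x|lborel. f (x - A) * cis (- (2 * pi * \<xi> * x)))"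
    unfolding fourier_integral_def by (rule integral_completion) measurable
  also have "\<dots> = (LINT x|lborel. f x * cis (- (2 * pi * \<xi> * (A + x))))"
    by (subst lborel_integral_real_affine[of 1 _ A]) auto
  also have "\<dots> = (LINT x|lborel. cis (- (2 * pi * \<xi> * A)) * (f x * cis (- (2 * pi * \<xi> * x))))"
    by (intro Bochner_Integration.integral_cong refl) (simp add: cis_mult algebra_simps)
  also have "\<dots> = cis (- (2 * pi * \<xi> * A)) * (LINT x|lborel. f x * cis (- (2 * pi * \<xi> * x)))"
    by (rule integral_mult_right_zero)
  also have "(LINT x|lborel. f x * cis (- (2 * pi * \<xi> * x))) = fourier_integral f \<xi>"
    unfolding fourier_integral_def by (rule integral_completion[symmetric]) measurable
  finally show ?thesis .
qed

lemma test_function_translate: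
  assumes f: "test_function f"
  shows "test_function (\<lambda>x. f (x - A))"
proof -
  obtain R where R: "\<And>x. \<bar>x\<bar> > R \<Longrightarrow> f x = 0" using f unfolding test_function_def by blast
  obtain C where C: "\<And>\<xi>. norm (fourier_integral f \<xi>) \<le> C / (1 + \<xi>\<^sup>2)" using f unfolding test_function_def by blast
  have "continuous_on UNIV (\<lambda>x. f (x - A))"
    by (rule continuous_on_compose2[OF test_function_continuous[OF f]]) (auto intro: continuous_intros)
  moreover have "f (x - A) = 0" if "\<bar>x\<bar> > R + \<bar>A\<bar>" for x
    using that by (intro R) linarith
  moreover have "norm (fourier_integral (\<lambda>x. f (x - A)) \<xi>) \<le> C / (1 + \<xi>\<^sup>2)" for \<xi>
    using C[of \<xi>] by (simp add: fourier_integral_translate[OF f] norm_mult)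
  ultimately show ?thesis unfolding test_function_def by blast
qed

lemma integrable_of_quadratic_decay:
  fixes F :: "real \<Rightarrow> complex"
  assumes "F \<in> borel_measurable lebesgue" "\<And>\<xi>. norm (F \<xi>) \<le> C / (1 + \<xi>\<^sup>2)"
  shows "integrable lebesgue F"
  by (rule Bochner_Integration.integrable_bound[OF integrable_inverse_quadratic[of C] assms(1)])
    (intro AE_I2, rule order_trans[OF assms(2)], simp only: real_norm_def abs_ge_self)

lemma test_function_fourier_measurable:
  "test_function f \<Longrightarrow> fourier_integral f \<in> borel_measurable lebesgue"
  by (intro measurable_completion) (simp add: fourier_integral_measurable test_function_integrable)

lemma test_function_fourier_integrable:
  assumes "test_function f" shows "integrable lebesgue (fourier_integral f)"
  using test_function_fourier_decay[OF assms] integrable_of_quadratic_decay[OF test_function_fourier_measurable[OF assms]]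
  by metis

section \<open>Character series and Riemann sums\<close>

definition character_series :: "(int \<Rightarrow> complex) \<Rightarrow> real \<Rightarrow> complex" where
  "character_series b x = (LINT n|count_space UNIV. b n * cis (2 * pi * of_int n * x))"

text \<open>A nontrivial character has a primitive with the same period.\<close>
lemma integral_character_circle:
  "(LINT x|circle. cis (2 * pi * of_int n * x)) = (if n = 0 then 1 else 0)"
proof (cases "n = 0")
  case True
  then show ?thesis using measure_circle_UNIV by simp
next
  case False
  define k where "k = 2 * pi * real_of_int n"
  have k: "k \<noteq> 0" using False by (simp add: k_def)
  define E where "E x = exp (\<i> * of_real k * of_real x) / (\<i> * of_real k)" for x :: real
  have E: "(E has_vector_derivative cis (k * x)) (at x within A)" for x A
    unfolding E_def
    by (rule has_vector_derivative_real_field) (use k in \<open>auto intro!: derivative_eq_intros simp: cis_conv_exp mult.assoc\<close>)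
  have "(LINT x|circle. cis (2 * pi * of_int n * x)) = (LINT x|lebesgue. indicator {0..<1} x *\<^sub>R cis (k * x))"
    unfolding k_def by (rule integral_restrict_space) simp
  also have "\<dots> = (LINT x|lborel. indicator {0..<1} x *\<^sub>R cis (k * x))"
  proof (rule integral_completion)
    have [measurable]: "(\<lambda>x. cis (k * x)) \<in> borel_measurable borel"
      by (intro borel_measurable_continuous_onI continuous_intros)
    show "(\<lambda>x. indicat_real {0..<1} x *\<^sub>R cis (k * x)) \<in> borel_measurable lborel" by measurable
  qed
  also have "\<dots> = (LINT x|lborel. indicator {0..1} x *\<^sub>R cis (k * x))"
  proof (rule integral_cong_AE)
    have [measurable]: "(\<lambda>x. cis (k * x)) \<in> borel_measurable borel"
      by (intro borel_measurable_continuous_onI continuous_intros)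
    show "(\<lambda>x. indicat_real {0..<1} x *\<^sub>R cis (k * x)) \<in> borel_measurable lborel" by measurable
    show "(\<lambda>x. indicat_real {0..1} x *\<^sub>R cis (k * x)) \<in> borel_measurable lborel" by measurable
    show "AE x in lborel. indicat_real {0..<1} x *\<^sub>R cis (k * x) = indicat_real {0..1} x *\<^sub>R cis (k * x)"
      using AE_lborel_singleton[of 1] by eventually_elim (auto simp: indicator_def)
  qed
  also have "\<dots> = E 1 - E 0"
    by (rule integral_FTC_Icc) (auto intro: E continuous_intros)
  also have "\<dots> = 0"
  proof -
    have "exp (\<i> * of_real k) = cis (2 * pi * real_of_int n)" by (simp add: k_def cis_conv_exp)
    also have "\<dots> = 1" by (rule cis_multiple_2pi) simp
    finally show ?thesis by (simp add: E_def)
  qed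
  finally show ?thesis using False by simp
qed

lemma character_series_pair_measurable:
  "(\<lambda>(n, x). b n * cis (k n * x)) \<in> borel_measurable (count_space (UNIV::int set) \<Otimes>\<^sub>M borel)"
  by (rule measurable_pair_measure_countable1)
    (auto intro!: borel_measurable_continuous_onI continuous_intros)

lemma character_series_measurable [measurable]: "character_series b \<in> borel_measurable borel"
proof -
  interpret sigma_finite_measure "count_space (UNIV::int set)" by (rule sigma_finite_measure_count_space)
  have "(\<lambda>(x, n). b n * cis (2 * pi * of_int n * x)) \<in> borel_measurable (borel \<Otimes>\<^sub>M count_space (UNIV::int set))"
    using measurable_compose[OF measurable_pair_swap' character_series_pair_measurable[of b "\<lambda>n. 2 * pi * of_int n"]]
    by (simp add: case_prod_beta')
  then show ?thesis unfolding character_series_def by (rule borel_measurable_lebesgue_integral)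
qed

lemma norm_character_series_le:
  "norm (character_series b x) \<le> (LINT n|count_space UNIV. norm (b n))"
  unfolding character_series_def
  using integral_norm_bound[of "count_space UNIV" "\<lambda>n. b n * cis (2 * pi * of_int n * x)"]
  by (simp add: norm_mult)

text \<open>The coefficients are absolutely summable, so sum and integral may be exchanged.\<close>
lemma character_series_coefficient:
  assumes b: "integrable (count_space UNIV) b"
  shows "integrable circle (character_series b)"
    and "(LINT x|circle. character_series b x * cis (- (2 * pi * of_int m * x))) = b m"
proof -
  interpret F: finite_measure circle by (rule circle_finite)
  have csm: "character_series b \<in> borel_measurable circle"
    by (intro circle_measurable_borel character_series_measurable)
  then show "integrable circle (character_series b)"
    by (rule F.integrable_const_bound[rotated, where B="LINT n|count_space UNIV. norm (b n)"])
      (simp add: norm_character_series_le)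
  interpret C: sigma_finite_measure "count_space (UNIV::int set)" by (rule sigma_finite_measure_count_space)
  interpret P: pair_sigma_finite "count_space (UNIV::int set)" circle ..
  define g where "g n x = b n * cis (2 * pi * of_int (n - m) * x)" for n x
  have gm: "case_prod g \<in> borel_measurable (count_space UNIV \<Otimes>\<^sub>M circle)"
    unfolding g_def
    by (rule measurable_pair_measure_countable1)
      (auto intro!: circle_measurable_borel borel_measurable_continuous_onI continuous_intros)
  have gi: "integrable circle (g n)" for n
    unfolding g_def by (rule F.integrable_const_bound[where B="norm (b n)"])
     (auto simp: norm_mult intro!: circle_measurable_borel borel_measurable_continuous_onI continuous_intros)
  have pi: "integrable (count_space UNIV \<Otimes>\<^sub>M circle) (case_prod g)"
  proof (rule P.Fubini_integrable[OF gm])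
    show "integrable (count_space UNIV) (\<lambda>n. LINT x|circle. norm (case_prod g (n, x)))"
      using b measure_circle_UNIV by (simp add: g_def norm_mult)
  qed (use gi in auto)
  have "(LINT x|circle. character_series b x * cis (- (2 * pi * of_int m * x)))
      = (LINT x|circle. LINT n|count_space UNIV. g n x)"
    unfolding character_series_def
    by (subst integral_mult_left_zero[symmetric]) (simp add: g_def mult.assoc cis_mult algebra_simps)
  also have "\<dots> = (LINT n|count_space UNIV. LINT x|circle. g n x)"
    by (rule P.Fubini_integral[OF pi])
  also have "\<dots> = (LINT n|count_space UNIV. b n * indicator {m} n)"
  proof (intro Bochner_Integration.integral_cong refl)
    fix n :: int
    have "(LINT x|circle. g n x) = b n * (LINT x|circle. cis (2 * pi * of_int (n - m) * x))"
      unfolding g_def by (rule integral_mult_right_zero)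
    then show "(LINT x|circle. g n x) = b n * indicator {m} n"
      by (simp only: integral_character_circle) (simp add: indicator_def)
  qed
  also have "\<dots> = (LINT n|count_space UNIV. indicator {m} n *\<^sub>R b m)"
    by (intro Bochner_Integration.integral_cong refl) (auto simp: indicator_def)
  also have "\<dots> = b m" by simp
  finally show "(LINT x|circle. character_series b x * cis (- (2 * pi * of_int m * x))) = b m" .
qed

text \<open>An integrable function with absolutely summable Fourier coefficients is the sum of its
  Fourier series: the sum has the same coefficients, and those determine a function up to null
  sets.\<close>
lemma AE_eq_character_series:
  assumes u: "integrable circle u" and b: "integrable (count_space UNIV) b"
    and "\<And>n::int. (LINT x|circle. u x * cis (- (2 * pi * of_int n * x))) = b n"
  shows "AE x in circle. u x = character_series b x"
  using assms character_series_coefficient[OF b] by (intro fourier_coefficients_unique) auto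

lemma sample_point_close:
  fixes \<epsilon> \<xi> :: real
  assumes "\<epsilon> > 0"
  shows "\<epsilon> * \<lfloor>\<xi> / \<epsilon>\<rfloor> \<le> \<xi>" "\<xi> < \<epsilon> * \<lfloor>\<xi> / \<epsilon>\<rfloor> + \<epsilon>"
proof -
  have fl: "real_of_int \<lfloor>\<xi> / \<epsilon>\<rfloor> \<le> \<xi> / \<epsilon>" "\<xi> / \<epsilon> < real_of_int \<lfloor>\<xi> / \<epsilon>\<rfloor> + 1" by linarith+
  have "\<epsilon> * \<lfloor>\<xi> / \<epsilon>\<rfloor> \<le> \<epsilon> * (\<xi> / \<epsilon>)" "\<epsilon> * (\<xi> / \<epsilon>) < \<epsilon> * (real_of_int \<lfloor>\<xi> / \<epsilon>\<rfloor> + 1)"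
    by (rule mult_left_mono[OF fl(1)], use assms in simp) (rule mult_strict_left_mono[OF fl(2) assms])
  moreover have "\<epsilon> * (\<xi> / \<epsilon>) = \<xi>" using assms by simp
  ultimately show "\<epsilon> * \<lfloor>\<xi> / \<epsilon>\<rfloor> \<le> \<xi>" "\<xi> < \<epsilon> * \<lfloor>\<xi> / \<epsilon>\<rfloor> + \<epsilon>"
    by (simp_all only: distrib_left mult_1_right)
qed

text \<open>Each cell \<open>[\<epsilon> a, \<epsilon> (a + 1))\<close> has length \<open>\<epsilon>\<close>. So a sum over the integers times \<open>\<epsilon>\<close> is an
  integral over the line of a step function, and convergence of Riemann sums becomes convergence
  of integrands.\<close>
lemma distr_floor_lebesgue:
  assumes \<epsilon>: "\<epsilon> > 0"
  shows "distr lebesgue (count_space UNIV) (\<lambda>\<xi>. \<lfloor>\<xi> / \<epsilon>\<rfloor>) = density (count_space UNIV) (\<lambda>_::int. ennreal \<epsilon>)"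
proof (rule measure_eqI_countable[of _ UNIV])
  fix a :: int
  have m: "(\<lambda>\<xi>. \<lfloor>\<xi> / \<epsilon>\<rfloor>) \<in> measurable lebesgue (count_space UNIV)"
    by (intro measurable_completion) measurable
  have "(\<lambda>\<xi>. \<lfloor>\<xi> / \<epsilon>\<rfloor>) -` {a} = {\<epsilon> * a..<\<epsilon> * a + \<epsilon>}"
  proof (intro equalityI subsetI)
    fix \<xi> assume "\<xi> \<in> (\<lambda>\<xi>. \<lfloor>\<xi> / \<epsilon>\<rfloor>) -` {a}"
    then show "\<xi> \<in> {\<epsilon> * a..<\<epsilon> * a + \<epsilon>}" using sample_point_close[OF \<epsilon>, of \<xi>] by auto
  next
    fix \<xi> assume "\<xi> \<in> {\<epsilon> * a..<\<epsilon> * a + \<epsilon>}"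
    then have "a \<le> \<xi> / \<epsilon>" "\<xi> / \<epsilon> < a + 1" using \<epsilon> by (simp_all add: field_simps)
    then show "\<xi> \<in> (\<lambda>\<xi>. \<lfloor>\<xi> / \<epsilon>\<rfloor>) -` {a}" by (auto simp: floor_eq_iff)
  qed
  then have "emeasure (distr lebesgue (count_space UNIV) (\<lambda>\<xi>. \<lfloor>\<xi> / \<epsilon>\<rfloor>)) {a} = emeasure lebesgue {\<epsilon> * a..<\<epsilon> * a + \<epsilon>}"
    using m by (subst emeasure_distr) auto
  also have "\<dots> = ennreal \<epsilon>" using \<epsilon> by simp
  also have "\<dots> = emeasure (density (count_space UNIV) (\<lambda>_::int. ennreal \<epsilon>)) {a}"
    by (subst emeasure_density) (auto simp: nn_integral_count_space_indicator[symmetric] nn_integral_cmult one_ennreal_def[symmetric])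
  finally show "emeasure (distr lebesgue (count_space UNIV) (\<lambda>\<xi>. \<lfloor>\<xi> / \<epsilon>\<rfloor>)) {a}
    = emeasure (density (count_space UNIV) (\<lambda>_::int. ennreal \<epsilon>)) {a}" .
qed auto

lemma floor_div_measurable: "(\<lambda>\<xi>::real. \<lfloor>\<xi> / \<epsilon>\<rfloor>) \<in> measurable lebesgue (count_space UNIV)"
  by (intro measurable_completion) measurable

lemma
  fixes a :: "int \<Rightarrow> complex"
  assumes \<epsilon>: "\<epsilon> > 0"
  shows integrable_floor_iff: "integrable lebesgue (\<lambda>\<xi>. a \<lfloor>\<xi> / \<epsilon>\<rfloor>) \<longleftrightarrow> integrable (count_space UNIV) a"
    and integral_floor: "(LINT \<xi>|lebesgue. a \<lfloor>\<xi> / \<epsilon>\<rfloor>) = (LINT n|count_space UNIV. of_real \<epsilon> * a n)"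
proof -
  have "integrable lebesgue (\<lambda>\<xi>. a \<lfloor>\<xi> / \<epsilon>\<rfloor>) \<longleftrightarrow> integrable (distr lebesgue (count_space UNIV) (\<lambda>\<xi>. \<lfloor>\<xi> / \<epsilon>\<rfloor>)) a"
    by (subst integrable_distr_eq[OF floor_div_measurable]) auto
  also have "\<dots> \<longleftrightarrow> integrable (count_space UNIV) (\<lambda>n. \<epsilon> *\<^sub>R a n)"
    unfolding distr_floor_lebesgue[OF \<epsilon>] using \<epsilon> by (subst integrable_density) auto
  also have "\<dots> \<longleftrightarrow> integrable (count_space UNIV) a"
    using integrable_scaleR_right[of "1 / \<epsilon>" "count_space UNIV" "\<lambda>n. \<epsilon> *\<^sub>R a n"]
      integrable_scaleR_right[of \<epsilon> "count_space UNIV" a] \<epsilon> by auto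
  finally show "integrable lebesgue (\<lambda>\<xi>. a \<lfloor>\<xi> / \<epsilon>\<rfloor>) \<longleftrightarrow> integrable (count_space UNIV) a" .
  have "(LINT \<xi>|lebesgue. a \<lfloor>\<xi> / \<epsilon>\<rfloor>) = (LINT n|distr lebesgue (count_space UNIV) (\<lambda>\<xi>. \<lfloor>\<xi> / \<epsilon>\<rfloor>). a n)"
    by (subst integral_distr[OF floor_div_measurable]) auto
  also have "\<dots> = (LINT n|count_space UNIV. \<epsilon> *\<^sub>R a n)"
    unfolding distr_floor_lebesgue[OF \<epsilon>] using \<epsilon> by (subst integral_density) auto
  finally show "(LINT \<xi>|lebesgue. a \<lfloor>\<xi> / \<epsilon>\<rfloor>) = (LINT n|count_space UNIV. of_real \<epsilon> * a n)"
    by (simp add: scaleR_conv_of_real)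
qed

text \<open>Moving the argument by at most 1 costs at most the factor 3, so one integrable function
  dominates the samples at all mesh sizes.\<close>
lemma sample_quadratic_decay:
  fixes \<epsilon> \<xi> :: real
  assumes \<epsilon>: "0 < \<epsilon>" "\<epsilon> \<le> 1" and C: "C \<ge> 0"
  shows "C / (1 + (\<epsilon> * \<lfloor>\<xi> / \<epsilon>\<rfloor>)\<^sup>2) \<le> 3 * C / (1 + \<xi>\<^sup>2)"
proof -
  define s where "s = \<epsilon> * \<lfloor>\<xi> / \<epsilon>\<rfloor>"
  have d: "\<bar>\<xi> - s\<bar> \<le> 1" using sample_point_close[OF \<epsilon>(1), of \<xi>] \<epsilon> by (simp add: s_def)
  then have "(\<xi> - s)\<^sup>2 \<le> 1" by (simp add: abs_square_le_1)
  moreover have "\<xi>\<^sup>2 \<le> 2 * s\<^sup>2 + 2 * (\<xi> - s)\<^sup>2"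
    using zero_le_power2[of "\<xi> - 2 * s"] by (simp add: power2_eq_square algebra_simps)
  ultimately have "\<xi>\<^sup>2 \<le> 2 * s\<^sup>2 + 2 * 1"
    by (meson add_left_mono mult_left_mono order_trans zero_le_numeral)
  moreover have "2 * s\<^sup>2 \<le> 3 * s\<^sup>2" by (intro mult_right_mono) auto
  ultimately have "1 + \<xi>\<^sup>2 \<le> 3 * (1 + s\<^sup>2)" by (simp only: distrib_left mult_1_right)
  then have "C * (1 + \<xi>\<^sup>2) \<le> C * (3 * (1 + s\<^sup>2))" using C by (rule mult_left_mono)
  moreover have "1 + s\<^sup>2 > 0" "1 + \<xi>\<^sup>2 > 0" by (auto intro: add_pos_nonneg)
  ultimately show ?thesis unfolding s_def[symmetric] by (simp add: divide_le_eq le_divide_eq field_simps)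
qed

context
  fixes F :: "real \<Rightarrow> complex" and C B :: real
  assumes F: "continuous_on UNIV F" and C: "C \<ge> 0" and decay: "\<And>\<xi>. norm (F \<xi>) \<le> C / (1 + \<xi>\<^sup>2)"
begin

lemma sampled_product_bound:
  fixes \<epsilon> \<xi> :: real
  assumes \<epsilon>: "0 < \<epsilon>" "\<epsilon> \<le> 1" and \<psi>: "\<And>n. norm (\<psi> n) \<le> B"
  shows "norm (\<psi> \<lfloor>\<xi> / \<epsilon>\<rfloor> * F (\<epsilon> * \<lfloor>\<xi> / \<epsilon>\<rfloor>)) \<le> (B * (3 * C)) / (1 + \<xi>\<^sup>2)"
proof -
  have "B \<ge> 0" using \<psi>[of 0] norm_ge_zero order_trans by blast
  have "norm (\<psi> \<lfloor>\<xi> / \<epsilon>\<rfloor> * F (\<epsilon> * \<lfloor>\<xi> / \<epsilon>\<rfloor>)) \<le> B * (3 * C / (1 + \<xi>\<^sup>2))"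
    unfolding norm_mult using \<open>B \<ge> 0\<close> order_trans[OF decay sample_quadratic_decay[OF \<epsilon> C]]
    by (intro mult_mono \<psi>) auto
  then show ?thesis by simp
qed

lemma integrable_sampled_coefficients:
  assumes \<epsilon>: "0 < \<epsilon>" "\<epsilon> \<le> 1" and \<psi>: "\<And>n. norm (\<psi> n) \<le> B"
  shows "integrable (count_space UNIV) (\<lambda>n. of_real \<epsilon> * (\<psi> n * F (\<epsilon> * of_int n)))"
proof -
  let ?a = "\<lambda>n. \<psi> n * F (\<epsilon> * of_int n)"
  have "(\<lambda>\<xi>. ?a \<lfloor>\<xi> / \<epsilon>\<rfloor>) \<in> borel_measurable lebesgue"
    by (rule measurable_compose[OF floor_div_measurable]) simp
  then have "integrable lebesgue (\<lambda>\<xi>. ?a \<lfloor>\<xi> / \<epsilon>\<rfloor>)"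
    by (rule integrable_of_quadratic_decay) (rule sampled_product_bound[OF \<epsilon> \<psi>])
  then show ?thesis using \<epsilon> by (subst (asm) integrable_floor_iff) auto
qed

text \<open>The series is the integral of a step function that samples \<open>F\<close> at \<open>\<epsilon> \<lfloor>\<xi> / \<epsilon>\<rfloor>\<close>. The sampled
  values of \<open>F\<close> converge by continuity, those of the symbols by hypothesis, and the common
  quadratic bound permits passing to the limit under the integral. The limit is written as a
  Fourier integral at \<open>- y\<close>, that is, as an inverse Fourier transform at \<open>y\<close>.\<close>
lemma sampled_series_tendsto:
  assumes \<epsilon>: "\<And>k. 0 < \<epsilon> k" "\<And>k. \<epsilon> k \<le> 1" "\<epsilon> \<longlonglongrightarrow> 0"
    and \<psi>: "\<And>k n. norm (\<psi> k n) \<le> B"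
    and \<phi>: "\<phi> \<in> borel_measurable lebesgue"
    and lim: "AE \<xi> in lebesgue. (\<lambda>k. \<psi> k \<lfloor>\<xi> / \<epsilon> k\<rfloor>) \<longlonglongrightarrow> \<phi> \<xi>"
  shows "(\<lambda>k. character_series (\<lambda>n. of_real (\<epsilon> k) * (\<psi> k n * F (\<epsilon> k * of_int n))) (\<epsilon> k * y))
    \<longlonglongrightarrow> fourier_integral (\<lambda>\<xi>. \<phi> \<xi> * F \<xi>) (- y)"
proof -
  let ?I = "\<lambda>k \<xi>. \<psi> k \<lfloor>\<xi> / \<epsilon> k\<rfloor> * F (\<epsilon> k * \<lfloor>\<xi> / \<epsilon> k\<rfloor>) * cis (2 * pi * (\<epsilon> k * \<lfloor>\<xi> / \<epsilon> k\<rfloor>) * y)"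
  have eq: "character_series (\<lambda>n. of_real (\<epsilon> k) * (\<psi> k n * F (\<epsilon> k * of_int n))) (\<epsilon> k * y)
      = (LINT \<xi>|lebesgue. ?I k \<xi>)" for k
    unfolding character_series_def
    by (subst integral_floor[OF \<epsilon>(1), where a="\<lambda>n. \<psi> k n * F (\<epsilon> k * n) * cis (2 * pi * (\<epsilon> k * n) * y)"])
      (simp add: mult.assoc mult.left_commute)
  have Fm: "F \<in> borel_measurable lebesgue"
    using F by (intro measurable_completion) (simp add: borel_measurable_continuous_onI)
  have "(\<lambda>k. LINT \<xi>|lebesgue. ?I k \<xi>)
     \<longlonglongrightarrow> (LINT \<xi>|lebesgue. \<phi> \<xi> * F \<xi> * cis (- (2 * pi * (- y) * \<xi>)))"
  proof (rule integral_dominated_convergence[where w="\<lambda>\<xi>. (B * (3 * C)) / (1 + \<xi>\<^sup>2)"])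
    have "(\<lambda>\<xi>. cis (- (2 * pi * (- y) * \<xi>))) \<in> borel_measurable lebesgue"
      by (intro measurable_completion) (simp, intro borel_measurable_continuous_onI continuous_intros)
    then show "(\<lambda>\<xi>. \<phi> \<xi> * F \<xi> * cis (- (2 * pi * (- y) * \<xi>))) \<in> borel_measurable lebesgue"
      using \<phi> Fm by (intro borel_measurable_times)
    show "(\<lambda>\<xi>. ?I k \<xi>)
        \<in> borel_measurable lebesgue" for k
      by (rule measurable_compose[OF floor_div_measurable]) simp
    show "AE \<xi> in lebesgue. (\<lambda>k. ?I k \<xi>)
        \<longlonglongrightarrow> \<phi> \<xi> * F \<xi> * cis (- (2 * pi * (- y) * \<xi>))"
      using lim
    proof eventually_elim
      case (elim \<xi>)
      have s: "(\<lambda>k. \<epsilon> k * \<lfloor>\<xi> / \<epsilon> k\<rfloor>) \<longlonglongrightarrow> \<xi>"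
      proof (rule tendsto_sandwich)
        show "eventually (\<lambda>k. \<xi> - \<epsilon> k \<le> \<epsilon> k * \<lfloor>\<xi> / \<epsilon> k\<rfloor>) sequentially"
          using sample_point_close(2)[OF \<epsilon>(1), where \<xi>=\<xi>] by (intro always_eventually allI) (simp add: less_imp_le algebra_simps)
        show "eventually (\<lambda>k. \<epsilon> k * \<lfloor>\<xi> / \<epsilon> k\<rfloor> \<le> \<xi>) sequentially"
          using sample_point_close(1)[OF \<epsilon>(1), where \<xi>=\<xi>] by (intro always_eventually allI) auto
        show "(\<lambda>k. \<xi> - \<epsilon> k) \<longlonglongrightarrow> \<xi>" using tendsto_diff[OF tendsto_const \<epsilon>(3), of \<xi>] by simp
      qed auto
      have "isCont F \<xi>" using F by (simp add: continuous_on_eq_continuous_at)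
      then have "(\<lambda>k. F (\<epsilon> k * \<lfloor>\<xi> / \<epsilon> k\<rfloor>)) \<longlonglongrightarrow> F \<xi>"
        using s by (rule isCont_tendsto_compose)
      moreover have "(\<lambda>k. cis (2 * pi * (\<epsilon> k * \<lfloor>\<xi> / \<epsilon> k\<rfloor>) * y)) \<longlonglongrightarrow> cis (2 * pi * \<xi> * y)"
        using s by (intro tendsto_intros)
      ultimately have "(\<lambda>k. ?I k \<xi>)
        \<longlonglongrightarrow> \<phi> \<xi> * F \<xi> * cis (2 * pi * \<xi> * y)"
        using elim by (intro tendsto_mult)
      moreover have "cis (2 * pi * \<xi> * y) = cis (- (2 * pi * (- y) * \<xi>))" by (simp add: algebra_simps)
      ultimately show ?case by simp
    qed
    show "AE \<xi> in lebesgue. norm (?I k \<xi>)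
        \<le> (B * (3 * C)) / (1 + \<xi>\<^sup>2)" for k
      using sampled_product_bound[where \<epsilon>="\<epsilon> k" and \<psi>="\<psi> k", OF \<epsilon>(1,2) \<psi>]
      by (intro AE_I2) (simp only: norm_mult norm_cis mult_1_right)
  qed (rule integrable_inverse_quadratic)
  then show ?thesis unfolding eq fourier_integral_def .
qed

end

lemma circle_integral_eq_lborel:
  fixes g :: "real \<Rightarrow> complex"
  assumes "g \<in> borel_measurable borel" "\<And>x. x \<notin> {0..<1} \<Longrightarrow> g x = 0"
  shows "(LINT x|circle. g x) = (LINT x|lborel. g x)"
proof -
  have "(LINT x|circle. g x) = (LINT x|lebesgue. indicator {0..<1} x *\<^sub>R g x)"
    by (rule integral_restrict_space) simp
  also have "\<dots> = (LINT x|lebesgue. g x)"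
    using assms(2) by (intro Bochner_Integration.integral_cong refl) (auto simp: indicator_def)
  also have "\<dots> = (LINT x|lborel. g x)" using assms(1) by (intro integral_completion) simp
  finally show ?thesis .
qed

text \<open>Since \<open>\<epsilon> S < 1\<close>, the dilated function is supported within one period, so the integral over
  the circle is an integral over the line, where the dilation can be undone.\<close>
lemma rescaled_coefficient:
  assumes f: "test_function f" and supp: "\<And>x. x \<notin> {0..S} \<Longrightarrow> f x = 0"
    and \<epsilon>: "\<epsilon> > 0" "\<epsilon> * S < 1"
  shows "(LINT x|circle. f (x / \<epsilon>) * cis (- (2 * pi * of_int n * x))) = of_real \<epsilon> * fourier_integral f (\<epsilon> * of_int n)"
proof -
  have [measurable]: "f \<in> borel_measurable borel" by (rule test_function_measurable_borel[OF f])
  have [measurable]: "(\<lambda>x. cis (k * x)) \<in> borel_measurable borel" for k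
    by (intro borel_measurable_continuous_onI continuous_intros)
  have c: "(\<lambda>x. cis (- (2 * pi * k * x))) \<in> borel_measurable borel" for k
    by (intro borel_measurable_continuous_onI continuous_intros)
  note [measurable] = c
  have "(LINT x|circle. f (x / \<epsilon>) * cis (- (2 * pi * of_int n * x)))
      = (LINT x|lborel. f (x / \<epsilon>) * cis (- (2 * pi * of_int n * x)))"
  proof (rule circle_integral_eq_lborel)
    fix x :: real assume x: "x \<notin> {0..<1}"
    have "x / \<epsilon> \<notin> {0..S}"
      using x \<epsilon> by (auto simp: divide_le_eq zero_le_divide_iff mult.commute)
    then show "f (x / \<epsilon>) * cis (- (2 * pi * of_int n * x)) = 0" using supp by simp
  qed measurable
  also have "\<dots> = \<bar>\<epsilon>\<bar> *\<^sub>R (LINT x|lborel. f ((0 + \<epsilon> * x) / \<epsilon>) * cis (- (2 * pi * of_int n * (0 + \<epsilon> * x))))"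
    using \<epsilon> by (intro lborel_integral_real_affine) simp
  also have "\<dots> = of_real \<epsilon> * (LINT x|lborel. f x * cis (- (2 * pi * (\<epsilon> * of_int n) * x)))"
    using \<epsilon> by (simp add: scaleR_conv_of_real mult_ac)
  also have "(LINT x|lborel. f x * cis (- (2 * pi * (\<epsilon> * of_int n) * x))) = fourier_integral f (\<epsilon> * of_int n)"
    unfolding fourier_integral_def by (rule integral_completion[symmetric]) measurable
  finally show ?thesis .
qed

lemma rescaled_integrable_circle:
  assumes f: "test_function f"
  shows "integrable circle (\<lambda>x. f (x / \<epsilon>))"
proof -
  interpret F: finite_measure circle by (rule circle_finite)
  obtain R B where "\<And>x. norm (f x) \<le> B" using test_function_bounded_support[OF f] by metis
  moreover note test_function_measurable_borel[OF f, measurable]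
  have "(\<lambda>x. f (x / \<epsilon>)) \<in> borel_measurable circle"
    by (intro circle_measurable_borel) measurable
  with calculation show ?thesis by (intro F.integrable_const_bound[where B=B]) auto
qed

lemma AE_circle_rescale:
  assumes "AE x in circle. P x" and \<epsilon>: "\<epsilon> > 0"
  shows "AE y in lebesgue. y \<in> {0..<1 / \<epsilon>} \<longrightarrow> P (\<epsilon> * y)"
proof -
  have "AE x in lebesgue. x \<in> {0..<1} \<longrightarrow> P x"
    using assms(1) by (subst (asm) AE_restrict_space_iff) auto
  from AE_lebesgue_affine[OF this, of \<epsilon> 0] \<epsilon>
  have "AE y in lebesgue. \<epsilon> * y \<in> {0..<1} \<longrightarrow> P (\<epsilon> * y)" by simp
  then show ?thesis by eventually_elim (use \<epsilon> in \<open>auto simp: less_divide_eq mult.commute\<close>)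
qed

section \<open>Inversion and the Plancherel identity for test functions\<close>

text \<open>A sequence of mesh sizes that tends to 0 and keeps \<open>[0, S]\<close> dilated by the mesh inside one
  period.\<close>
definition sampling_step :: "real \<Rightarrow> nat \<Rightarrow> real" where
  "sampling_step S k = 1 / (real k + S + 1)"

lemma sampling_step:
  assumes "S \<ge> 0"
  shows "sampling_step S k > 0" "sampling_step S k \<le> 1" "sampling_step S k * S < 1"
    "1 / sampling_step S k = real k + S + 1"
  using assms by (auto simp: sampling_step_def field_simps)

lemma sampling_step_tendsto: 
  assumes "S \<ge> 0" shows "sampling_step S \<longlonglongrightarrow> 0"
proof (rule tendsto_sandwich)
  show "eventually (\<lambda>k. sampling_step S k \<le> inverse (real (Suc k))) sequentially"
    using assms by (intro always_eventually allI) (simp add: sampling_step_def field_simps)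
  show "eventually (\<lambda>k. 0 \<le> sampling_step S k) sequentially"
    using sampling_step(1)[OF assms] by (intro always_eventually allI less_imp_le)
qed (use LIMSEQ_inverse_real_of_nat in auto)

lemma sampling_step_eventually:
  assumes "S \<ge> 0" shows "eventually (\<lambda>k. y < 1 / sampling_step S k) sequentially"
proof -
  obtain K where "y < real K" using reals_Archimedean2 by blast
  then show ?thesis using assms
    by (intro eventually_sequentiallyI[of K]) (simp add: sampling_step(4))
qed

text \<open>For each mesh size, \<open>f\<close> dilated to the circle equals its Fourier series almost everywhere.
  Rescaled to the line this reads: \<open>f\<close> is a Riemann sum for the inversion integral, and the
  Riemann sums converge. Only countably many mesh sizes are used, so the exceptional null sets can
  be collected.\<close>
lemma fourier_inversion_one_sided:
  assumes f: "test_function f" and supp: "\<And>x. x \<notin> {0..S} \<Longrightarrow> f x = 0" and S: "S \<ge> 0"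
  shows "AE y in lebesgue. y \<ge> 0 \<longrightarrow> f y = fourier_integral (fourier_integral f) (- y)"
proof -
  let ?F = "fourier_integral f" and ?e = "sampling_step S"
  obtain C where C: "C \<ge> 0" "\<And>\<xi>. norm (?F \<xi>) \<le> C / (1 + \<xi>\<^sup>2)"
    using test_function_fourier_decay[OF f] by blast
  have cF: "continuous_on UNIV ?F" by (rule fourier_integral_continuous[OF test_function_integrable[OF f]])
  define b where "b k n = of_real (?e k) * (1 * ?F (?e k * of_int n))" for k and n :: int
  have "AE x in circle. f (x / ?e k) = character_series (b k) x" for k
  proof (rule AE_eq_character_series)
    show "integrable (count_space UNIV) (b k)"
      unfolding b_def
      using integrable_sampled_coefficients[OF cF C sampling_step(1,2)[OF S], of "\<lambda>_. 1" 1] by simp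
    show "integrable circle (\<lambda>x. f (x / ?e k))" by (rule rescaled_integrable_circle[OF f])
    show "(LINT x|circle. f (x / ?e k) * cis (- (2 * pi * of_int n * x))) = b k n" for n
      unfolding b_def mult_1 by (rule rescaled_coefficient[OF f supp sampling_step(1,3)[OF S]])
  qed
  then have "AE y in lebesgue. y \<in> {0..<1 / ?e k} \<longrightarrow> f (?e k * y / ?e k) = character_series (b k) (?e k * y)" for k
    by (rule AE_circle_rescale[OF _ sampling_step(1)[OF S]])
  then have "AE y in lebesgue. \<forall>k. y \<in> {0..<1 / ?e k} \<longrightarrow> f (?e k * y / ?e k) = character_series (b k) (?e k * y)"
    unfolding AE_all_countable by blast
  then show ?thesis
  proof eventually_elim
    case (elim y)
    show ?case
    proof
      assume y: "y \<ge> 0"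
      have "eventually (\<lambda>k. character_series (b k) (?e k * y) = f y) sequentially"
        using sampling_step_eventually[OF S, of y]
      proof eventually_elim
        case (elim k)
        have "?e k * y / ?e k = y" using sampling_step(1)[OF S, of k] by simp
        then show ?case using \<open>\<forall>k. _\<close> elim y by (metis atLeastLessThan_iff)
      qed
      then have "(\<lambda>k. character_series (b k) (?e k * y)) \<longlonglongrightarrow> f y"
        by (rule tendsto_eventually)
      moreover have "(\<lambda>k. character_series (b k) (?e k * y)) \<longlonglongrightarrow> fourier_integral (\<lambda>\<xi>. 1 * ?F \<xi>) (- y)"
        unfolding b_def
        by (rule sampled_series_tendsto[OF cF C sampling_step(1,2)[OF S] sampling_step_tendsto[OF S], where B=1]) auto
      ultimately show "f y = fourier_integral ?F (- y)"
        by (simp add: LIMSEQ_unique)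
    qed
  qed
qed

lemma fourier_integral_modulate:
  "fourier_integral (\<lambda>\<xi>. cis (- (2 * pi * \<xi> * A)) * G \<xi>) (- y) = fourier_integral G (- (y - A))"
  unfolding fourier_integral_def
proof (intro Bochner_Integration.integral_cong refl)
  fix \<xi> :: real
  have "cis (- (2 * pi * \<xi> * A)) * cis (- (2 * pi * (- y) * \<xi>)) = cis (- (2 * pi * (- (y - A)) * \<xi>))"
    by (simp add: cis_mult algebra_simps)
  then show "cis (- (2 * pi * \<xi> * A)) * G \<xi> * cis (- (2 * pi * (- y) * \<xi>)) = G \<xi> * cis (- (2 * pi * (- (y - A)) * \<xi>))"
    by (metis mult.assoc mult.commute)
qed

text \<open>Translate the support into the nonnegative half-line. The one-sided statement then covers
  the points right of \<open>- m\<close>, and \<open>m\<close> is arbitrarily large.\<close>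
theorem fourier_inversion_test_function:
  assumes f: "test_function f"
  shows "AE y in lebesgue. f y = fourier_integral (fourier_integral f) (- y)"
proof -
  obtain R where R: "R > 0" "\<And>x. \<bar>x\<bar> > R \<Longrightarrow> f x = 0"
    using test_function_bounded_support[OF f] by metis
  have "AE z in lebesgue. R \<le> real m \<longrightarrow> - real m \<le> z \<longrightarrow> f z = fourier_integral (fourier_integral f) (- z)" for m
  proof (cases "R \<le> real m")
    case True
    \<comment> \<open>With \<open>m \<ge> R\<close> the support of the translate lies in \<open>[0, 2 m]\<close>.\<close>
    define g where "g x = f (x - real m)" for x
    have g: "test_function g" unfolding g_def by (rule test_function_translate[OF f])
    have F: "fourier_integral g = (\<lambda>\<xi>. cis (- (2 * pi * \<xi> * real m)) * fourier_integral f \<xi>)"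
      unfolding g_def by (intro ext fourier_integral_translate[OF f])
    have "AE y in lebesgue. y \<ge> 0 \<longrightarrow> g y = fourier_integral (fourier_integral g) (- y)"
      using R True by (intro fourier_inversion_one_sided[OF g, of "2 * real m"]) (auto simp: g_def)
    from AE_lebesgue_affine[OF this, of 1 "real m"]
    have "AE z in lebesgue. real m + 1 * z \<ge> 0 \<longrightarrow> g (real m + 1 * z) = fourier_integral (fourier_integral g) (- (real m + 1 * z))"
      by simp
    then show ?thesis
      unfolding F fourier_integral_modulate by eventually_elim (auto simp: g_def)
  qed simp
  then have "AE z in lebesgue. \<forall>m. R \<le> real m \<longrightarrow> - real m \<le> z \<longrightarrow> f z = fourier_integral (fourier_integral f) (- z)"
    unfolding AE_all_countable by blast
  then show ?thesis
  proof eventually_elim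
    case (elim z)
    obtain m where "max R (- z) \<le> real m" using real_arch_simple by blast
    then show ?case using elim by auto
  qed
qed

lemma fourier_integral_lborel:
  "f \<in> borel_measurable borel \<Longrightarrow> fourier_integral f \<xi> = (LINT x|lborel. f x * cis (- (2 * pi * \<xi> * x)))"
  unfolding fourier_integral_def
proof (rule integral_completion)
  assume [measurable]: "f \<in> borel_measurable borel"
  have [measurable]: "(\<lambda>x. cis (- (2 * pi * \<xi> * x))) \<in> borel_measurable borel"
    by (intro borel_measurable_continuous_onI continuous_intros)
  show "(\<lambda>x. f x * cis (- (2 * pi * \<xi> * x))) \<in> borel_measurable lborel" by measurable
qed

lemma fourier_integral_reflect:
  assumes "F \<in> borel_measurable borel"
  shows "fourier_integral (\<lambda>x. F (- x)) \<xi> = fourier_integral F (- \<xi>)"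
proof -
  have m: "(\<lambda>x. F (- x)) \<in> borel_measurable borel" using assms by measurable
  have "fourier_integral (\<lambda>x. F (- x)) \<xi> = (LINT x|lborel. F (- x) * cis (- (2 * pi * \<xi> * x)))"
    by (rule fourier_integral_lborel[OF m])
  also have "\<dots> = (LINT x|lborel. F x * cis (- (2 * pi * (- \<xi>) * x)))"
    by (subst lborel_integral_real_affine[of "-1" _ 0]) auto
  also have "\<dots> = fourier_integral F (- \<xi>)" by (rule fourier_integral_lborel[OF assms, symmetric])
  finally show ?thesis .
qed

lemma power_mass_reflect:
  fixes f :: "real \<Rightarrow> complex"
  assumes [measurable]: "f \<in> borel_measurable lebesgue"
  shows "power_mass q lebesgue (\<lambda>x. f (- x)) = power_mass q lebesgue f"
  unfolding power_mass_def
  using nn_integral_real_affine_lebesgue[of "\<lambda>x. ennreal (norm (f x) powr q)" "-1" 0] by simp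

lemma Lp_two_of_quadratic_decay:
  fixes F :: "real \<Rightarrow> complex"
  assumes F: "F \<in> borel_measurable lebesgue" and decay: "\<And>\<xi>. norm (F \<xi>) \<le> C / (1 + \<xi>\<^sup>2)"
  shows "F \<in> Lp 2 lebesgue"
proof -
  have b: "norm (F \<xi>) powr 2 \<le> C\<^sup>2 / (1 + \<xi>\<^sup>2)" for \<xi>
  proof -
    have p: "1 + \<xi>\<^sup>2 \<ge> 1" by simp
    have "norm (F \<xi>) powr 2 = (norm (F \<xi>))\<^sup>2" by (simp add: powr_numeral)
    also have "\<dots> \<le> (C / (1 + \<xi>\<^sup>2))\<^sup>2" by (intro power_mono decay) auto
    also have "\<dots> = C\<^sup>2 / (1 + \<xi>\<^sup>2)\<^sup>2" by (simp add: power_divide)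
    also have "\<dots> \<le> C\<^sup>2 / (1 + \<xi>\<^sup>2)"
      using p by (intro divide_left_mono self_le_power mult_pos_pos zero_less_power) (auto intro: add_pos_nonneg)
    finally show ?thesis .
  qed
  have "integrable lebesgue (\<lambda>\<xi>. norm (F \<xi>) powr 2)"
    by (rule Bochner_Integration.integrable_bound[OF integrable_inverse_quadratic[of "C\<^sup>2"]])
      (use F b in \<open>auto\<close>)
  then show ?thesis using F by (simp add: Lp_def)
qed

lemma test_function_fourier_Lp_two: "test_function f \<Longrightarrow> fourier_integral f \<in> Lp 2 lebesgue"
  using test_function_fourier_decay Lp_two_of_quadratic_decay test_function_fourier_measurable by metis

lemma power_mass_two_eq_integral:
  assumes "f \<in> Lp 2 lebesgue" "f \<in> borel_measurable borel"
  shows "power_mass 2 lebesgue f = ennreal (Re (LINT x|lborel. f x * cnj (f x)))"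
proof -
  have e: "f x * cnj (f x) = of_real (norm (f x) powr 2)" for x
    by (simp add: powr_numeral flip: complex_norm_square)
  have "power_mass 2 lebesgue f = ennreal (LINT x|lebesgue. norm (f x) powr 2)"
    by (rule power_mass_eq_integral[OF assms(1)])
  also have "(LINT x|lebesgue. norm (f x) powr 2) = (LINT x|lborel. norm (f x) powr 2)"
    using assms(2) by (intro integral_completion) measurable
  also have "\<dots> = Re (LINT x|lborel. f x * cnj (f x))"
    by (simp only: e integral_complex_of_real Re_complex_of_real)
  finally show ?thesis .
qed

text \<open>Insert the inversion formula for one factor of \<open>f\<close> times its conjugate and exchange the
  order of integration; both \<open>f\<close> and its transform are integrable.\<close>
theorem plancherel_test_function:
  assumes f: "test_function f"
  shows "power_mass 2 lebesgue (fourier_integral f) = power_mass 2 lebesgue f"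
proof -
  let ?F = "fourier_integral f"
  have fm[measurable]: "f \<in> borel_measurable borel" by (rule test_function_measurable_borel[OF f])
  have Fm[measurable]: "?F \<in> borel_measurable borel"
    by (rule fourier_integral_measurable[OF test_function_integrable[OF f]])
  have fi: "integrable lborel f"
    using test_function_integrable[OF f] by (subst (asm) integrable_completion) auto
  have Fi: "integrable lborel ?F"
    using test_function_fourier_integrable[OF f] by (subst (asm) integrable_completion) auto
  define k where "k x \<xi> = cnj (f x) * ?F \<xi> * cis (2 * pi * \<xi> * x)" for x \<xi>
  have km: "case_prod k \<in> borel_measurable (lborel \<Otimes>\<^sub>M lborel)"
  proof -
    have "(\<lambda>p. cis (2 * pi * snd p * fst p)) \<in> borel_measurable (borel :: (real \<times> real) measure)"
      by (intro borel_measurable_continuous_onI continuous_intros)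
    then have [measurable]: "(\<lambda>p. cis (2 * pi * snd p * fst p)) \<in> borel_measurable (lborel \<Otimes>\<^sub>M lborel :: (real \<times> real) measure)"
      by (simp add: borel_prod[symmetric] cong: measurable_cong_sets)
    have [measurable]: "(\<lambda>x. cnj (f x)) \<in> borel_measurable borel"
      by (intro borel_measurable_continuous_onI continuous_intros test_function_continuous[OF f])
    show ?thesis unfolding k_def case_prod_beta' by measurable
  qed
  have ki: "integrable (lborel \<Otimes>\<^sub>M lborel) (case_prod k)"
  proof (rule lborel_pair.Fubini_integrable[OF km])
    have "integrable lborel (\<lambda>x. norm (f x) * (LINT \<xi>|lborel. norm (?F \<xi>)))"
      using fi by simp
    then show "integrable lborel (\<lambda>x. LINT \<xi>|lborel. norm (case_prod k (x, \<xi>)))"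
      by (simp add: k_def norm_mult)
    have "integrable lborel (\<lambda>\<xi>. ?F \<xi> * cis (2 * pi * x * \<xi>))" for x
      by (rule integrable_mult_bounded[OF Fi, where B=1])
        (simp, intro borel_measurable_continuous_onI continuous_intros, simp)
    then have "integrable lborel (\<lambda>\<xi>. cnj (f x) * (?F \<xi> * cis (2 * pi * x * \<xi>)))" for x
      by (rule integrable_mult_right)
    then show "AE x in lborel. integrable lborel (\<lambda>\<xi>. case_prod k (x, \<xi>))"
      by (simp add: k_def mult_ac)
  qed
  have inv: "AE x in lborel. f x = fourier_integral ?F (- x)"
  proof -
    have "fourier_integral ?F \<in> borel_measurable borel"
      by (rule fourier_integral_measurable[OF test_function_fourier_integrable[OF f]])
    then have [measurable]: "(\<lambda>x. fourier_integral ?F (- x)) \<in> borel_measurable borel" by measurable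
    have "{x \<in> space lborel. f x = fourier_integral ?F (- x)} \<in> sets lborel" by measurable
    then show ?thesis
      using fourier_inversion_test_function[OF f] by (simp add: AE_completion_iff)
  qed
  have "(LINT x|lborel. f x * cnj (f x)) = (LINT x|lborel. LINT \<xi>|lborel. k x \<xi>)"
  proof (rule integral_cong_AE)
    show "AE x in lborel. f x * cnj (f x) = (LINT \<xi>|lborel. k x \<xi>)"
      using inv
    proof eventually_elim
      case (elim x)
      have "(LINT \<xi>|lborel. k x \<xi>) = (LINT \<xi>|lborel. cnj (f x) * (?F \<xi> * cis (- (2 * pi * (- x) * \<xi>))))"
        by (simp add: k_def mult_ac)
      also have "\<dots> = cnj (f x) * fourier_integral ?F (- x)"
        by (simp only: integral_mult_right_zero fourier_integral_lborel[OF Fm])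
      finally show ?case using elim by simp
    qed
    show "(\<lambda>x. f x * cnj (f x)) \<in> borel_measurable lborel"
      by (simp, intro borel_measurable_continuous_onI continuous_intros test_function_continuous[OF f])
    show "(\<lambda>x. LINT \<xi>|lborel. k x \<xi>) \<in> borel_measurable lborel"
      using km by (intro lborel.borel_measurable_lebesgue_integral) simp
  qed
  also have "\<dots> = (LINT \<xi>|lborel. LINT x|lborel. k x \<xi>)"
    by (rule lborel_pair.Fubini_integral[OF ki, symmetric])
  also have "\<dots> = (LINT \<xi>|lborel. ?F \<xi> * cnj (?F \<xi>))"
  proof (intro Bochner_Integration.integral_cong refl)
    fix \<xi>
    have "(LINT x|lborel. k x \<xi>) = (LINT x|lborel. ?F \<xi> * cnj (f x * cis (- (2 * pi * \<xi> * x))))"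
      by (simp add: k_def mult_ac cis_cnj)
    also have "\<dots> = ?F \<xi> * cnj (LINT x|lborel. f x * cis (- (2 * pi * \<xi> * x)))"
      by (simp only: integral_mult_right_zero Bochner_Integration.integral_cnj)
    also have "\<dots> = ?F \<xi> * cnj (?F \<xi>)" by (simp only: fourier_integral_lborel[OF fm])
    finally show "(LINT x|lborel. k x \<xi>) = ?F \<xi> * cnj (?F \<xi>)" .
  qed
  finally show ?thesis
    using power_mass_two_eq_integral[OF test_function_Lp[OF f] fm]
      power_mass_two_eq_integral[OF test_function_fourier_Lp_two[OF f] Fm] by simp
qed

section \<open>The Fourier transform on square-integrable functions\<close>

lemma tendsto_0_of_le_sum_ennreal:
  fixes a b u :: "nat \<Rightarrow> ennreal"
  assumes a: "a \<longlonglongrightarrow> 0" and b: "b \<longlonglongrightarrow> 0" and le: "\<And>n. u n \<le> ennreal c * (a n + b n)"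
  shows "u \<longlonglongrightarrow> 0"
proof -
  have "(\<lambda>n. ennreal c * (a n + b n)) \<longlonglongrightarrow> ennreal c * (0 + 0)"
    using a b by (intro ennreal_tendsto_cmult tendsto_add) auto
  then have lim: "(\<lambda>n. ennreal c * (a n + b n)) \<longlonglongrightarrow> 0" by simp
  show ?thesis
    by (rule tendsto_sandwich[OF _ _ tendsto_const lim]) (auto intro!: always_eventually le)
qed

lemma ennreal_inverse_Suc_tendsto: "(\<lambda>n. ennreal (1 / real (Suc n))) \<longlonglongrightarrow> 0"
  using tendsto_ennrealI[OF LIMSEQ_inverse_real_of_nat] by (simp only: ennreal_0 inverse_eq_divide)

lemma tendsto_0_of_less_inverse_Suc:
  fixes u :: "nat \<Rightarrow> ennreal"
  assumes "\<And>n. u n < ennreal (1 / real (Suc n))" shows "u \<longlonglongrightarrow> 0"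
  by (rule tendsto_sandwich[OF _ _ tendsto_const ennreal_inverse_Suc_tendsto])
    (auto intro!: always_eventually less_imp_le assms simp del: of_nat_Suc)

text \<open>The density theorem as a sequence, one for all exponents in \<open>Q\<close>.\<close>
lemma test_function_sequence:
  fixes u :: "real \<Rightarrow> complex"
  assumes Q: "finite Q" "Q \<noteq> {}" "\<And>q. q \<in> Q \<Longrightarrow> q > 0"
    and u: "\<And>q. q \<in> Q \<Longrightarrow> u \<in> Lp q lebesgue"
  obtains d where "\<And>n. test_function (d n)"
    "\<And>q. q \<in> Q \<Longrightarrow> converges_Lp q d u"
proof -
  have "\<exists>d. test_function d \<and> (\<forall>q\<in>Q. diff_mass q d u < ennreal (1 / real (Suc n)))" for n
  proof -
    have "0 < 1 / real (Suc n)" by simp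
    from test_functions_dense[OF Q u this] show ?thesis by metis
  qed
  from choice[OF allI[OF this]] obtain d where "\<forall>n. test_function (d n) \<and>
    (\<forall>q\<in>Q. diff_mass q (d n) u < ennreal (1 / real (Suc n)))" ..
  then have d: "\<And>n. test_function (d n)"
    "\<And>n q. q \<in> Q \<Longrightarrow> diff_mass q (d n) u < ennreal (1 / real (Suc n))" by blast+
  show thesis by (rule that[OF d(1)]) (rule tendsto_0_of_less_inverse_Suc, rule d(2))
qed

lemma has_fourier_real_iff:
  "has_fourier_real f F \<longleftrightarrow> f \<in> Lp 2 lebesgue \<and> F \<in> Lp 2 lebesgue \<and>
    (\<exists>g. (\<forall>n. g n \<in> Lp 1 lebesgue \<inter> Lp 2 lebesgue) \<and>
      converges_Lp 2 g f \<and>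
      (\<lambda>n. diff_mass 2 (fourier_integral (g n)) F) \<longlonglongrightarrow> 0)"
  unfolding has_fourier_real_def power_mass_two ..

lemma has_fourier_real_cong_AE:
  assumes H: "has_fourier_real f F" and eq: "AE x in lebesgue. f x = f' x" and m: "f' \<in> borel_measurable lebesgue"
  shows "has_fourier_real f' F"
proof -
  obtain g where g: "\<And>n. g n \<in> Lp 1 lebesgue \<inter> Lp 2 lebesgue"
      "converges_Lp 2 g f"
      "(\<lambda>n. diff_mass 2 (fourier_integral (g n)) F) \<longlonglongrightarrow> 0"
    using H unfolding has_fourier_real_iff by blast
  have "diff_mass 2 (g n) f = diff_mass 2 (g n) f'" for n
    using eq by (intro power_mass_cong_AE) (auto elim: eventually_mono)
  moreover have "f' \<in> Lp 2 lebesgue"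
    using H m power_mass_cong_AE[OF eq, of 2] by (simp add: has_fourier_real_iff Lp_iff)
  ultimately show ?thesis using H g unfolding has_fourier_real_iff by auto
qed

lemma has_fourier_real_test_function:
  "test_function f \<Longrightarrow> has_fourier_real f (fourier_integral f)"
  unfolding has_fourier_real_iff
  by (auto simp: test_function_Lp test_function_fourier_Lp_two power_mass_def intro!: exI[of _ "\<lambda>_. f"])

text \<open>The transform on \<open>L\<^sup>2\<close> is a closed relation: approximate each \<open>f\<^sub>n\<close> together with its
  transform up to \<open>1 / (n + 1)\<close> by an integrable function and take the diagonal sequence.\<close>
lemma has_fourier_real_closed:
  assumes H: "\<And>n. has_fourier_real (f n) (F n)"
    and f: "f0 \<in> Lp 2 lebesgue" "converges_Lp 2 f f0"
    and F: "F0 \<in> Lp 2 lebesgue" "converges_Lp 2 F F0"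
  shows "has_fourier_real f0 F0"
proof -
  define near where "near n g \<longleftrightarrow> g \<in> Lp 1 lebesgue \<inter> Lp 2 lebesgue \<and>
      diff_mass 2 g (f n) < ennreal (1 / real (Suc n)) \<and>
      diff_mass 2 (fourier_integral g) (F n) < ennreal (1 / real (Suc n))" for n g
  have "\<exists>g. near n g" for n
  proof -
    obtain g where g: "\<And>n. g n \<in> Lp 1 lebesgue \<inter> Lp 2 lebesgue" "converges_Lp 2 g (f n)"
        "converges_Lp 2 (\<lambda>k. fourier_integral (g k)) (F n)"
      using H[of n] unfolding has_fourier_real_iff by blast
    have p: "0 < ennreal (1 / real (Suc n))" by simp
    from eventually_happens[OF eventually_conj[OF order_tendstoD(2)[OF g(2) p] order_tendstoD(2)[OF g(3) p]]]
    obtain k where "diff_mass 2 (g k) (f n) < ennreal (1 / real (Suc n)) \<and>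
        diff_mass 2 (fourier_integral (g k)) (F n) < ennreal (1 / real (Suc n))" by auto
    then show ?thesis using g(1) unfolding near_def by blast
  qed
  from choice[OF allI[OF this]] obtain g where "\<forall>n. near n (g n)" ..
  then have g: "\<And>n. g n \<in> Lp 1 lebesgue \<inter> Lp 2 lebesgue"
    "\<And>n. diff_mass 2 (g n) (f n) < ennreal (1 / real (Suc n))"
    "\<And>n. diff_mass 2 (fourier_integral (g n)) (F n) < ennreal (1 / real (Suc n))"
    unfolding near_def by blast+
  have m: "f n \<in> borel_measurable lebesgue" "F n \<in> borel_measurable lebesgue" for n
    using H[of n] by (auto simp: has_fourier_real_iff Lp_measurable)
  have Fg: "fourier_integral (g n) \<in> borel_measurable lebesgue" for n
    using g(1)[of n] by (intro measurable_completion) (simp add: fourier_integral_measurable Lp_one_iff_integrable)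
  have gm: "g n \<in> borel_measurable lebesgue" for n using g(1)[of n] by (auto simp: Lp_measurable)
  have "converges_Lp 2 g f0"
    by (rule tendsto_0_of_le_sum_ennreal[where c="2 powr 2", OF tendsto_0_of_less_inverse_Suc[OF g(2)] f(2)])
      (rule power_mass_diff_triangle[OF gm m(1) Lp_measurable[OF f(1)]], simp)
  moreover have "(\<lambda>n. diff_mass 2 (fourier_integral (g n)) F0) \<longlonglongrightarrow> 0"
    by (rule tendsto_0_of_le_sum_ennreal[where c="2 powr 2", OF tendsto_0_of_less_inverse_Suc[OF g(3)] F(2)])
      (rule power_mass_diff_triangle[OF Fg m(2) Lp_measurable[OF F(1)]], simp)
  ultimately show ?thesis unfolding has_fourier_real_iff using g(1) f(1) F(1) by blast
qed

lemma liminf_cmult_add_le: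
  fixes a :: "nat \<Rightarrow> ennreal"
  assumes "a \<longlonglongrightarrow> 0"
  shows "liminf (\<lambda>n. ennreal c * (a n + b)) \<le> ennreal c * b"
proof -
  have "(\<lambda>n. ennreal c * (a n + b)) \<longlonglongrightarrow> ennreal c * (0 + b)"
    using assms by (intro ennreal_tendsto_cmult tendsto_add) auto
  from lim_imp_Liminf[OF _ this] show ?thesis by simp
qed

text \<open>Approximate \<open>G\<close> by test functions \<open>h\<^sub>n\<close> in \<open>L\<^sup>1\<close> and in \<open>L\<^sup>2\<close>, and let \<open>g\<^sub>n\<close> be their
  inverse transforms. These decay quadratically, and by inversion their transforms are the \<open>h\<^sub>n\<close>.
  Convergence in \<open>L\<^sup>1\<close> gives \<open>g\<^sub>n \<rightarrow> g\<close> pointwise, Plancherel's identity gives the \<open>L\<^sup>2\<close> Cauchy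
  property, and Fatou's lemma joins the two. The constant 4 is that of the crude triangle
  inequality for squares; any finite constant suffices later.\<close>
theorem inverse_fourier_transform:
  assumes G1: "G \<in> Lp 1 lebesgue" and G2: "G \<in> Lp 2 lebesgue"
  defines "g \<equiv> \<lambda>x. fourier_integral G (- x)"
  shows "has_fourier_real g G"
    and "power_mass 2 lebesgue g \<le> ennreal (2 powr 2) * power_mass 2 lebesgue G"
proof -
  have Gi: "integrable lebesgue G" using G1 by (simp add: Lp_one_iff_integrable)
  have [measurable]: "G \<in> borel_measurable lebesgue" using G1 by (rule Lp_measurable)
  obtain h where h: "\<And>n. test_function (h n)"
    and "\<And>q. q \<in> {1, 2} \<Longrightarrow> converges_Lp q h G"
    by (rule test_function_sequence[of "{1, 2}" G]) (use G1 G2 in auto)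
  then have h1: "converges_Lp 1 h G"
    and h2: "converges_Lp 2 h G" by auto
  note [measurable] = test_function_measurable[OF h]
  have reflm: "(\<lambda>x. fourier_integral k (- x)) \<in> borel_measurable borel" if "integrable lebesgue k" for k
    using fourier_integral_measurable[OF that] by measurable
  have gm[measurable]: "g \<in> borel_measurable lebesgue"
    unfolding g_def using reflm[OF Gi] by (intro measurable_completion) simp
  define gn where "gn n x = fourier_integral (h n) (- x)" for n x
  have gnm[measurable]: "gn n \<in> borel_measurable lebesgue" for n
    unfolding gn_def using reflm[OF test_function_integrable[OF h]] by (intro measurable_completion) simp
  have gn12: "gn n \<in> Lp 1 lebesgue \<inter> Lp 2 lebesgue" for n
  proof -
    obtain C where "\<And>\<xi>. norm (fourier_integral (h n) \<xi>) \<le> C / (1 + \<xi>\<^sup>2)"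
      using test_function_fourier_decay[OF h[of n]] by blast
    from this[of "- x" for x] have b: "norm (gn n x) \<le> C / (1 + x\<^sup>2)" for x by (simp add: gn_def)
    show ?thesis
      using integrable_of_quadratic_decay[OF gnm b] Lp_two_of_quadratic_decay[OF gnm b] by (simp add: Lp_one_iff_integrable)
  qed
  have Fgn: "AE \<xi> in lebesgue. fourier_integral (gn n) \<xi> = h n \<xi>" for n
  proof -
    have "fourier_integral (gn n) \<xi> = fourier_integral (fourier_integral (h n)) (- \<xi>)" for \<xi>
      unfolding gn_def
      by (rule fourier_integral_reflect[OF fourier_integral_measurable[OF test_function_integrable[OF h]]])
    then show ?thesis using fourier_inversion_test_function[OF h[of n]] by (simp add: eq_commute)
  qed
  have iso: "diff_mass 2 (gn n) (gn m) = diff_mass 2 (h n) (h m)" for n m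
  proof -
    have d: "test_function (\<lambda>x. h n x - h m x)" by (intro test_function_diff h)
    have "(\<lambda>x. gn n x - gn m x) = (\<lambda>x. fourier_integral (\<lambda>x. h n x - h m x) (- x))"
      unfolding gn_def by (simp add: fourier_integral_diff test_function_integrable h)
    then show ?thesis
      using power_mass_reflect[OF test_function_fourier_measurable[OF d]] plancherel_test_function[OF d] by simp
  qed
  have iso1: "power_mass 2 lebesgue (gn n) = power_mass 2 lebesgue (h n)" for n
    unfolding gn_def
    using power_mass_reflect[OF test_function_fourier_measurable[OF h]] plancherel_test_function[OF h] by simp
  have lim: "(\<lambda>n. gn n x) \<longlonglongrightarrow> g x" for x
  proof -
    have "ennreal (norm (gn n x - g x)) \<le> diff_mass 1 (h n) G" for n
    proof -
      have i: "integrable lebesgue (\<lambda>x. h n x - G x)" using Gi test_function_integrable[OF h[of n]] by auto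
      have "norm (gn n x - g x) = norm (fourier_integral (\<lambda>x. h n x - G x) (- x))"
        unfolding gn_def g_def by (simp add: fourier_integral_diff test_function_integrable h Gi)
      also have "\<dots> \<le> (LINT x|lebesgue. norm (h n x - G x))" by (rule norm_fourier_integral_le)
      finally have "ennreal (norm (gn n x - g x)) \<le> ennreal (LINT x|lebesgue. norm (h n x - G x))" by (rule ennreal_leI)
      also have "\<dots> = diff_mass 1 (h n) G"
        using i by (subst power_mass_eq_integral) (auto simp: Lp_one_iff_integrable)
      finally show ?thesis .
    qed
    then have "(\<lambda>n. ennreal (norm (gn n x - g x))) \<longlonglongrightarrow> 0"
      by (intro tendsto_sandwich[OF _ _ tendsto_const h1]) auto
    then have "(\<lambda>n. norm (gn n x - g x)) \<longlonglongrightarrow> 0"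
      by (simp flip: ennreal_0 add: tendsto_ennreal_iff)
    then show ?thesis by (simp add: tendsto_norm_zero_iff LIM_zero_iff)
  qed
  have diff: "diff_mass 2 (gn n) g \<le> ennreal (2 powr 2) * diff_mass 2 (h n) G" for n
  proof -
    have "diff_mass 2 (gn n) g \<le> liminf (\<lambda>m. diff_mass 2 (gn n) (gn m))"
      by (intro power_mass_Fatou AE_I2 tendsto_diff tendsto_const lim) auto
    also have "\<dots> \<le> liminf (\<lambda>m. ennreal (2 powr 2) * (diff_mass 2 (h m) G + diff_mass 2 (h n) G))"
    proof (intro Liminf_mono always_eventually allI)
      fix m
      have "diff_mass 2 (h n) (h m) \<le> ennreal (2 powr 2) *
          (diff_mass 2 (h n) G + diff_mass 2 G (h m))"
        by (intro power_mass_diff_triangle) auto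
      then show "diff_mass 2 (gn n) (gn m) \<le> ennreal (2 powr 2) *
          (diff_mass 2 (h m) G + diff_mass 2 (h n) G)"
        unfolding iso power_mass_minus_commute[of 2 lebesgue G] by (simp only: add.commute)
    qed
    also have "\<dots> \<le> ennreal (2 powr 2) * diff_mass 2 (h n) G"
      by (rule liminf_cmult_add_le[OF h2])
    finally show ?thesis .
  qed
  have conv: "converges_Lp 2 gn g"
    using diff by (intro tendsto_0_of_le_sum_ennreal[OF h2 tendsto_const, of _ "2 powr 2"]) simp
  have "eventually (\<lambda>n. diff_mass 2 (gn n) g < 1) sequentially"
    by (rule order_tendstoD(2)[OF conv]) simp
  from eventually_happens[OF this] obtain N where N: "diff_mass 2 (gn N) g < 1"
    by auto
  have "diff_mass 2 g (gn N) < \<infinity>"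
    unfolding power_mass_minus_commute[of 2 lebesgue g] by (rule less_trans[OF N]) simp
  note fin = this
  have "gn N \<in> Lp 2 lebesgue" using gn12[of N] by blast
  from Lp_if_close[OF this gm _ fin] have g2: "g \<in> Lp 2 lebesgue" by simp
  have "diff_mass 2 (fourier_integral (gn n)) G = diff_mass 2 (h n) G" for n
    by (rule power_mass_cong_AE, use Fgn[of n] in eventually_elim) simp
  then show "has_fourier_real g G"
    unfolding has_fourier_real_iff using g2 G2 gn12 conv h2 by (intro conjI exI[of _ gn] allI) simp_all
  have "power_mass 2 lebesgue g \<le> liminf (\<lambda>n. power_mass 2 lebesgue (gn n))"
    by (intro power_mass_Fatou AE_I2 lim) auto
  also have "\<dots> \<le> liminf (\<lambda>n. ennreal (2 powr 2) * (diff_mass 2 (h n) G + power_mass 2 lebesgue G))"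
  proof (intro Liminf_mono always_eventually allI)
    fix n
    show "power_mass 2 lebesgue (gn n) \<le> ennreal (2 powr 2) * (diff_mass 2 (h n) G + power_mass 2 lebesgue G)"
      unfolding iso1 using power_mass_diff_triangle[of "h n" lebesgue G "\<lambda>_. 0" 2] by simp
  qed
  also have "\<dots> \<le> ennreal (2 powr 2) * power_mass 2 lebesgue G"
    by (rule liminf_cmult_add_le[OF h2])
  finally show "power_mass 2 lebesgue g \<le> ennreal (2 powr 2) * power_mass 2 lebesgue G" .
qed

section \<open>Extension of multiplier transforms from test functions\<close>

text \<open>The factor \<open>c\<close> lets the lemma serve also for sequences that are only controlled by a
  multiple of the distance of the \<open>d\<^sub>n\<close>.\<close>
lemma power_mass_Cauchy:
  assumes d: "\<And>n. d n \<in> borel_measurable M" and f: "f \<in> borel_measurable M" and q: "q > 0"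
    and lim: "(\<lambda>n. power_mass q M (\<lambda>x. d n x - f x)) \<longlonglongrightarrow> 0" and \<eta>: "\<eta> > 0"
  shows "\<exists>N. \<forall>n\<ge>N. \<forall>m\<ge>N. ennreal c * power_mass q M (\<lambda>x. d n x - d m x) < ennreal \<eta>"
proof -
  have "(\<lambda>n. ennreal c * (ennreal (2 powr q) * (2 * power_mass q M (\<lambda>x. d n x - f x))))
      \<longlonglongrightarrow> ennreal c * (ennreal (2 powr q) * (2 * 0))"
    using lim by (intro ennreal_tendsto_cmult) auto
  then have "eventually (\<lambda>n. ennreal c * (ennreal (2 powr q) * (2 * power_mass q M (\<lambda>x. d n x - f x))) < ennreal \<eta>) sequentially"
    using \<eta> by (intro order_tendstoD) auto
  then obtain N where N: "\<And>n. n \<ge> N \<Longrightarrow>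
      ennreal c * (ennreal (2 powr q) * (2 * power_mass q M (\<lambda>x. d n x - f x))) < ennreal \<eta>"
    unfolding eventually_sequentially by blast
  have "ennreal c * power_mass q M (\<lambda>x. d n x - d m x) < ennreal \<eta>" if nm: "n \<ge> N" "m \<ge> N" for n m
  proof -
    define a where "a = max (power_mass q M (\<lambda>x. d n x - f x)) (power_mass q M (\<lambda>x. d m x - f x))"
    have "power_mass q M (\<lambda>x. d n x - d m x) \<le> ennreal (2 powr q) *
        (power_mass q M (\<lambda>x. d n x - f x) + power_mass q M (\<lambda>x. f x - d m x))"
      by (rule power_mass_diff_triangle[OF d f d q])
    also have "\<dots> \<le> ennreal (2 powr q) * (a + a)"
      unfolding power_mass_minus_commute[of q M f] a_def by (intro mult_left_mono add_mono) auto
    finally have "ennreal c * power_mass q M (\<lambda>x. d n x - d m x) \<le> ennreal c * (ennreal (2 powr q) * (2 * a))"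
      by (intro mult_left_mono) (simp_all add: mult_2)
    also have "\<dots> < ennreal \<eta>"
      using N[OF nm(1)] N[OF nm(2)] unfolding a_def max_def by presburger
    finally show ?thesis .
  qed
  then show ?thesis by blast
qed

lemma le_of_scaled_approximation_ennreal:
  assumes "\<And>n. X \<le> ennreal ((1 + 1 / real (Suc n)) powr q * A)"
  shows "X \<le> ennreal A"
proof -
  have "(\<lambda>n. (1 + inverse (real (Suc n))) powr q * A) \<longlonglongrightarrow> (1 + 0) powr q * A"
    by (intro tendsto_intros LIMSEQ_inverse_real_of_nat) auto
  then have "(\<lambda>n. ennreal ((1 + 1 / real (Suc n)) powr q * A)) \<longlonglongrightarrow> ennreal A"
    using tendsto_ennrealI by (fastforce simp only: inverse_eq_divide add_0_right powr_one_eq_one mult_1)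
  then show ?thesis using assms by (intro LIMSEQ_le_const) auto
qed

text \<open>The constant must not grow here, since it ends up in the weak type norm. The sharp
  splitting with parameter \<open>s\<close> is used and \<open>s\<close> tends to 0 after \<open>n\<close> has tended to infinity.\<close>
lemma liminf_power_mass_le:
  assumes d: "\<And>n. d n \<in> borel_measurable M" and f: "f \<in> Lp q M" and q: "q > 0"
    and lim: "(\<lambda>n. power_mass q M (\<lambda>x. d n x - f x)) \<longlonglongrightarrow> 0" and c: "c \<ge> 0"
  shows "liminf (\<lambda>n. ennreal c * power_mass q M (d n)) \<le> ennreal c * power_mass q M f"
proof -
  have fm: "f \<in> borel_measurable M" using f by (rule Lp_measurable)
  obtain A where A: "A \<ge> 0" "power_mass q M f = ennreal A"
    using f by (cases "power_mass q M f") (auto simp: Lp_iff)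
  have "liminf (\<lambda>n. ennreal c * power_mass q M (d n)) \<le> ennreal ((1 + s) powr q * (c * A))" if s: "s > 0" for s
  proof -
    let ?u = "\<lambda>n. ennreal c * (ennreal ((1 + s) powr q) * ennreal A
        + ennreal ((1 + 1/s) powr q) * power_mass q M (\<lambda>x. d n x - f x))"
    have "ennreal c * power_mass q M (d n) \<le> ?u n" for n
      using power_mass_add[of f M "\<lambda>x. d n x - f x" s q] fm d[of n] s q unfolding A(2)[symmetric]
      by (intro mult_left_mono) auto
    then have "liminf (\<lambda>n. ennreal c * power_mass q M (d n)) \<le> liminf ?u"
      by (intro Liminf_mono always_eventually allI)
    also have "?u \<longlonglongrightarrow> ennreal c * (ennreal ((1 + s) powr q) * ennreal A + ennreal ((1 + 1/s) powr q) * 0)"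
      using lim by (intro ennreal_tendsto_cmult tendsto_add tendsto_const) auto
    from lim_imp_Liminf[OF _ this]
    have "liminf ?u = ennreal c * (ennreal ((1 + s) powr q) * ennreal A)" by simp
    also have "\<dots> = ennreal ((1 + s) powr q * (c * A))"
      using c A(1) by (simp add: ennreal_mult[symmetric] mult_ac)
    finally show ?thesis .
  qed
  note bound = this
  have "liminf (\<lambda>n. ennreal c * power_mass q M (d n)) \<le> ennreal (c * A)"
  proof (rule le_of_scaled_approximation_ennreal)
    show "liminf (\<lambda>n. ennreal c * power_mass q M (d n)) \<le> ennreal ((1 + 1 / real (Suc n)) powr q * (c * A))" for n
      by (rule bound) simp
  qed
  then show ?thesis unfolding A(2) ennreal_mult[OF c A(1)] .
qed

lemma power_mass_translate:
  fixes f :: "real \<Rightarrow> complex"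
  assumes [measurable]: "f \<in> borel_measurable lebesgue"
  shows "power_mass q lebesgue (\<lambda>x. f (x - y)) = power_mass q lebesgue f"
  unfolding power_mass_def
  using nn_integral_real_affine_lebesgue[of "\<lambda>x. ennreal (norm (f x) powr q)" 1 "- y"] by simp

lemma measurable_translate:
  fixes f :: "real \<Rightarrow> complex"
  assumes "f \<in> borel_measurable lebesgue"
  shows "(\<lambda>x. f (x - y)) \<in> borel_measurable lebesgue"
  using measurable_compose[OF lebesgue_affine_measurable[where c="\<lambda>_::real. 1" and t="- y"] assms] by simp

text \<open>The inverse Fourier transform is written as the Fourier integral at the reflected point.
  For test functions and bounded symbols the integral converges absolutely.\<close>
definition multiplier_transform :: "(real \<Rightarrow> complex) \<Rightarrow> (real \<Rightarrow> complex) \<Rightarrow> real \<Rightarrow> complex" where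
  "multiplier_transform \<phi> f x = fourier_integral (\<lambda>\<xi>. \<phi> \<xi> * fourier_integral f \<xi>) (- x)"

text \<open>The \<open>L\<^sup>2\<close> part of the argument uses only that the symbol is bounded.\<close>
locale bounded_symbol =
  fixes B :: real and \<phi> :: "real \<Rightarrow> complex"
  assumes \<phi>_meas: "\<phi> \<in> borel_measurable lebesgue"
    and \<phi>_bound: "AE \<xi> in lebesgue. norm (\<phi> \<xi>) \<le> B"
begin

lemma symbol_times_bound: "AE \<xi> in lebesgue. norm (\<phi> \<xi> * F \<xi>) \<le> norm (of_real B * F \<xi>)"
  using \<phi>_bound
proof eventually_elim
  case (elim \<xi>)
  then have "norm (\<phi> \<xi>) * norm (F \<xi>) \<le> \<bar>B\<bar> * norm (F \<xi>)" by (intro mult_right_mono) auto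
  then show ?case by (simp add: norm_mult)
qed

lemma power_mass_symbol_times:
  assumes "F \<in> borel_measurable lebesgue"
  shows "power_mass 2 lebesgue (\<lambda>\<xi>. \<phi> \<xi> * F \<xi>) \<le> ennreal (\<bar>B\<bar> powr 2) * power_mass 2 lebesgue F"
proof -
  have "power_mass 2 lebesgue (\<lambda>\<xi>. \<phi> \<xi> * F \<xi>) \<le> power_mass 2 lebesgue (\<lambda>\<xi>. of_real B * F \<xi>)"
    by (intro power_mass_mono_AE symbol_times_bound) simp
  then show ?thesis using power_mass_cmult[OF assms, of 2 "of_real B"] by simp
qed

lemma symbol_times_Lp_two:
  assumes "F \<in> Lp 2 lebesgue" shows "(\<lambda>\<xi>. \<phi> \<xi> * F \<xi>) \<in> Lp 2 lebesgue"
proof -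
  have m: "F \<in> borel_measurable lebesgue" by (rule Lp_measurable[OF assms])
  have "ennreal (\<bar>B\<bar> powr 2) * power_mass 2 lebesgue F < \<infinity>"
    using assms by (simp add: Lp_iff ennreal_mult_less_top)
  with power_mass_symbol_times[OF m] have "power_mass 2 lebesgue (\<lambda>\<xi>. \<phi> \<xi> * F \<xi>) < \<infinity>"
    by (rule le_less_trans)
  then show ?thesis using m \<phi>_meas by (simp add: Lp_iff)
qed

lemma symbol_fourier_integrable:
  assumes f: "test_function f"
  shows "integrable lebesgue (\<lambda>\<xi>. \<phi> \<xi> * fourier_integral f \<xi>)"
proof (rule Bochner_Integration.integrable_bound[OF _ _ symbol_times_bound])
  show "integrable lebesgue (\<lambda>\<xi>. of_real B * fourier_integral f \<xi>)"
    using test_function_fourier_integrable[OF f] by (rule integrable_mult_right)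
  show "(\<lambda>\<xi>. \<phi> \<xi> * fourier_integral f \<xi>) \<in> borel_measurable lebesgue"
    using \<phi>_meas test_function_fourier_measurable[OF f] by (rule borel_measurable_times)
qed

lemma multiplier_transform_measurable:
  assumes f: "test_function f" shows "multiplier_transform \<phi> f \<in> borel_measurable lebesgue"
proof -
  have "fourier_integral (\<lambda>\<xi>. \<phi> \<xi> * fourier_integral f \<xi>) \<in> borel_measurable borel"
    by (rule fourier_integral_measurable[OF symbol_fourier_integrable[OF f]])
  then have "multiplier_transform \<phi> f \<in> borel_measurable borel"
    unfolding multiplier_transform_def[abs_def] by measurable
  then show ?thesis by (intro measurable_completion) simp
qed

lemma multiplier_transform_linear:
  assumes f: "test_function f" and g: "test_function g"
  shows "multiplier_transform \<phi> (\<lambda>x. a * f x + b * g x) x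
    = a * multiplier_transform \<phi> f x + b * multiplier_transform \<phi> g x"
proof -
  have "(\<lambda>\<xi>. \<phi> \<xi> * fourier_integral (\<lambda>x. a * f x + b * g x) \<xi>)
    = (\<lambda>\<xi>. a * (\<phi> \<xi> * fourier_integral f \<xi>) + b * (\<phi> \<xi> * fourier_integral g \<xi>))"
    by (intro ext, subst fourier_integral_linear[OF test_function_integrable[OF f] test_function_integrable[OF g]])
      (simp add: algebra_simps)
  then show ?thesis
    unfolding multiplier_transform_def
    by (simp only: fourier_integral_linear[OF symbol_fourier_integrable[OF f] symbol_fourier_integrable[OF g]])
qed

lemma multiplier_transform_diff:
  assumes "test_function f" "test_function g"
  shows "multiplier_transform \<phi> (\<lambda>x. f x - g x) x = multiplier_transform \<phi> f x - multiplier_transform \<phi> g x"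
  using multiplier_transform_linear[OF assms, of 1 "-1" x] by simp

end

lemma multiplier_transform_translate:
  assumes f: "test_function f"
  shows "multiplier_transform \<phi> (\<lambda>x. f (x - A)) y = multiplier_transform \<phi> f (y - A)"
proof -
  have "(\<lambda>\<xi>. \<phi> \<xi> * fourier_integral (\<lambda>x. f (x - A)) \<xi>)
    = (\<lambda>\<xi>. cis (- (2 * pi * \<xi> * A)) * (\<phi> \<xi> * fourier_integral f \<xi>))"
    by (simp add: fourier_integral_translate[OF f] fun_eq_iff)
  then show ?thesis unfolding multiplier_transform_def by (simp only: fourier_integral_modulate)
qed

context bounded_symbol
begin

lemma
  assumes f: "test_function f"
  shows has_fourier_multiplier_transform:
      "has_fourier_real (multiplier_transform \<phi> f) (\<lambda>\<xi>. \<phi> \<xi> * fourier_integral f \<xi>)"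
    and power_mass_multiplier_transform:
      "power_mass 2 lebesgue (multiplier_transform \<phi> f)
        \<le> ennreal (2 powr 2 * \<bar>B\<bar> powr 2) * power_mass 2 lebesgue f"
proof -
  have G: "(\<lambda>\<xi>. \<phi> \<xi> * fourier_integral f \<xi>) \<in> Lp 1 lebesgue" "(\<lambda>\<xi>. \<phi> \<xi> * fourier_integral f \<xi>) \<in> Lp 2 lebesgue"
    using symbol_fourier_integrable[OF f] symbol_times_Lp_two[OF test_function_fourier_Lp_two[OF f]]
    by (auto simp: Lp_one_iff_integrable)
  show "has_fourier_real (multiplier_transform \<phi> f) (\<lambda>\<xi>. \<phi> \<xi> * fourier_integral f \<xi>)"
    using inverse_fourier_transform(1)[OF G] by (simp add: multiplier_transform_def[abs_def])
  have "power_mass 2 lebesgue (multiplier_transform \<phi> f)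
      \<le> ennreal (2 powr 2) * power_mass 2 lebesgue (\<lambda>\<xi>. \<phi> \<xi> * fourier_integral f \<xi>)"
    using inverse_fourier_transform(2)[OF G] by (simp add: multiplier_transform_def[abs_def])
  also have "\<dots> \<le> ennreal (2 powr 2) * (ennreal (\<bar>B\<bar> powr 2) * power_mass 2 lebesgue (fourier_integral f))"
    by (intro mult_left_mono power_mass_symbol_times test_function_fourier_measurable f) simp
  also have "\<dots> = ennreal (2 powr 2 * \<bar>B\<bar> powr 2) * power_mass 2 lebesgue f"
    unfolding plancherel_test_function[OF f] by (subst ennreal_mult) (auto simp: mult.assoc)
  finally show "power_mass 2 lebesgue (multiplier_transform \<phi> f)
        \<le> ennreal (2 powr 2 * \<bar>B\<bar> powr 2) * power_mass 2 lebesgue f" .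
qed

end

text \<open>The outcome of the transfer from the circle, taken here as a hypothesis: a weak type bound
  on test functions. From it the operator on all of \<open>L\<^sup>p\<close> is built.\<close>
locale weak_type_symbol = bounded_symbol B \<phi> for B :: real and \<phi> :: "real \<Rightarrow> complex" +
  fixes p K :: real
  assumes p: "p > 0" and K: "K \<ge> 0"
    and weak: "\<And>f t. test_function f \<Longrightarrow> t > 0 \<Longrightarrow>
      emeasure lebesgue {x. norm (multiplier_transform \<phi> f x) > t}
        \<le> ennreal (K powr p / t powr p) * power_mass p lebesgue f"
begin

text \<open>The graph of the extended operator. Working with the relation instead of a chosen limit
  makes the algebra of limits available before the extension is known to be single valued.\<close>
definition extends_to :: "(real \<Rightarrow> complex) \<Rightarrow> (real \<Rightarrow> complex) \<Rightarrow> bool" where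
  "extends_to f h \<longleftrightarrow> f \<in> Lp p lebesgue \<and> h \<in> borel_measurable lebesgue \<and>
     (\<exists>d. (\<forall>n. test_function (d n)) \<and> converges_Lp p d f \<and>
        (AE x in lebesgue. (\<lambda>n. multiplier_transform \<phi> (d n) x) \<longlonglongrightarrow> h x))"

lemma extends_toI:
  assumes "f \<in> Lp p lebesgue" "h \<in> borel_measurable lebesgue" "\<And>n. test_function (d n)"
    "converges_Lp p d f"
    "AE x in lebesgue. (\<lambda>n. multiplier_transform \<phi> (d n) x) \<longlonglongrightarrow> h x"
  shows "extends_to f h"
  using assms unfolding extends_to_def by blast

lemma extends_toE:
  assumes "extends_to f h"
  obtains d where "f \<in> Lp p lebesgue" "h \<in> borel_measurable lebesgue" "\<And>n. test_function (d n)"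
    "converges_Lp p d f"
    "AE x in lebesgue. (\<lambda>n. multiplier_transform \<phi> (d n) x) \<longlonglongrightarrow> h x"
  using assms unfolding extends_to_def by blast

text \<open>The weak type bound for differences makes the images of an approximating sequence Cauchy
  in measure.\<close>
lemma extends_to_total:
  assumes f: "f \<in> Lp p lebesgue"
  obtains h where "extends_to f h"
proof -
  obtain d where d: "\<And>n. test_function (d n)"
    and "\<And>q. q \<in> {p} \<Longrightarrow> converges_Lp q d f"
    by (rule test_function_sequence[of "{p}" f]) (use f p in auto)
  then have lim: "converges_Lp p d f" by blast
  let ?u = "\<lambda>n. multiplier_transform \<phi> (d n)"
  have c: "\<exists>N. \<forall>n\<ge>N. \<forall>m\<ge>N. emeasure lebesgue {x \<in> space lebesgue. norm (?u n x - ?u m x) > t} \<le> ennreal \<eta>"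
    if t: "t > 0" and \<eta>: "\<eta> > 0" for t \<eta>
  proof -
    obtain N where N: "\<forall>n\<ge>N. \<forall>m\<ge>N. ennreal (K powr p / t powr p) * diff_mass p (d n) (d m) < ennreal \<eta>"
      using power_mass_Cauchy[OF test_function_measurable[OF d] Lp_measurable[OF f] p lim \<eta>, of "K powr p / t powr p"] ..
    show ?thesis
    proof (intro exI[of _ N] allI impI)
      fix n m assume nm: "N \<le> n" "N \<le> m"
      have "emeasure lebesgue {x \<in> space lebesgue. norm (?u n x - ?u m x) > t}
          = emeasure lebesgue {x. norm (multiplier_transform \<phi> (\<lambda>x. d n x - d m x) x) > t}"
        by (simp add: multiplier_transform_diff d)
      also have "\<dots> \<le> ennreal (K powr p / t powr p) * diff_mass p (d n) (d m)"
        by (rule weak[OF test_function_diff[OF d d] t])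
      also have "\<dots> \<le> ennreal \<eta>" using N nm less_imp_le by blast
      finally show "emeasure lebesgue {x \<in> space lebesgue. norm (?u n x - ?u m x) > t} \<le> ennreal \<eta>" .
    qed
  qed
  obtain r h where r: "strict_mono r" and h: "h \<in> borel_measurable lebesgue"
    and ae: "AE x in lebesgue. (\<lambda>k. ?u (r k) x) \<longlonglongrightarrow> h x"
    using Cauchy_in_measure_imp_AE_subseq[OF multiplier_transform_measurable[OF d] c] by blast
  have "extends_to f h"
  proof (rule extends_toI[OF f h, of "\<lambda>k. d (r k)"])
    show "(\<lambda>k. diff_mass p (d (r k)) f) \<longlonglongrightarrow> 0"
      using LIMSEQ_subseq_LIMSEQ[OF lim r] by (simp add: comp_def)
  qed (use d ae in auto)
  then show thesis by (rule that)
qed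

lemma extends_to_weak_type:
  assumes H: "extends_to f h" and t: "t > 0"
  shows "emeasure lebesgue {x. norm (h x) > t} \<le> ennreal (K powr p / t powr p) * power_mass p lebesgue f"
proof -
  obtain d where f: "f \<in> Lp p lebesgue" and h: "h \<in> borel_measurable lebesgue" and d: "\<And>n. test_function (d n)"
    and lim: "converges_Lp p d f"
    and ae: "AE x in lebesgue. (\<lambda>n. multiplier_transform \<phi> (d n) x) \<longlonglongrightarrow> h x"
    by (rule extends_toE[OF H]) (rule that)
  have "emeasure lebesgue {x. norm (h x) > t}
      \<le> liminf (\<lambda>n. emeasure lebesgue {x. norm (multiplier_transform \<phi> (d n) x) > t})"
    using emeasure_level_Fatou[OF multiplier_transform_measurable[OF d] h ae, of t] by simp
  also have "\<dots> \<le> liminf (\<lambda>n. ennreal (K powr p / t powr p) * power_mass p lebesgue (d n))"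
    by (intro Liminf_mono always_eventually allI weak d t)
  also have "\<dots> \<le> ennreal (K powr p / t powr p) * power_mass p lebesgue f"
    by (rule liminf_power_mass_le[OF test_function_measurable[OF d] f p lim]) simp
  finally show ?thesis .
qed

lemma extends_to_linear:
  assumes "extends_to f h" "extends_to g k"
  shows "extends_to (\<lambda>x. a * f x + b * g x) (\<lambda>x. a * h x + b * k x)"
proof -
  obtain d where f: "f \<in> Lp p lebesgue" and h: "h \<in> borel_measurable lebesgue" and d: "\<And>n. test_function (d n)"
    and dlim: "converges_Lp p d f"
    and dae: "AE x in lebesgue. (\<lambda>n. multiplier_transform \<phi> (d n) x) \<longlonglongrightarrow> h x"
    by (rule extends_toE[OF assms(1)]) (rule that)
  obtain e where g: "g \<in> Lp p lebesgue" and k: "k \<in> borel_measurable lebesgue" and e: "\<And>n. test_function (e n)"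
    and elim: "converges_Lp p e g"
    and eae: "AE x in lebesgue. (\<lambda>n. multiplier_transform \<phi> (e n) x) \<longlonglongrightarrow> k x"
    by (rule extends_toE[OF assms(2)]) (rule that)
  note [measurable] = test_function_measurable[OF d] test_function_measurable[OF e] Lp_measurable[OF f] Lp_measurable[OF g]
  show ?thesis
  proof (rule extends_toI[of _ _ "\<lambda>n x. a * d n x + b * e n x"])
    show "(\<lambda>x. a * f x + b * g x) \<in> Lp p lebesgue" by (rule Lp_linear[OF f g p])
    show "(\<lambda>x. a * h x + b * k x) \<in> borel_measurable lebesgue" using h k by measurable
    show "test_function (\<lambda>x. a * d n x + b * e n x)" for n by (rule test_function_linear[OF d e])
    show "(\<lambda>n. power_mass p lebesgue (\<lambda>x. a * d n x + b * e n x - (a * f x + b * g x))) \<longlonglongrightarrow> 0"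
    proof (rule tendsto_0_of_le_sum_ennreal[where c="2 powr p"])
      show "(\<lambda>n. ennreal (norm a powr p) * diff_mass p (d n) f) \<longlonglongrightarrow> 0"
        using ennreal_tendsto_cmult[OF _ dlim, of "ennreal (norm a powr p)"] by simp
      show "(\<lambda>n. ennreal (norm b powr p) * diff_mass p (e n) g) \<longlonglongrightarrow> 0"
        using ennreal_tendsto_cmult[OF _ elim, of "ennreal (norm b powr p)"] by simp
      fix n
      have "power_mass p lebesgue (\<lambda>x. a * (d n x - f x) + b * (e n x - g x)) \<le>
         ennreal ((1 + 1) powr p) * power_mass p lebesgue (\<lambda>x. a * (d n x - f x))
         + ennreal ((1 + 1 / 1) powr p) * power_mass p lebesgue (\<lambda>x. b * (e n x - g x))"
        using p by (intro power_mass_add) auto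
      also have "\<dots> = ennreal (2 powr p) * (ennreal (norm a powr p) * diff_mass p (d n) f +
            ennreal (norm b powr p) * diff_mass p (e n) g)"
        by (subst (1 2) power_mass_cmult) (auto simp: distrib_left)
      finally show "power_mass p lebesgue (\<lambda>x. a * d n x + b * e n x - (a * f x + b * g x))
         \<le> ennreal (2 powr p) * (ennreal (norm a powr p) * diff_mass p (d n) f +
            ennreal (norm b powr p) * diff_mass p (e n) g)"
        by (simp add: algebra_simps)
    qed
    show "AE x in lebesgue. (\<lambda>n. multiplier_transform \<phi> (\<lambda>x. a * d n x + b * e n x) x) \<longlonglongrightarrow> a * h x + b * k x"
      using dae eae
    proof eventually_elim
      case (elim x)
      then show ?case
        by (simp add: multiplier_transform_linear d e tendsto_add tendsto_mult)
    qed
  qed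
qed

lemma extends_to_cong_AE:
  assumes "extends_to f h" "AE x in lebesgue. f x = g x" "g \<in> Lp p lebesgue"
  shows "extends_to g h"
proof -
  have "diff_mass p d f = diff_mass p d g" for d
    by (rule power_mass_cong_AE, use assms(2) in eventually_elim) simp
  then show ?thesis using assms(1,3) by (simp add: extends_to_def)
qed

text \<open>By linearity the difference of two values is an extension at the zero function, and the
  weak type bound makes all its level sets null.\<close>
lemma extends_to_unique:
  assumes "extends_to f h" "extends_to f k"
  shows "AE x in lebesgue. h x = k x"
proof -
  have E: "extends_to (\<lambda>x. 1 * f x + (-1) * f x) (\<lambda>x. 1 * h x + (-1) * k x)"
    by (rule extends_to_linear[OF assms])
  have [measurable]: "h \<in> borel_measurable lebesgue" "k \<in> borel_measurable lebesgue"
    using assms by (auto simp: extends_to_def)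
  have "AE x in lebesgue. \<not> norm (h x - k x) > 1 / real (Suc n)" for n
  proof -
    have "emeasure lebesgue {x. norm (1 * h x + (-1) * k x) > 1 / real (Suc n)}
      \<le> ennreal (K powr p / (1 / real (Suc n)) powr p) * power_mass p lebesgue (\<lambda>x. 1 * f x + (-1) * f x)"
      by (rule extends_to_weak_type[OF E]) simp
    then have "emeasure lebesgue {x. norm (h x - k x) > 1 / real (Suc n)} = 0"
      by (simp add: power_mass_def)
    moreover have "{x \<in> space lebesgue. norm (h x - k x) > 1 / real (Suc n)} \<in> sets lebesgue" by measurable
    ultimately have "{x. norm (h x - k x) > 1 / real (Suc n)} \<in> null_sets lebesgue" by (simp add: null_sets_def)
    from AE_not_in[OF this] show ?thesis by simp
  qed
  then have "AE x in lebesgue. \<forall>n. \<not> norm (h x - k x) > 1 / real (Suc n)"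
    unfolding AE_all_countable by blast
  then show ?thesis
  proof eventually_elim
    case (elim x)
    show ?case
    proof (rule ccontr)
      assume "h x \<noteq> k x"
      then have "0 < norm (h x - k x)" by simp
      then obtain n where "inverse (real (Suc n)) < norm (h x - k x)" using reals_Archimedean by blast
      then show False using elim by (simp add: inverse_eq_divide)
    qed
  qed
qed

lemma extends_to_translate:
  assumes "extends_to f h"
  shows "extends_to (\<lambda>x. f (x - y)) (\<lambda>x. h (x - y))"
proof -
  obtain d where f: "f \<in> Lp p lebesgue" and h: "h \<in> borel_measurable lebesgue" and d: "\<And>n. test_function (d n)"
    and lim: "converges_Lp p d f"
    and ae: "AE x in lebesgue. (\<lambda>n. multiplier_transform \<phi> (d n) x) \<longlonglongrightarrow> h x"
    by (rule extends_toE[OF assms]) (rule that)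
  have fm: "f \<in> borel_measurable lebesgue" by (rule Lp_measurable[OF f])
  show ?thesis
  proof (rule extends_toI[of _ _ "\<lambda>n x. d n (x - y)"])
    show "(\<lambda>x. f (x - y)) \<in> Lp p lebesgue"
      using f by (simp add: Lp_iff power_mass_translate measurable_translate)
    show "(\<lambda>x. h (x - y)) \<in> borel_measurable lebesgue" by (rule measurable_translate[OF h])
    show "test_function (\<lambda>x. d n (x - y))" for n by (rule test_function_translate[OF d])
    have "power_mass p lebesgue (\<lambda>x. d n (x - y) - f (x - y)) = power_mass p lebesgue (\<lambda>x. d n x - f x)" for n
      using fm test_function_measurable[OF d[of n]] by (intro power_mass_translate[where f="\<lambda>x. d n x - f x"]) auto
    then show "(\<lambda>n. power_mass p lebesgue (\<lambda>x. d n (x - y) - f (x - y))) \<longlonglongrightarrow> 0" using lim by simp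
    show "AE x in lebesgue. (\<lambda>n. multiplier_transform \<phi> (\<lambda>x. d n (x - y)) x) \<longlonglongrightarrow> h (x - y)"
      using AE_lebesgue_affine[OF ae, of 1 "- y"] by (simp add: multiplier_transform_translate d)
  qed
qed

text \<open>Approximate in \<open>L\<^sup>p\<close> and \<open>L\<^sup>2\<close> by the same test functions. By Plancherel's identity their
  transforms converge in \<open>L\<^sup>2\<close> to some \<open>F\<close>, the products with the bounded symbol converge to \<open>\<phi>
  F\<close>, and the images converge in \<open>L\<^sup>2\<close>. A subsequence of the images converges almost everywhere,
  so the \<open>L\<^sup>2\<close> limit is also a value of the extension from \<open>L\<^sup>p\<close>.\<close>
lemma extends_to_square_integrable:
  assumes f: "f \<in> Lp p lebesgue" "f \<in> Lp 2 lebesgue"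
  obtains h F where "extends_to f h" "has_fourier_real f F" "has_fourier_real h (\<lambda>\<xi>. \<phi> \<xi> * F \<xi>)"
proof -
  obtain d where d: "\<And>n. test_function (d n)"
    and "\<And>q. q \<in> {p, 2} \<Longrightarrow> converges_Lp q d f"
    by (rule test_function_sequence[of "{p, 2}" f]) (use f p in auto)
  then have limp: "converges_Lp p d f"
    and lim2: "converges_Lp 2 d f" by blast+
  note fm = Lp_measurable[OF f(1)] and dm = test_function_measurable[OF d]
  have cauchy: "\<exists>N. \<forall>n\<ge>N. \<forall>m\<ge>N. ennreal c * diff_mass 2 (d n) (d m) < ennreal \<eta>" if "\<eta> > 0" for \<eta> c
    by (rule power_mass_Cauchy[OF dm fm _ lim2 that]) simp
  have F_diff: "(\<lambda>\<xi>. fourier_integral (d n) \<xi> - fourier_integral (d m) \<xi>) = fourier_integral (\<lambda>x. d n x - d m x)" for n m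
    by (simp add: fun_eq_iff fourier_integral_diff test_function_integrable d)
  have "\<exists>N. \<forall>n\<ge>N. \<forall>m\<ge>N. diff_mass 2 (fourier_integral (d n)) (fourier_integral (d m)) < ennreal \<eta>"
    if "\<eta> > 0" for \<eta>
    using cauchy[OF that, of 1] unfolding F_diff plancherel_test_function[OF test_function_diff[OF d d]] by simp
  from Lp_complete[OF test_function_fourier_Lp_two[OF d] _ this]
  obtain F where F: "F \<in> Lp 2 lebesgue"
    and Flim: "(\<lambda>n. diff_mass 2 (fourier_integral (d n)) F) \<longlonglongrightarrow> 0" by auto
  let ?T = "\<lambda>n. multiplier_transform \<phi> (d n)"
  have T2: "?T n \<in> Lp 2 lebesgue" for n
    using has_fourier_multiplier_transform[OF d] by (simp add: has_fourier_real_iff)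
  have T_diff: "(\<lambda>x. ?T n x - ?T m x) = multiplier_transform \<phi> (\<lambda>x. d n x - d m x)" for n m
    by (simp add: fun_eq_iff multiplier_transform_diff d)
  have Tc: "\<exists>N. \<forall>n\<ge>N. \<forall>m\<ge>N. diff_mass 2 (?T n) (?T m) < ennreal \<eta>" if "\<eta> > 0" for \<eta>
    unfolding T_diff
    using cauchy[OF that, of "2 powr 2 * \<bar>B\<bar> powr 2"]
      power_mass_multiplier_transform[OF test_function_diff[OF d d]] le_less_trans by blast
  obtain h r where h: "h \<in> Lp 2 lebesgue"
    and hlim: "(\<lambda>n. diff_mass 2 (?T n) h) \<longlonglongrightarrow> 0"
    and r: "strict_mono r" and ae: "AE x in lebesgue. (\<lambda>k. ?T (r k) x) \<longlonglongrightarrow> h x"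
    using Lp_complete[OF T2 _ Tc] by auto
  have "extends_to f h"
  proof (rule extends_toI[OF f(1) Lp_measurable[OF h], of "\<lambda>k. d (r k)"])
    show "(\<lambda>k. diff_mass p (d (r k)) f) \<longlonglongrightarrow> 0"
      using LIMSEQ_subseq_LIMSEQ[OF limp r] by (simp add: comp_def)
  qed (use d ae in auto)
  moreover have "has_fourier_real f F"
    by (rule has_fourier_real_closed[OF has_fourier_real_test_function[OF d] f(2) lim2 F Flim])
  moreover have "has_fourier_real h (\<lambda>\<xi>. \<phi> \<xi> * F \<xi>)"
  proof (rule has_fourier_real_closed[OF has_fourier_multiplier_transform[OF d] h hlim symbol_times_Lp_two[OF F]])
    show "(\<lambda>n. power_mass 2 lebesgue (\<lambda>x. \<phi> x * fourier_integral (d n) x - \<phi> x * F x)) \<longlonglongrightarrow> 0"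
    proof (rule tendsto_0_of_le_sum_ennreal[where c="\<bar>B\<bar> powr 2", OF Flim tendsto_const])
      fix n
      have "(\<lambda>x. \<phi> x * fourier_integral (d n) x - \<phi> x * F x) = (\<lambda>x. \<phi> x * (fourier_integral (d n) x - F x))"
        by (simp add: algebra_simps)
      then show "power_mass 2 lebesgue (\<lambda>x. \<phi> x * fourier_integral (d n) x - \<phi> x * F x)
        \<le> ennreal (\<bar>B\<bar> powr 2) * (diff_mass 2 (fourier_integral (d n)) F + 0)"
        using power_mass_symbol_times[of "\<lambda>x. fourier_integral (d n) x - F x"]
          test_function_fourier_measurable[OF d[of n]] Lp_measurable[OF F] by simp
    qed
  qed
  ultimately show thesis by (rule that)
qed

theorem multiplier_operator_exists:
  obtains T where "is_multiplier_operator p lebesgue (\<lambda>y x. x - y) has_fourier_real \<phi> T"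
    "weak_type_bound p lebesgue T K"
proof -
  define T where "T f = (SOME h. extends_to f h)" for f
  have T: "extends_to f (T f)" if f: "f \<in> Lp p lebesgue" for f
  proof -
    obtain h where "extends_to f h" using extends_to_total[OF f] by blast
    then show ?thesis unfolding T_def by (rule someI[of "extends_to f"])
  qed
  have Tm: "T f \<in> borel_measurable lebesgue" if "f \<in> Lp p lebesgue" for f
    using T[OF that] by (simp add: extends_to_def)
  have Tw: "emeasure lebesgue {x \<in> space lebesgue. norm (T f x) > t}
      \<le> ennreal (K powr p / t powr p * (LINT x|lebesgue. norm (f x) powr p))" if f: "f \<in> Lp p lebesgue" and t: "t > 0" for f t
  proof -
    have "ennreal (K powr p / t powr p * (LINT x|lebesgue. norm (f x) powr p))
      = ennreal (K powr p / t powr p) * power_mass p lebesgue f"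
      unfolding power_mass_eq_integral[OF f] by (rule ennreal_mult) auto
    then show ?thesis using extends_to_weak_type[OF T[OF f] t] by simp
  qed
  have wb: "weak_type_bound p lebesgue T K"
    unfolding weak_type_bound_def using K Tw by blast
  have wL: "T f \<in> weak_Lp p lebesgue" if f: "f \<in> Lp p lebesgue" for f
  proof -
    define I where "I = (LINT x|lebesgue. norm (f x) powr p)"
    have I: "I \<ge> 0" unfolding I_def by simp
    \<comment> \<open>The weak quasi-norm is at most \<open>K\<close> times the norm of \<open>f\<close>.\<close>
    define A where "A = K * I powr (1 / p)"
    have A: "A \<ge> 0" unfolding A_def using K by simp
    have "A powr p = K powr p * I"
      unfolding A_def using K I p by (simp add: powr_mult powr_powr)
    then have "\<forall>t>0. emeasure lebesgue {x \<in> space lebesgue. norm (T f x) > t} \<le> ennreal (A powr p / t powr p)"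
      using Tw[OF f] unfolding I_def[symmetric] by simp
    then show ?thesis unfolding weak_Lp_def using A Tm[OF f] by blast
  qed
  have "translation_invariant_operator p lebesgue (\<lambda>y x. x - y) T"
    unfolding translation_invariant_operator_def
  proof (intro conjI ballI impI allI)
    fix f :: "real \<Rightarrow> complex" assume f: "f \<in> Lp p lebesgue"
    show "T f \<in> weak_Lp p lebesgue" by (rule wL[OF f])
    fix g :: "real \<Rightarrow> complex" assume g: "g \<in> Lp p lebesgue"
    show "AE x in lebesgue. T f x = T g x" if "AE x in lebesgue. f x = g x"
      by (rule extends_to_unique[OF extends_to_cong_AE[OF T[OF f] that g] T[OF g]])
    show "AE x in lebesgue. T (\<lambda>z. a * f z + b * g z) x = a * T f x + b * T g x" for a b
      by (rule extends_to_unique[OF T[OF Lp_linear[OF f g p]] extends_to_linear[OF T[OF f] T[OF g]]])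
  next
    fix f :: "real \<Rightarrow> complex" and y :: real assume f: "f \<in> Lp p lebesgue"
    note E = extends_to_translate[OF T[OF f], of y]
    have "(\<lambda>z. f (z - y)) \<in> Lp p lebesgue" using E by (simp add: extends_to_def)
    from extends_to_unique[OF T[OF this] E]
    show "AE x in lebesgue. T (\<lambda>z. f (z - y)) x = T f (x - y)" .
  qed
  moreover have "\<exists>F. has_fourier_real f F \<and> has_fourier_real (T f) (\<lambda>\<xi>. \<phi> \<xi> * F \<xi>)"
    if "f \<in> Lp 2 lebesgue \<inter> Lp p lebesgue" for f
  proof -
    have f: "f \<in> Lp p lebesgue" "f \<in> Lp 2 lebesgue" using that by auto
    obtain h F where E: "extends_to f h" and F: "has_fourier_real f F" and H: "has_fourier_real h (\<lambda>\<xi>. \<phi> \<xi> * F \<xi>)"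
      using extends_to_square_integrable[OF f] by blast
    have "has_fourier_real (T f) (\<lambda>\<xi>. \<phi> \<xi> * F \<xi>)"
      by (rule has_fourier_real_cong_AE[OF H extends_to_unique[OF E T[OF f(1)]] Tm[OF f(1)]])
    then show ?thesis using F by blast
  qed
  ultimately have "is_multiplier_operator p lebesgue (\<lambda>y x. x - y) has_fourier_real \<phi> T"
    unfolding is_multiplier_operator_def by blast
  then show thesis using wb by (rule that)
qed

end

section \<open>From the circle to the line\<close>

lemma circle_bounded_Lp:
  assumes "f \<in> borel_measurable circle" "\<And>x. norm (f x) \<le> B" "q > 0"
  shows "f \<in> Lp q circle"
proof -
  interpret F: finite_measure circle by (rule circle_finite)
  have [measurable]: "f \<in> borel_measurable circle" by fact
  have "integrable circle (\<lambda>x. norm (f x) powr q)"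
    using assms(2,3) by (intro F.integrable_const_bound[where B="B powr q"]) (auto intro!: powr_mono2)
  then show ?thesis using assms(1) by (simp add: Lp_def)
qed

lemma circle_Lp_two_integrable:
  assumes "f \<in> Lp 2 circle" shows "integrable circle f"
proof (rule Bochner_Integration.integrable_bound)
  interpret F: finite_measure circle by (rule circle_finite)
  show "integrable circle (\<lambda>x. 1 + norm (f x) powr 2)"
    using assms by (intro Bochner_Integration.integrable_add) (auto simp: Lp_def)
  show "f \<in> borel_measurable circle" using assms by (rule Lp_measurable)
  have "norm (f x) \<le> norm (1 + norm (f x) powr 2)" for x
  proof -
    have "0 \<le> (norm (f x) - 1)\<^sup>2 + norm (f x)" by simp
    then have "norm (f x) \<le> 1 + (norm (f x))\<^sup>2" by (simp add: power2_eq_square algebra_simps)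
    then show ?thesis by (simp add: powr_numeral)
  qed
  then show "AE x in circle. norm (f x) \<le> norm (1 + norm (f x) powr 2)" by simp
qed

abbreviation circle_multiplier_operator ::
  "real \<Rightarrow> (int \<Rightarrow> complex) \<Rightarrow> ((real \<Rightarrow> complex) \<Rightarrow> real \<Rightarrow> complex) \<Rightarrow> bool" where
  "circle_multiplier_operator p \<equiv> is_multiplier_operator p circle (\<lambda>y x. frac (x - y)) has_fourier_circle"

text \<open>An operator on the circle is prescribed by its symbol only through Fourier coefficients;
  absolute summability turns this into a pointwise formula.\<close>
lemma circle_multiplier_operator_eq_series:
  assumes T: "circle_multiplier_operator p \<psi> T" and g: "g \<in> Lp 2 circle" "g \<in> Lp p circle"
    and c: "\<And>n. c n = \<psi> n * (LINT x|circle. g x * cis (- (2 * pi * of_int n * x)))"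
    and int: "integrable (count_space UNIV) c"
  shows "AE x in circle. T g x = character_series c x"
proof -
  obtain F where F: "has_fourier_circle g F" "has_fourier_circle (T g) (\<lambda>n. \<psi> n * F n)"
    using T g unfolding is_multiplier_operator_def by blast
  have "integrable circle (T g)"
    using F(2) by (intro circle_Lp_two_integrable) (simp add: has_fourier_circle_def)
  then show ?thesis
    using F int by (intro AE_eq_character_series) (auto simp: has_fourier_circle_def c)
qed

text \<open>A character \<open>e\<close> of frequency \<open>n\<close> is mapped to \<open>\<psi> n\<close> times itself. This image has constant
  modulus, so at a level \<open>t\<close> between \<open>C\<close> and the modulus of \<open>\<psi> n\<close> the weak type bound would say
  that the whole circle has measure at most \<open>(C / t)\<^sup>p < 1\<close>.\<close>
lemma circle_multiplier_symbol_bound: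
  assumes T: "circle_multiplier_operator p \<psi> T" and W: "weak_type_bound p circle T C" and p: "p > 0"
  shows "norm (\<psi> n) \<le> C"
proof (rule ccontr)
  assume "\<not> norm (\<psi> n) \<le> C"
  then obtain t where t: "C < t" "t < norm (\<psi> n)" using dense not_le by metis
  have C: "C \<ge> 0" using W by (simp add: weak_type_bound_def)
  then have t0: "t > 0" using t by simp
  define e where "e x = cis (2 * pi * of_int n * x)" for x
  have em: "e \<in> borel_measurable circle"
    unfolding e_def using cis_measurable_circle[of "2 * pi * of_int n"] by simp
  have e: "e \<in> Lp q circle" if "q > 0" for q
    using that by (intro circle_bounded_Lp[OF em, of 1]) (auto simp: e_def)
  have coeff: "(LINT x|circle. e x * cis (- (2 * pi * of_int m * x))) = indicator {n} m" for m
  proof -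
    have "(LINT x|circle. e x * cis (- (2 * pi * of_int m * x))) = (LINT x|circle. cis (2 * pi * of_int (n - m) * x))"
      unfolding e_def by (intro Bochner_Integration.integral_cong refl) (simp add: cis_mult algebra_simps)
    then show ?thesis by (simp only: integral_character_circle) (auto simp: indicator_def)
  qed
  define c where "c m = \<psi> n * indicator {n} m" for m
  have ci: "integrable (count_space UNIV) c"
  proof -
    have "integrable (count_space UNIV) (\<lambda>m. indicator {n} m *\<^sub>R \<psi> n)" by simp
    also have "(\<lambda>m. indicator {n} m *\<^sub>R \<psi> n) = c" by (auto simp: c_def fun_eq_iff indicator_def)
    finally show ?thesis .
  qed
  have "AE x in circle. T e x = character_series c x"
    using p by (intro circle_multiplier_operator_eq_series[OF T e e _ ci]) (auto simp: coeff c_def indicator_def)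
  moreover have "character_series c x = \<psi> n * e x" for x
  proof -
    have "character_series c x = (LINT m|count_space UNIV. indicator {n} m *\<^sub>R (\<psi> n * e x))"
      unfolding character_series_def
      by (intro Bochner_Integration.integral_cong refl) (auto simp: c_def indicator_def e_def)
    then show ?thesis by simp
  qed
  ultimately have ae: "AE x in circle. norm (T e x) = norm (\<psi> n)"
    by (auto simp: e_def norm_mult elim: eventually_mono)
  have Tm: "T e \<in> borel_measurable circle"
    using T e[OF p] unfolding is_multiplier_operator_def translation_invariant_operator_def weak_Lp_def by blast
  note Tm [measurable]
  have "{x \<in> space circle. norm (T e x) > t} \<in> sets circle" by measurable
  then have "emeasure circle {x \<in> space circle. norm (T e x) > t} = emeasure circle (space circle)"
    by (intro emeasure_eq_AE sets.top, use ae in eventually_elim) (use t in auto)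
  also have "\<dots> = 1" by (simp add: emeasure_restrict_space)
  finally have one: "emeasure circle {x \<in> space circle. norm (T e x) > t} = 1" .
  have "emeasure circle {x \<in> space circle. norm (T e x) > t}
      \<le> ennreal (C powr p / t powr p * (LINT x|circle. norm (e x) powr p))"
    using W e[OF p] t0 unfolding weak_type_bound_def by blast
  then have "1 \<le> ennreal (C powr p / t powr p * (LINT x|circle. norm (e x) powr p))"
    unfolding one .
  also have "(LINT x|circle. norm (e x) powr p) = 1"
    using measure_circle_UNIV by (simp add: e_def)
  finally have "1 \<le> C powr p / t powr p" by simp
  moreover have "C powr p < t powr p" using C t p by (intro powr_less_mono2) auto
  ultimately show False using t0 by (simp add: le_divide_eq)
qed

lemma rescaled_power_mass:
  assumes f: "test_function f" and supp: "\<And>x. x \<notin> {0..S} \<Longrightarrow> f x = 0"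
    and \<epsilon>: "\<epsilon> > 0" "\<epsilon> * S < 1"
  shows "power_mass q circle (\<lambda>x. f (x / \<epsilon>)) = ennreal \<epsilon> * power_mass q lebesgue f"
proof -
  note [measurable] = test_function_measurable_borel[OF f]
  have "power_mass q circle (\<lambda>x. f (x / \<epsilon>))
      = (\<integral>\<^sup>+x. ennreal (norm (f (x / \<epsilon>)) powr q) * indicator {0..<1} x \<partial>lebesgue)"
    unfolding power_mass_def by (rule nn_integral_restrict_space) simp
  also have "\<dots> = (\<integral>\<^sup>+x. ennreal (norm (f (x / \<epsilon>)) powr q) \<partial>lebesgue)"
  proof (intro nn_integral_cong)
    fix x :: real
    have "x / \<epsilon> \<notin> {0..S}" if "x \<notin> {0..<1}"
      using that \<epsilon> by (auto simp: divide_le_eq zero_le_divide_iff mult.commute)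
    then show "ennreal (norm (f (x / \<epsilon>)) powr q) * indicator {0..<1} x = ennreal (norm (f (x / \<epsilon>)) powr q)"
      using supp by (cases "x \<in> {0..<1}") auto
  qed
  also have "\<dots> = ennreal \<bar>\<epsilon>\<bar> * (\<integral>\<^sup>+x. ennreal (norm (f ((0 + \<epsilon> * x) / \<epsilon>)) powr q) \<partial>lebesgue)"
    using \<epsilon>(1) by (intro nn_integral_real_affine_lebesgue measurable_completion) auto
  also have "\<dots> = ennreal \<epsilon> * power_mass q lebesgue f"
    using \<epsilon>(1) by (simp add: power_mass_def)
  finally show ?thesis .
qed

text \<open>The series is the image of the dilated function under the circle operator. Both sides of
  the weak type inequality on the circle are multiples by \<open>\<epsilon>\<close> of the corresponding quantities on
  the line, and this factor cancels.\<close>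
lemma rescaled_series_weak_bound:
  assumes T: "circle_multiplier_operator p \<psi> T" and W: "weak_type_bound p circle T C" and p: "p > 0"
    and f: "test_function f" and supp: "\<And>x. x \<notin> {0..S} \<Longrightarrow> f x = 0"
    and \<epsilon>: "0 < \<epsilon>" "\<epsilon> \<le> 1" "\<epsilon> * S < 1" and t: "t > 0"
  defines "b \<equiv> \<lambda>n::int. of_real \<epsilon> * (\<psi> n * fourier_integral f (\<epsilon> * of_int n))"
  shows "emeasure lebesgue {y. norm (indicator {0..<1 / \<epsilon>} y * character_series b (\<epsilon> * y)) > t}
    \<le> ennreal (C powr p / t powr p) * power_mass p lebesgue f"
proof -
  define g where "g x = f (x / \<epsilon>)" for x
  obtain D where D: "D \<ge> 0" "\<And>\<xi>. norm (fourier_integral f \<xi>) \<le> D / (1 + \<xi>\<^sup>2)"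
    using test_function_fourier_decay[OF f] by blast
  have bi: "integrable (count_space UNIV) b"
    unfolding b_def
    by (rule integrable_sampled_coefficients[OF fourier_integral_continuous[OF test_function_integrable[OF f]]
          D \<epsilon>(1,2) circle_multiplier_symbol_bound[OF T W p]])
  obtain M where M: "\<And>x. norm (f x) \<le> M"
    by (rule test_function_bounded_support[OF f]) (rule that)
  have gm: "g \<in> borel_measurable circle"
    unfolding g_def by (rule borel_measurable_integrable[OF rescaled_integrable_circle[OF f]])
  have g: "g \<in> Lp q circle" if "q > 0" for q
    using that by (intro circle_bounded_Lp[OF gm, of M]) (auto simp: g_def M)
  have ae: "AE x in circle. T g x = character_series b x"
  proof (rule circle_multiplier_operator_eq_series[OF T g g[OF p] _ bi])
    show "b n = \<psi> n * (LINT x|circle. g x * cis (- (2 * pi * of_int n * x)))" for n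
      unfolding g_def b_def by (subst rescaled_coefficient[OF f supp \<epsilon>(1,3)]) simp_all
  qed simp
  have Tm: "T g \<in> borel_measurable circle"
    using T g[OF p] unfolding is_multiplier_operator_def translation_invariant_operator_def weak_Lp_def by blast
  have sm: "character_series b \<in> borel_measurable circle"
    by (intro circle_measurable_borel character_series_measurable)
  define A where "A = {x \<in> {0..<1}. norm (character_series b x) > t}"
  have "{x \<in> space borel. norm (character_series b x) > t} \<in> sets borel" by measurable
  then have A: "A \<in> sets lebesgue"
    unfolding A_def by (intro sets_completionI_sets) (auto simp: Collect_conj_eq)
  have A_circle: "A = {x \<in> space circle. norm (character_series b x) > t}" by (simp add: A_def)
  have "emeasure lebesgue A = emeasure circle A"
    using A by (subst emeasure_restrict_space) (auto simp: A_def)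
  also have "emeasure circle A = emeasure circle {x \<in> space circle. norm (T g x) > t}"
    unfolding A_circle
  proof (rule emeasure_eq_AE)
    note Tm [measurable] sm [measurable]
    show "{x \<in> space circle. norm (character_series b x) > t} \<in> sets circle"
      "{x \<in> space circle. norm (T g x) > t} \<in> sets circle" by measurable
    show "AE x in circle. x \<in> {x \<in> space circle. norm (character_series b x) > t}
        \<longleftrightarrow> x \<in> {x \<in> space circle. norm (T g x) > t}"
      using ae by eventually_elim simp
  qed
  also have "\<dots> \<le> ennreal (C powr p / t powr p * (LINT x|circle. norm (g x) powr p))"
    using W g[OF p] t unfolding weak_type_bound_def by blast
  also have "\<dots> = ennreal (C powr p / t powr p) * power_mass p circle g"
    unfolding power_mass_eq_integral[OF g[OF p]] by (rule ennreal_mult) auto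
  also have "\<dots> = ennreal \<epsilon> * (ennreal (C powr p / t powr p) * power_mass p lebesgue f)"
  proof -
    have "power_mass p circle g = ennreal \<epsilon> * power_mass p lebesgue f"
      unfolding g_def by (rule rescaled_power_mass[OF f supp \<epsilon>(1,3)])
    then show ?thesis by (simp only: mult_ac)
  qed
  finally have "emeasure lebesgue A \<le> ennreal \<epsilon> * (ennreal (C powr p / t powr p) * power_mass p lebesgue f)" .
  moreover have "emeasure lebesgue A = ennreal \<epsilon> * emeasure lebesgue {y. 0 + \<epsilon> * y \<in> A}"
    using emeasure_lebesgue_affine_preimage[OF A, of \<epsilon> 0] \<epsilon>(1) by simp
  moreover have "{y. 0 + \<epsilon> * y \<in> A} = {y. norm (indicator {0..<1 / \<epsilon>} y * character_series b (\<epsilon> * y)) > t}"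
  proof (intro Collect_cong)
    fix y
    have "\<epsilon> * y \<in> {0..<1} \<longleftrightarrow> y \<in> {0..<1 / \<epsilon>}"
      using \<epsilon>(1) by (simp add: less_divide_eq mult.commute zero_le_mult_iff)
    then show "0 + \<epsilon> * y \<in> A \<longleftrightarrow> norm (indicator {0..<1 / \<epsilon>} y * character_series b (\<epsilon> * y)) > t"
      using t by (cases "y \<in> {0..<1 / \<epsilon>}") (auto simp: A_def)
  qed
  ultimately have "ennreal \<epsilon> * emeasure lebesgue {y. norm (indicator {0..<1 / \<epsilon>} y * character_series b (\<epsilon> * y)) > t}
      \<le> ennreal \<epsilon> * (ennreal (C powr p / t powr p) * power_mass p lebesgue f)" by simp
  then show ?thesis using \<epsilon>(1) by (subst (asm) ennreal_mult_le_mult_iff) auto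
qed

text \<open>In the application \<open>C\<close> exceeds all the multiplier norms, so that for every mesh size an
  operator with this constant exists.\<close>
locale circle_multiplier_family = bounded_symbol B \<phi> for B :: real and \<phi> :: "real \<Rightarrow> complex" +
  fixes p C :: real and \<Phi> :: "real \<Rightarrow> int \<Rightarrow> complex"
  assumes p: "p > 0"
    and operators: "\<And>\<epsilon>. \<epsilon> > 0 \<Longrightarrow> \<exists>T. circle_multiplier_operator p (\<Phi> \<epsilon>) T \<and> weak_type_bound p circle T C"
    and limit: "AE \<xi> in lebesgue. ((\<lambda>\<epsilon>. \<Phi> \<epsilon> \<lfloor>\<xi> / \<epsilon>\<rfloor>) \<longlongrightarrow> \<phi> \<xi>) (at_right 0)"
begin

text \<open>The periods \<open>[0, 1/\<epsilon>)\<close> exhaust the nonnegative half-line, which explains the indicator: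
  nothing is seen to the left of the origin.\<close>
lemma one_sided_weak_bound:
  assumes f: "test_function f" and supp: "\<And>x. x \<notin> {0..S} \<Longrightarrow> f x = 0" and S: "S \<ge> 0" and t: "t > 0"
  shows "emeasure lebesgue {y. norm (indicator {0..} y * multiplier_transform \<phi> f y) > t}
    \<le> ennreal (C powr p / t powr p) * power_mass p lebesgue f"
proof -
  let ?e = "sampling_step S"
  define b where "b k n = of_real (?e k) * (\<Phi> (?e k) n * fourier_integral f (?e k * of_int n))" for k and n :: int
  note e = sampling_step[OF S] sampling_step_tendsto[OF S]
  obtain D where D: "D \<ge> 0" "\<And>\<xi>. norm (fourier_integral f \<xi>) \<le> D / (1 + \<xi>\<^sup>2)"
    using test_function_fourier_decay[OF f] by blast
  have \<Phi>_le: "norm (\<Phi> (?e k) n) \<le> C" for k n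
    using operators[OF e(1)[of k]] circle_multiplier_symbol_bound[OF _ _ p] by blast
  have "filterlim ?e (at_right 0) sequentially"
    using e(1,5) by (simp add: filterlim_at greaterThan_def less_imp_neq[symmetric])
  then have lim: "AE \<xi> in lebesgue. (\<lambda>k. \<Phi> (?e k) \<lfloor>\<xi> / ?e k\<rfloor>) \<longlonglongrightarrow> \<phi> \<xi>"
    using limit by (auto elim!: eventually_mono intro: filterlim_compose)
  have ser: "(\<lambda>k. character_series (b k) (?e k * y)) \<longlonglongrightarrow> multiplier_transform \<phi> f y" for y
    unfolding b_def multiplier_transform_def
    by (rule sampled_series_tendsto[OF fourier_integral_continuous[OF test_function_integrable[OF f]] D
        e(1,2,5) \<Phi>_le \<phi>_meas lim])
  define u where "u k y = indicator {0..<1 / ?e k} y * character_series (b k) (?e k * y)" for k y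
  have um: "u k \<in> borel_measurable lebesgue" for k
    unfolding u_def by (intro measurable_completion) measurable
  have vm: "(\<lambda>y. indicator {0..} y * multiplier_transform \<phi> f y) \<in> borel_measurable lebesgue"
    using multiplier_transform_measurable[OF f] by (intro borel_measurable_times borel_measurable_indicator) auto
  have ulim: "(\<lambda>k. u k y) \<longlonglongrightarrow> indicator {0..} y * multiplier_transform \<phi> f y" for y
  proof -
    have "eventually (\<lambda>k. indicator {0..<1 / ?e k} y = (indicator {0..} y :: complex)) sequentially"
      using sampling_step_eventually[OF S, of y] by eventually_elim (auto simp: indicator_def)
    then have "(\<lambda>k. indicator {0..<1 / ?e k} y :: complex) \<longlonglongrightarrow> indicator {0..} y"
      by (rule tendsto_eventually)
    then show ?thesis unfolding u_def by (intro tendsto_mult ser)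
  qed
  have "emeasure lebesgue {y. norm (u k y) > t} \<le> ennreal (C powr p / t powr p) * power_mass p lebesgue f" for k
  proof -
    obtain T where T: "circle_multiplier_operator p (\<Phi> (?e k)) T" "weak_type_bound p circle T C"
      using operators[OF e(1)[of k]] by blast
    show ?thesis
      unfolding u_def b_def by (rule rescaled_series_weak_bound[OF T p f supp e(1,2,3) t])
  qed
  then show ?thesis
    using emeasure_level_le_of_AE_limit[OF um vm AE_I2[OF ulim], of t] by simp
qed

text \<open>Translating \<open>f\<close> by a large \<open>m\<close> moves its support into \<open>[0, 2 m]\<close> and the window that the
  one-sided bound sees to \<open>[- m, \<infinity>)\<close>. The windows exhaust the line as \<open>m\<close> grows.\<close>
lemma test_function_weak_bound:
  assumes f: "test_function f" and t: "t > 0"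
  shows "emeasure lebesgue {y. norm (multiplier_transform \<phi> f y) > t}
    \<le> ennreal (C powr p / t powr p) * power_mass p lebesgue f"
proof -
  obtain R where R: "R > 0" "\<And>x. \<bar>x\<bar> > R \<Longrightarrow> f x = 0"
    using test_function_bounded_support[OF f] by metis
  note fm = test_function_measurable[OF f] and Mm = multiplier_transform_measurable[OF f]
  define u where "u m z = indicator {- real m..} z * multiplier_transform \<phi> f z" for m z
  have um: "u m \<in> borel_measurable lebesgue" for m
    unfolding u_def using Mm by (intro borel_measurable_times borel_measurable_indicator) auto
  have ulim: "(\<lambda>m. u m z) \<longlonglongrightarrow> multiplier_transform \<phi> f z" for z
  proof (rule tendsto_eventually)
    obtain N where "- z \<le> real N" using real_arch_simple by blast
    then show "eventually (\<lambda>m. u m z = multiplier_transform \<phi> f z) sequentially"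
      by (intro eventually_sequentiallyI[of N]) (auto simp: u_def)
  qed
  obtain N where N: "R \<le> real N" using real_arch_simple by blast
  have "emeasure lebesgue {z. norm (u m z) > t} \<le> ennreal (C powr p / t powr p) * power_mass p lebesgue f" if "m \<ge> N" for m
  proof -
    define g where "g x = f (x - real m)" for x
    have g: "test_function g" unfolding g_def by (rule test_function_translate[OF f])
    have Rm: "R \<le> real m" using N that by linarith
    have "{z \<in> space lebesgue. norm (u m z) > t} \<in> sets lebesgue"
      using um[of m] by measurable
    then have "{z. norm (u m z) > t} \<in> sets lebesgue" by simp
    from emeasure_lebesgue_affine_preimage[OF this, of 1 "- real m"]
    have "emeasure lebesgue {z. norm (u m z) > t} = emeasure lebesgue {y. norm (u m (y - real m)) > t}" by simp
    also have "{y. norm (u m (y - real m)) > t} = {y. norm (indicator {0..} y * multiplier_transform \<phi> g y) > t}"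
      unfolding u_def g_def multiplier_transform_translate[OF f]
      by (intro Collect_cong) (simp add: indicator_def)
    also have "emeasure lebesgue \<dots> \<le> ennreal (C powr p / t powr p) * power_mass p lebesgue g"
      using Rm R by (intro one_sided_weak_bound[OF g, of "2 * real m"] t) (auto simp: g_def)
    also have "power_mass p lebesgue g = power_mass p lebesgue f"
      unfolding g_def by (rule power_mass_translate[OF fm])
    finally show ?thesis .
  qed
  then have "eventually (\<lambda>m. emeasure lebesgue {z \<in> space lebesgue. norm (u m z) > t}
      \<le> ennreal (C powr p / t powr p) * power_mass p lebesgue f) sequentially"
    by (intro eventually_sequentiallyI[of N]) simp
  from emeasure_level_le_of_AE_limit[OF um Mm AE_I2[OF ulim] this] show ?thesis by simp
qed

end

lemma weak_type_bound_mono: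
  assumes W: "weak_type_bound p M T C" and C: "C \<le> C'" and p: "p > 0"
  shows "weak_type_bound p M T C'"
  unfolding weak_type_bound_def
proof (intro conjI ballI allI impI)
  have C0: "0 \<le> C" using W by (simp add: weak_type_bound_def)
  then show "0 \<le> C'" using C by simp
  fix f and t :: real assume "f \<in> Lp p M" "t > 0"
  then have "emeasure M {x \<in> space M. norm (T f x) > t} \<le> ennreal (C powr p / t powr p * (LINT x|M. norm (f x) powr p))"
    using W by (simp add: weak_type_bound_def)
  also have "\<dots> \<le> ennreal (C' powr p / t powr p * (LINT x|M. norm (f x) powr p))"
    using C C0 p by (intro ennreal_leI mult_right_mono divide_right_mono powr_mono2) auto
  finally show "emeasure M {x \<in> space M. norm (T f x) > t} \<le> ennreal (C' powr p / t powr p * (LINT x|M. norm (f x) powr p))" .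
qed

lemma weak_norm_int_nonneg:
  assumes "\<psi> \<in> weak_multipliers_int p" shows "weak_norm_int p \<psi> \<ge> 0"
  unfolding weak_norm_int_def weak_multiplier_norm_def
proof (rule cInf_greatest)
  show "{C. \<exists>T. circle_multiplier_operator p \<psi> T \<and> weak_type_bound p circle T C} \<noteq> {}"
    using assms unfolding weak_multipliers_int_def weak_multipliers_def by blast
qed (auto simp: weak_type_bound_def)

text \<open>The infimum in the definition of the norm is approached by constants of actual operators.\<close>
lemma weak_multiplier_int_operator:
  assumes \<psi>: "\<psi> \<in> weak_multipliers_int p" and C: "weak_norm_int p \<psi> < C" and p: "p > 0"
  shows "\<exists>T. circle_multiplier_operator p \<psi> T \<and> weak_type_bound p circle T C"
proof -
  let ?A = "{C. \<exists>T. circle_multiplier_operator p \<psi> T \<and> weak_type_bound p circle T C}"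
  have ne: "?A \<noteq> {}" using \<psi> unfolding weak_multipliers_int_def weak_multipliers_def by blast
  have lt: "Inf ?A < C" using C by (simp add: weak_norm_int_def weak_multiplier_norm_def)
  from cInf_lessD[OF ne lt] obtain D where "D \<in> ?A" "D < C" by blast
  then obtain T where "circle_multiplier_operator p \<psi> T" "weak_type_bound p circle T D" "D < C" by blast
  then show ?thesis using weak_type_bound_mono[OF _ less_imp_le p] by blast
qed

lemma le_of_shrinking_constant_ennreal:
  assumes K: "K \<ge> 0" and p: "p > 0" and A: "A \<ge> 0" and c: "c > 0"
    and le: "\<And>n. X \<le> ennreal ((K + 1 / real (Suc n)) powr p / c) * ennreal A"
  shows "X \<le> ennreal (K powr p / c) * ennreal A"
proof -
  have "(\<lambda>n. 1 / real (Suc n)) \<longlonglongrightarrow> 0"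
    using LIMSEQ_inverse_real_of_nat by (simp only: inverse_eq_divide)
  then have "(\<lambda>n. K + 1 / real (Suc n)) \<longlonglongrightarrow> K + 0"
    by (intro tendsto_add tendsto_const)
  then have "(\<lambda>n. (K + 1 / real (Suc n)) powr p) \<longlonglongrightarrow> (K + 0) powr p"
    using K p by (intro tendsto_powr2[OF _ tendsto_const]) auto
  then have "(\<lambda>n. (K + 1 / real (Suc n)) powr p / c * A) \<longlonglongrightarrow> (K + 0) powr p / c * A"
    using c by (intro tendsto_mult tendsto_divide tendsto_const) auto
  then have lim: "(\<lambda>n. ennreal ((K + 1 / real (Suc n)) powr p / c * A)) \<longlonglongrightarrow> ennreal (K powr p / c * A)"
    using tendsto_ennrealI by (simp only: add_0_right)
  have e: "ennreal (B powr p / c) * ennreal A = ennreal (B powr p / c * A)" for B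
    using c A by (intro ennreal_mult[symmetric]) auto
  have "X \<le> ennreal (K powr p / c * A)"
    by (rule LIMSEQ_le_const[OF lim]) (use le in \<open>simp only: e, blast\<close>)
  then show ?thesis by (simp only: e)
qed

theorem theorem4p1:
  fixes p :: real
    and \<Phi> :: "real \<Rightarrow> int \<Rightarrow> complex"
    and \<phi> :: "real \<Rightarrow> complex"
  assumes "1 < p"
    and "\<And>\<epsilon>. \<epsilon> > 0 \<Longrightarrow> \<Phi> \<epsilon> \<in> weak_multipliers_int p"
    and "AE x in lebesgue. ((\<lambda>\<epsilon>. \<Phi> \<epsilon> \<lfloor>x / \<epsilon>\<rfloor>) \<longlongrightarrow> \<phi> x) (at_right 0)"
    and "bdd_above ((\<lambda>\<epsilon>. weak_norm_int p (\<Phi> \<epsilon>)) ` {0<..})"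
  shows "\<phi> \<in> weak_multipliers_real p \<and>
    weak_norm_real p \<phi> \<le> (SUP \<epsilon>\<in>{0<..}. weak_norm_int p (\<Phi> \<epsilon>))"
proof -
  define K where "K = (SUP \<epsilon>\<in>{0<..}. weak_norm_int p (\<Phi> \<epsilon>))"
  have p: "p > 0" using assms(1) by simp
  have norm_le: "weak_norm_int p (\<Phi> \<epsilon>) \<le> K" if "\<epsilon> > 0" for \<epsilon>
    unfolding K_def using that by (intro cSUP_upper assms(4)) simp
  have K: "K \<ge> 0"
    using norm_le[of 1] weak_norm_int_nonneg[OF assms(2)[of 1]] by simp
  have operators: "\<exists>T. circle_multiplier_operator p (\<Phi> \<epsilon>) T \<and> weak_type_bound p circle T C"
    if "\<epsilon> > 0" "C > K" for \<epsilon> C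
    using norm_le[OF that(1)] that(2) by (intro weak_multiplier_int_operator assms(2) that(1) p) simp
  have \<Phi>_le: "norm (\<Phi> \<epsilon> n) \<le> K + 1" if "\<epsilon> > 0" for \<epsilon> n
    using operators[OF that, of "K + 1"] circle_multiplier_symbol_bound[OF _ _ p] by auto
  have bound: "AE x in lebesgue. norm (\<phi> x) \<le> K + 1"
    using assms(3)
  proof eventually_elim
    case (elim x)
    have "eventually (\<lambda>\<epsilon>. norm (\<Phi> \<epsilon> \<lfloor>x / \<epsilon>\<rfloor>) \<le> K + 1) (at_right 0)"
      using eventually_at_right_less[of "0::real"] by eventually_elim (rule \<Phi>_le)
    from Lim_norm_ubound[OF _ elim this] show ?case by simp
  qed
  \<comment> \<open>The symbol is measurable because it is an almost everywhere limit along a sequence of mesh sizes.\<close>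
  let ?e = "sampling_step 0"
  define g where "g x = lim (\<lambda>k. \<Phi> (?e k) \<lfloor>x / ?e k\<rfloor>)" for x
  have "(\<lambda>x. \<Phi> (?e k) \<lfloor>x / ?e k\<rfloor>) \<in> borel_measurable lebesgue" for k
    by (rule measurable_compose[OF floor_div_measurable]) simp
  then have g: "g \<in> borel_measurable lebesgue"
    unfolding g_def by (rule borel_measurable_lim_metric)
  have e: "filterlim ?e (at_right 0) sequentially"
    using sampling_step(1)[of 0] sampling_step_tendsto[of 0]
    by (simp add: filterlim_at greaterThan_def less_imp_neq[symmetric])
  have "AE x in lebesgue. g x = \<phi> x"
    using assms(3)
  proof eventually_elim
    case (elim x)
    from filterlim_compose[OF elim e] show ?case unfolding g_def by (rule limI)
  qed
  with g have meas: "\<phi> \<in> borel_measurable lebesgue" by (rule borel_measurable_AE)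
  interpret S: bounded_symbol "K + 1" \<phi>
    using meas bound by unfold_locales
  have weak: "emeasure lebesgue {x. norm (multiplier_transform \<phi> f x) > t}
      \<le> ennreal (K powr p / t powr p) * power_mass p lebesgue f" if f: "test_function f" and t: "t > 0" for f t
  proof -
    have "emeasure lebesgue {x. norm (multiplier_transform \<phi> f x) > t}
      \<le> ennreal ((K + 1 / real (Suc n)) powr p / t powr p) * power_mass p lebesgue f" for n
    proof -
      interpret circle_multiplier_family "K + 1" \<phi> p "K + 1 / real (Suc n)" \<Phi>
        using p operators assms(3) by unfold_locales auto
      show ?thesis by (rule test_function_weak_bound[OF f t])
    qed
    note le = this[unfolded power_mass_eq_integral[OF test_function_Lp[OF f p]]]
    show ?thesis
      unfolding power_mass_eq_integral[OF test_function_Lp[OF f p]]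
      by (rule le_of_shrinking_constant_ennreal[OF K p _ _ le]) (use t in simp_all)
  qed
  interpret W: weak_type_symbol "K + 1" \<phi> p K
    using p K weak by unfold_locales
  obtain T where T: "is_multiplier_operator p lebesgue (\<lambda>y x. x - y) has_fourier_real \<phi> T"
    "weak_type_bound p lebesgue T K"
    by (rule W.multiplier_operator_exists)
  have "\<phi> \<in> Linfty lebesgue"
    unfolding Linfty_def by (intro CollectI conjI exI[of _ "K + 1"] meas bound)
  then have "\<phi> \<in> weak_multipliers_real p"
    unfolding weak_multipliers_real_def weak_multipliers_def
    by (intro CollectI conjI exI[of _ T] exI[of _ K] T)
  moreover have "weak_norm_real p \<phi> \<le> K"
    unfolding weak_norm_real_def weak_multiplier_norm_def
  proof (rule cInf_lower)
    show "K \<in> {C. \<exists>T. is_multiplier_operator p lebesgue (\<lambda>y x. x - y) has_fourier_real \<phi> T \<and> weak_type_bound p lebesgue T C}"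
      by (intro CollectI conjI exI[of _ T] T)
  qed (auto intro!: bdd_belowI[of _ 0] simp: weak_type_bound_def)
  ultimately show ?thesis by (simp add: K_def)
qed

end
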